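(* Let $\hbar\in\mathbb{R}_{>0}\setminus\mathbb{Q}$, let $\Gamma$ be a $\mathcal{D}$-seed with exchange matrix $\varepsilon$ and skew-symmetrizer $d$, and let $\Gamma'=\mu_k(\Gamma)$ for some $k\in\{1,\dots,n\}$. Write $\mathbf{K}'=\mathbf{K}'_{\Gamma\stackrel{k}{\to}\Gamma'}$. One has $$\mathbf{K}'\,\widehat{\mathbf x}^\hbar_{\Gamma';i}\,(\mathbf{K}')^{-1}=\widehat{\mathbf x}^\hbar_{\Gamma;i}+[\varepsilon_{ik}]_+\,\widehat{\mathbf x}^\hbar_{\Gamma;k},\qquad \forall i\neq k,$$ $$\mathbf{K}'\,\widehat{\widetilde{\mathbf x}}{}^\hbar_{\Gamma';i}\,(\mathbf{K}')^{-1}=\widehat{\widetilde{\mathbf x}}{}^\hbar_{\Gamma;i}+[\varepsilon_{ik}]_+\,\widehat{\widetilde{\mathbf x}}{}^\hbar_{\Gamma;k},\qquad \forall i\neq k,$$ $$\mathbf{K}'\,\widehat{\mathbf x}^\hbar_{\Gamma';k}\,(\mathbf{K}')^{-1}=-\widehat{\mathbf x}^\hbar_{\Gamma;k},\qquad \mathbf{K}'\,\widehat{\widetilde{\mathbf x}}{}^\hbar_{\Gamma';k}\,(\mathbf{K}')^{-1}=-\widehat{\widetilde{\mathbf x}}{}^\hbar_{\Gamma;k},$$ as equalities on $D_\Gamma$, when the operators $\widehat{\mathbf x}^\hbar_{\Gamma';i}$ and $\widehat{\mathbf x}^\hbar_{\Gamma;i}$ (and their tilde versions) are taken to be given by the "old"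 formulas. These equalities do NOT hold when the operators are taken from the "new" formulas. If $\widehat{\mathbf x}^\hbar_{\Gamma';i}$ and $\widehat{\mathbf x}^\hbar_{\Gamma;i}$ are replaced by their unique self-adjoint extensions, each equality still holds on the domain of the self-adjoint extension of either side of the equation.
   Context: **Seeds and mutations.** $n\ge1$ is fixed; $[a]_+=\max(a,0)$. A $\mathcal{D}$-seed $\Gamma$ consists of an exchange matrix $\varepsilon=(\varepsilon_{ij})\in\mathbb{Z}^{n\times n}$, a skew-symmetrizer $d=(d_1,\dots,d_n)$ of positive integers such that $\varepsilon_{ij}d_j^{-1}=-\varepsilon_{ji}d_i^{-1}$ for all $i,j$, and cluster variables $B_1,\dots,B_n,X_1,\dots,X_n$ (which play no role here). The mutated seed $\Gamma'=\mu_k(\Gamma)$ has $d'=d$, $\varepsilon'_{ij}=-\varepsilon_{ij}$ if $i=k$ or $j=k$, and $\varepsilon'_{ij}=\varepsilon_{ij}+\frac12(|\varepsilon_{ik}|\varepsilon_{kj}+\varepsilon_{ik}|\varepsilon_{kj}|)$ otherwise. **Hilbert spaces and operators.** $\mathscr{H}_\Gamma=L^2(\mathbb{R}^n,da_1\cdots da_n)$, and $D_\Gamma\subset\mathscr{H}_\Gamma$ is the dense complex span of the functions $e^{-\sum_i(\alpha_ia_i^2+\beta_ia_i)}P(a_1,\dots,a_n)$ with $\alpha_i,\beta_i\in\mathbb{C}$, $\mathrm{Re}(\alpha_i)>0$, and $P$ a complex polynomial. $\mathscr{H}_{\Gamma'}$ and $D_{\Gamma'}$ are defined in the same way with variables $a'_1,\dots,a'_n$.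 On $D_\Gamma$ put $\widehat{\mathbf q}^\hbar_{\Gamma;i}=a_i$ (multiplication) and $\widehat{\mathbf p}^\hbar_{\Gamma;i}=2\pi\sqrt{-1}\,\hbar\,\frac{\partial}{\partial a_i}$; similarly on $D_{\Gamma'}$ with $a'_i$ in place of $a_i$. Old formulas, on $D_\Gamma$: $\widehat{\mathbf x}^\hbar_{\Gamma;i}=\frac12d_i^{-1}\widehat{\mathbf p}^\hbar_{\Gamma;i}-\sum_{j=1}^n\varepsilon_{ij}\widehat{\mathbf q}^\hbar_{\Gamma;j}$ and $\widehat{\widetilde{\mathbf x}}{}^\hbar_{\Gamma;i}=\frac12d_i^{-1}\widehat{\mathbf p}^\hbar_{\Gamma;i}+\sum_{j=1}^n\varepsilon_{ij}\widehat{\mathbf q}^\hbar_{\Gamma;j}$. New formulas, on $D_\Gamma$: $\widehat{\mathbf x}^\hbar_{\Gamma;i}=d_i^{-1}\widehat{\mathbf p}^\hbar_{\Gamma;i}-\sum_{j=1}^n[\varepsilon_{ij}]_+\widehat{\mathbf q}^\hbar_{\Gamma;j}$ and $\widehat{\widetilde{\mathbf x}}{}^\hbar_{\Gamma;i}=d_i^{-1}\widehat{\mathbf p}^\hbar_{\Gamma;i}-\sum_{j=1}^n[-\varepsilon_{ij}]_+\widehat{\mathbf q}^\hbar_{\Gamma;j}$. The operators for $\Gamma'$ are given on $D_{\Gamma'}$ by the same formulas with $\varepsilon'$, $d'=d$, $\widehat{\mathbf p}^\hbar_{\Gamma';i}$, $\widehat{\mathbf q}^\hbar_{\Gamma';j}$.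 These operators are essentially self-adjoint on $D_\Gamma$, respectively $D_{\Gamma'}$. **The map $\mathbf{K}'$.** $\mathbf{K}'_{\Gamma\stackrel{k}{\to}\Gamma'}:\mathscr{H}_{\Gamma'}\to\mathscr{H}_\Gamma$ is the unitary map $(\mathbf{K}'f)(a_1,\dots,a_n)=f(a'_1,\dots,a'_n)$, where on the right-hand side one substitutes $a'_i=a_i$ for $i\neq k$ and $a'_k=-a_k+\sum_{j=1}^n[-\varepsilon_{kj}]_+a_j$.
   Formalization: For the "new" formulas, failure is claimed for the i-th equality only if ε_ik≠0 and for the k-th only if row k of ε is nonzero (otherwise they hold, e.g. n=1); on D_Γ, x' acts on (K')^{-1}f as a differential expression, since (K')^{-1}f may leave D_Γ'. *)

theory Defs
  imports "HOL-Analysis.Analysis"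
begin

text \<open>
  The index set \<open>{1, ..., n}\<close> is the finite type \<open>'n\<close>. The cluster variables of a seed are left
  out: neither the mutation of the exchange matrix nor the operators below depend on them.
\<close>

record 'n seed =
  exch :: "int ^ 'n ^ 'n"
  skew :: "nat ^ 'n"

definition D_seed :: "'n::finite seed \<Rightarrow> bool" where
  "D_seed \<Gamma> \<longleftrightarrow> (\<forall>i. skew \<Gamma> $ i > 0) \<and>
     (\<forall>i j. real_of_int (exch \<Gamma> $ i $ j) * inverse (real (skew \<Gamma> $ j)) =
            - real_of_int (exch \<Gamma> $ j $ i) * inverse (real (skew \<Gamma> $ i)))"

text \<open>The division by two is exact: \<open>\<bar>x\<bar> * y + x * \<bar>y\<bar>\<close> is zero or \<open>\<plusminus> 2 * x * y\<close>.\<close>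

definition mutation :: "'n::finite \<Rightarrow> 'n seed \<Rightarrow> 'n seed" where
  "mutation k \<Gamma> = \<Gamma>\<lparr>exch := \<chi> i j.
     if i = k \<or> j = k then - exch \<Gamma> $ i $ j
     else exch \<Gamma> $ i $ j +
       (\<bar>exch \<Gamma> $ i $ k\<bar> * exch \<Gamma> $ k $ j + exch \<Gamma> $ i $ k * \<bar>exch \<Gamma> $ k $ j\<bar>) div 2\<rparr>"

definition pos_part :: "int \<Rightarrow> int" where
  "pos_part x = max x 0"

definition square_integrable :: "(real ^ 'n::finite \<Rightarrow> complex) set" where
  "square_integrable =
     {f \<in> borel_measurable borel. integrable lborel (\<lambda>a. (cmod (f a))\<^sup>2)}"

lemma borel_measurable_cnj [measurable]:
  "cnj \<in> borel_measurable borel"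
  by (intro borel_measurable_continuous_onI continuous_on_cnj continuous_on_id)

lemma square_integrable_zero: "(\<lambda>a. 0) \<in> square_integrable"
  by (simp add: square_integrable_def)

lemma square_integrable_cmult:
  assumes "f \<in> square_integrable"
  shows "(\<lambda>a. c * f a) \<in> square_integrable"
  using assms by (auto simp: square_integrable_def norm_mult power_mult_distrib)

lemma square_integrable_add:
  assumes "f \<in> square_integrable" "g \<in> square_integrable"
  shows "(\<lambda>a. f a + g a) \<in> square_integrable"
proof -
  have [measurable]: "f \<in> borel_measurable borel" "g \<in> borel_measurable borel"
    using assms by (auto simp: square_integrable_def)
  have "(cmod (f a + g a))\<^sup>2 \<le> 2 * (cmod (f a))\<^sup>2 + 2 * (cmod (g a))\<^sup>2" for a
  proof -
    have "(cmod (f a + g a))\<^sup>2 \<le> (cmod (f a) + cmod (g a))\<^sup>2"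
      by (intro power_mono norm_triangle_ineq) auto
    also have "\<dots> \<le> 2 * (cmod (f a))\<^sup>2 + 2 * (cmod (g a))\<^sup>2"
      using zero_le_power2[of "cmod (f a) - cmod (g a)"] by (simp add: power2_sum power2_diff)
    finally show ?thesis .
  qed
  then have bound: "AE a in lborel.
      norm ((cmod (f a + g a))\<^sup>2) \<le> norm (2 * (cmod (f a))\<^sup>2 + 2 * (cmod (g a))\<^sup>2)"
    by (intro AE_I2) simp
  have "integrable lborel (\<lambda>a. 2 * (cmod (f a))\<^sup>2 + 2 * (cmod (g a))\<^sup>2)"
    using assms by (simp add: square_integrable_def)
  then have "integrable lborel (\<lambda>a. (cmod (f a + g a))\<^sup>2)"
    by (rule Bochner_Integration.integrable_bound [OF _ _ bound]) measurable
  then show ?thesis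
    by (simp add: square_integrable_def)
qed

lemma square_integrable_mult_cnj:
  assumes "f \<in> square_integrable" "g \<in> square_integrable"
  shows "integrable lborel (\<lambda>a. f a * cnj (g a))"
proof -
  have [measurable]: "f \<in> borel_measurable borel" "g \<in> borel_measurable borel"
    using assms by (auto simp: square_integrable_def)
  have "cmod (f a) * cmod (g a) \<le> (cmod (f a))\<^sup>2 + (cmod (g a))\<^sup>2" for a
    using sum_squares_bound[of "cmod (f a)" "cmod (g a)"]
      mult_nonneg_nonneg[OF norm_ge_zero[of "f a"] norm_ge_zero[of "g a"]]
    unfolding mult.assoc by linarith
  then have bound: "AE a in lborel.
      norm (f a * cnj (g a)) \<le> norm ((cmod (f a))\<^sup>2 + (cmod (g a))\<^sup>2)"
    by (intro AE_I2) (simp add: norm_mult)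
  have "integrable lborel (\<lambda>a. (cmod (f a))\<^sup>2 + (cmod (g a))\<^sup>2)"
    using assms by (simp add: square_integrable_def)
  then show ?thesis
    by (rule Bochner_Integration.integrable_bound [OF _ _ bound]) measurable
qed

definition l2_rel :: "(real ^ 'n::finite \<Rightarrow> complex) \<Rightarrow> (real ^ 'n \<Rightarrow> complex) \<Rightarrow> bool" where
  "l2_rel f g \<longleftrightarrow>
     f \<in> square_integrable \<and> g \<in> square_integrable \<and> (AE a in lborel. f a = g a)"

quotient_type (overloaded) 'n l2 = "real ^ ('n::finite) \<Rightarrow> complex" / partial: l2_rel
proof (rule part_equivpI)
  show "\<exists>f::real ^ 'n \<Rightarrow> complex. l2_rel f f"
    by (rule exI[of _ "\<lambda>a. 0"]) (simp add: l2_rel_def square_integrable_zero)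
  show "symp (l2_rel :: (real ^ 'n \<Rightarrow> complex) \<Rightarrow> _)"
    by (auto simp: symp_def l2_rel_def elim: AE_mp)
  show "transp (l2_rel :: (real ^ 'n \<Rightarrow> complex) \<Rightarrow> _)"
    by (auto simp: transp_def l2_rel_def elim: AE_mp)
qed

lift_definition cinner :: "'n::finite l2 \<Rightarrow> 'n l2 \<Rightarrow> complex" is
  "\<lambda>f g. LINT a|lborel. f a * cnj (g a)"
proof -
  fix f f' g g' :: "real ^ 'n \<Rightarrow> complex"
  assume "l2_rel f f'" "l2_rel g g'"
  then show "(LINT a|lborel. f a * cnj (g a)) = (LINT a|lborel. f' a * cnj (g' a))"
    by (intro integral_cong_AE) (auto simp: l2_rel_def square_integrable_def)
qed

instantiation l2 :: (finite) real_inner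
begin

lift_definition zero_l2 :: "'a l2" is "\<lambda>a. 0"
  by (simp add: l2_rel_def square_integrable_zero)

lift_definition plus_l2 :: "'a l2 \<Rightarrow> 'a l2 \<Rightarrow> 'a l2" is "\<lambda>f g a. f a + g a"
  by (auto simp: l2_rel_def square_integrable_add)

lift_definition scaleR_l2 :: "real \<Rightarrow> 'a l2 \<Rightarrow> 'a l2" is "\<lambda>r f a. complex_of_real r * f a"
  by (auto simp: l2_rel_def square_integrable_cmult)

definition uminus_l2 :: "'a l2 \<Rightarrow> 'a l2" where
  "uminus_l2 f = (-1) *\<^sub>R f"

definition minus_l2 :: "'a l2 \<Rightarrow> 'a l2 \<Rightarrow> 'a l2" where
  "minus_l2 f g = f + (- g)"

definition inner_l2 :: "'a l2 \<Rightarrow> 'a l2 \<Rightarrow> real" where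
  "inner_l2 f g = Re (cinner f g)"

definition norm_l2 :: "'a l2 \<Rightarrow> real" where
  "norm_l2 f = sqrt (inner f f)"

definition sgn_l2 :: "'a l2 \<Rightarrow> 'a l2" where
  "sgn_l2 f = scaleR (inverse (norm f)) f"

definition dist_l2 :: "'a l2 \<Rightarrow> 'a l2 \<Rightarrow> real" where
  "dist_l2 f g = norm (f - g)"

definition uniformity_l2 :: "('a l2 \<times> 'a l2) filter" where
  "uniformity_l2 = (INF e\<in>{0 <..}. principal {(f, g). dist f g < e})"

definition open_l2 :: "'a l2 set \<Rightarrow> bool" where
  "open_l2 U = (\<forall>f\<in>U. eventually (\<lambda>(f', g). f' = f \<longrightarrow> g \<in> U) uniformity)"

instance
proof
  fix f g h :: "'a l2" and r s :: real
  show "f + g + h = f + (g + h)"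
    by transfer (auto simp: l2_rel_def add.assoc intro!: square_integrable_add)
  show "f + g = g + f"
    by transfer (auto simp: l2_rel_def add.commute intro!: square_integrable_add)
  show "0 + f = f"
    by transfer (auto simp: l2_rel_def)
  show "- f + f = 0"
    unfolding uminus_l2_def
    by transfer (auto simp: l2_rel_def square_integrable_zero)
  show "f - g = f + - g"
    by (simp add: minus_l2_def)
  show "r *\<^sub>R (f + g) = r *\<^sub>R f + r *\<^sub>R g"
    by transfer (auto simp: l2_rel_def distrib_left distrib_right
        intro!: square_integrable_add square_integrable_cmult)
  show "(r + s) *\<^sub>R f = r *\<^sub>R f + s *\<^sub>R f"
    by transfer (auto simp: l2_rel_def distrib_left distrib_right
        intro!: square_integrable_add square_integrable_cmult)
  show "r *\<^sub>R s *\<^sub>R f = (r * s) *\<^sub>R f"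
    by transfer (use square_integrable_cmult[of _ "complex_of_real (_ * _)"]
        in \<open>auto simp: l2_rel_def mult.assoc intro!: square_integrable_cmult\<close>)
  show "1 *\<^sub>R f = f"
    by transfer (auto simp: l2_rel_def)
  show "dist f g = norm (f - g)"
    by (rule dist_l2_def)
  show "sgn f = inverse (norm f) *\<^sub>R f"
    by (rule sgn_l2_def)
  show "uniformity = (INF e\<in>{0 <..}. principal {(f::'a l2, g). dist f g < e})"
    by (rule uniformity_l2_def)
  show "open U = (\<forall>f\<in>U. eventually (\<lambda>(f', g). f' = f \<longrightarrow> g \<in> U) uniformity)"
    for U :: "'a l2 set"
    by (rule open_l2_def)
  show "norm f = sqrt (inner f f)"
    by (rule norm_l2_def)
  have "cinner f g = cnj (cinner g f)"
    using Bochner_Integration.integral_cnj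
        [of lborel "\<lambda>a. rep_l2 g a * cnj (rep_l2 f a)"]
    by (simp add: cinner.rep_eq mult.commute del: Bochner_Integration.integral_cnj)
  then show "inner f g = inner g f"
    by (simp add: inner_l2_def)
  have "cinner (f + g) h = cinner f h + cinner g h"
    by transfer (simp add: l2_rel_def distrib_right square_integrable_mult_cnj)
  then show "inner (f + g) h = inner f h + inner g h"
    by (simp add: inner_l2_def)
  have "cinner (r *\<^sub>R f) g = r * cinner f g"
    by transfer (simp add: mult.assoc)
  then show "inner (r *\<^sub>R f) g = r * inner f g"
    by (simp add: inner_l2_def)
  have cinner_self: "cinner f f = of_real (LINT a|lborel. (cmod (rep_l2 f a))\<^sup>2)"
    unfolding cinner.rep_eq complex_norm_square [symmetric] of_real_power [symmetric]
    by (rule integral_complex_of_real)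
  then show "0 \<le> inner f f"
    by (simp add: inner_l2_def)
  have rep: "rep_l2 f \<in> square_integrable"
    using Quotient3_rep_reflp[OF Quotient3_l2, of f] by (simp add: l2_rel_def)
  have "inner f f = 0 \<longleftrightarrow> (AE a in lborel. rep_l2 f a = 0)"
    using rep unfolding inner_l2_def cinner_self
    by (simp add: square_integrable_def integral_nonneg_eq_0_iff_AE)
  also have "\<dots> \<longleftrightarrow> l2_rel (rep_l2 f) (\<lambda>a. 0)"
    by (simp add: l2_rel_def rep square_integrable_zero)
  also have "\<dots> \<longleftrightarrow> f = 0"
    using Quotient3_rel [OF Quotient3_l2, of "rep_l2 f" "\<lambda>a. 0"]
    by (simp add: l2_rel_def rep square_integrable_zero zero_l2_def
        Quotient3_abs_rep [OF Quotient3_l2])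
  finally show "inner f f = 0 \<longleftrightarrow> f = 0" .
qed

end

text \<open>
  An unbounded operator is its graph, so that equality of operators includes equality of their
  domains, and inclusion of graphs is extension of operators.
\<close>

type_synonym 'n op = "('n l2 \<times> 'n l2) set"

definition op_add :: "'n::finite op \<Rightarrow> 'n op \<Rightarrow> 'n op" where
  "op_add S T = {(f, g + h) | f g h. (f, g) \<in> S \<and> (f, h) \<in> T}"

definition op_scale :: "real \<Rightarrow> 'n::finite op \<Rightarrow> 'n op" where
  "op_scale r T = {(f, r *\<^sub>R g) | f g. (f, g) \<in> T}"

definition op_conj :: "('n::finite l2 \<Rightarrow> 'n l2) \<Rightarrow> 'n op \<Rightarrow> 'n op" where
  "op_conj U T = {(f, U g) | f g. (inv U f, g) \<in> T}"

definition op_adjoint :: "'n::finite op \<Rightarrow> 'n op" where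
  "op_adjoint T = {(g, h). \<forall>(f, f') \<in> T. cinner f' g = cinner f h}"

definition self_adjoint :: "'n::finite op \<Rightarrow> bool" where
  "self_adjoint T \<longleftrightarrow> closure (Domain T) = UNIV \<and> op_adjoint T = T"

definition unique_sa_extension :: "'n::finite op \<Rightarrow> bool" where
  "unique_sa_extension T \<longleftrightarrow> (\<exists>!A. self_adjoint A \<and> T \<subseteq> A)"

definition sa_extension :: "'n::finite op \<Rightarrow> 'n op" where
  "sa_extension T = (THE A. self_adjoint A \<and> T \<subseteq> A)"

definition same_sa_extension :: "'n::finite op \<Rightarrow> 'n op \<Rightarrow> bool" where
  "same_sa_extension S T \<longleftrightarrow>
     unique_sa_extension S \<and> unique_sa_extension T \<and> sa_extension S = sa_extension T"

definition gaussian_poly :: "(real ^ 'n::finite \<Rightarrow> complex) set" where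
  "gaussian_poly =
     {\<lambda>a. exp (- (\<Sum>i\<in>UNIV. \<alpha> $ i * complex_of_real ((a $ i)\<^sup>2) + \<beta> $ i * complex_of_real (a $ i))) * P a
      | (\<alpha> :: complex ^ 'n) (\<beta> :: complex ^ 'n) (P :: real ^ 'n \<Rightarrow> complex).
        (\<forall>i. Re (\<alpha> $ i) > 0) \<and> polynomial_function P}"

text \<open>
  A \<open>polynomial_function\<close> with values in \<open>complex\<close> is a polynomial with complex coefficients, so
  this is the complex span of Gaussians times complex polynomials. As a set of functions on
  \<open>\<real>\<^sup>n\<close> it is the same for all seeds; only the name of the coordinates differs.
\<close>

definition D_dom :: "(real ^ 'n::finite \<Rightarrow> complex) set" where
  "D_dom = {\<lambda>a. \<Sum>g\<in>G. c g * g a | G c. finite G \<and> G \<subseteq> gaussian_poly}"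

definition partial_deriv :: "'n::finite \<Rightarrow> (real ^ 'n \<Rightarrow> complex) \<Rightarrow> real ^ 'n \<Rightarrow> complex" where
  "partial_deriv i f a = vector_derivative (\<lambda>t. f (a + t *\<^sub>R axis i 1)) (at 0)"

definition q_hat :: "'n::finite \<Rightarrow> (real ^ 'n \<Rightarrow> complex) \<Rightarrow> real ^ 'n \<Rightarrow> complex" where
  "q_hat i f a = complex_of_real (a $ i) * f a"

definition p_hat :: "real \<Rightarrow> 'n::finite \<Rightarrow> (real ^ 'n \<Rightarrow> complex) \<Rightarrow> real ^ 'n \<Rightarrow> complex" where
  "p_hat hbar i f a = 2 * complex_of_real pi * \<i> * complex_of_real hbar * partial_deriv i f a"

text \<open>
  The formulas are differential expressions, and are applied to differentiable functions outside
  \<open>D_dom\<close> as well: the linear substitution in \<open>K_fun\<close> below creates mixed terms in the exponents,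
  so that \<open>K_fun k \<Gamma>\<close> does not preserve \<open>D_dom\<close>.
\<close>

definition x_old ::
    "real \<Rightarrow> 'n::finite seed \<Rightarrow> 'n \<Rightarrow> (real ^ 'n \<Rightarrow> complex) \<Rightarrow> real ^ 'n \<Rightarrow> complex" where
  "x_old hbar \<Gamma> i f a =
     1 / 2 * inverse (of_nat (skew \<Gamma> $ i)) * p_hat hbar i f a
     - (\<Sum>j\<in>UNIV. of_int (exch \<Gamma> $ i $ j) * q_hat j f a)"

definition xt_old ::
    "real \<Rightarrow> 'n::finite seed \<Rightarrow> 'n \<Rightarrow> (real ^ 'n \<Rightarrow> complex) \<Rightarrow> real ^ 'n \<Rightarrow> complex" where
  "xt_old hbar \<Gamma> i f a =
     1 / 2 * inverse (of_nat (skew \<Gamma> $ i)) * p_hat hbar i f a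
     + (\<Sum>j\<in>UNIV. of_int (exch \<Gamma> $ i $ j) * q_hat j f a)"

definition x_new ::
    "real \<Rightarrow> 'n::finite seed \<Rightarrow> 'n \<Rightarrow> (real ^ 'n \<Rightarrow> complex) \<Rightarrow> real ^ 'n \<Rightarrow> complex" where
  "x_new hbar \<Gamma> i f a =
     inverse (of_nat (skew \<Gamma> $ i)) * p_hat hbar i f a
     - (\<Sum>j\<in>UNIV. of_int (pos_part (exch \<Gamma> $ i $ j)) * q_hat j f a)"

definition xt_new ::
    "real \<Rightarrow> 'n::finite seed \<Rightarrow> 'n \<Rightarrow> (real ^ 'n \<Rightarrow> complex) \<Rightarrow> real ^ 'n \<Rightarrow> complex" where
  "xt_new hbar \<Gamma> i f a =
     inverse (of_nat (skew \<Gamma> $ i)) * p_hat hbar i f a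
     - (\<Sum>j\<in>UNIV. of_int (pos_part (- (exch \<Gamma> $ i $ j))) * q_hat j f a)"

definition op_on_D ::
    "((real ^ 'n::finite \<Rightarrow> complex) \<Rightarrow> real ^ 'n \<Rightarrow> complex) \<Rightarrow> 'n op" where
  "op_on_D F = {(abs_l2 f, abs_l2 (F f)) | f. f \<in> D_dom}"

definition K_subst :: "'n::finite \<Rightarrow> 'n seed \<Rightarrow> real ^ 'n \<Rightarrow> real ^ 'n" where
  "K_subst k \<Gamma> a = (\<chi> i. if i = k
     then - (a $ k) + (\<Sum>j\<in>UNIV. of_int (pos_part (- (exch \<Gamma> $ k $ j))) * a $ j)
     else a $ i)"

definition K_fun ::
    "'n::finite \<Rightarrow> 'n seed \<Rightarrow> (real ^ 'n \<Rightarrow> complex) \<Rightarrow> real ^ 'n \<Rightarrow> complex" where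
  "K_fun k \<Gamma> f a = f (K_subst k \<Gamma> a)"

text \<open>
  The choice of the representative is immaterial when \<open>D_seed \<Gamma>\<close>: then \<open>exch \<Gamma> $ k $ k = 0\<close>, and
  \<open>K_subst k \<Gamma>\<close> is a linear involution, which preserves Lebesgue measure.
\<close>

definition K_l2 :: "'n::finite \<Rightarrow> 'n seed \<Rightarrow> 'n l2 \<Rightarrow> 'n l2" where
  "K_l2 k \<Gamma> f = abs_l2 (K_fun k \<Gamma> (rep_l2 f))"

end

theory Submission
  imports Defs "HOL-Probability.Distributions"
begin

text \<open>
  All operators in question are first-order expressions
  \<open>L f = \<i> \<partial>\<^sub>w f + (l \<bullet> a) f\<close> with a real direction \<open>w\<close> and a real covector \<open>l\<close>
  (\<open>lin_op w l\<close>; \<open>x_old_eq_lin_op\<close>, \<open>x_new_eq_lin_op\<close>). The substitution \<open>\<kappa> = K_subst k \<Gamma>\<close> is a linear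
  involution, so by the chain rule conjugation by it replaces the pair \<open>(w, l)\<close> by
  \<open>(\<kappa> w, l \<circ> \<kappa>)\<close>. The equalities of functions thus become equalities between such pairs. For the
  directions they express skew-symmetrizability (\<open>K_subst_momentum_dir\<close>), for the covectors of the
  old formulas they express matrix mutation (\<open>exch_row_K_subst\<close>). For the new formulas the
  directions still match but the covectors do not: they differ at a coordinate vector, where a
  Gaussian does not vanish.

  For the self-adjoint extensions, \<open>L\<close> is related to the explicit unitary group
  \<open>(U\<^sub>t f) a = cis (- (t (l \<bullet> a) + t\<^sup>2 / 2 (l \<bullet> w))) * f (a + t w)\<close>. It solves
  \<open>\<partial>\<^sub>t U\<^sub>t f = - \<i> L U\<^sub>t f\<close>, and it maps the span \<open>D\<close> of the Gaussians to itself, because translations and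
  linear phases only change the linear term of the exponent, the polynomial and a constant factor.
  The weak generator of the group, which consists of the pairs \<open>(g, h)\<close> such that \<open>\<langle>U\<^sub>t g, u\<rangle>\<close> has
  derivative \<open>- \<i> \<langle>h, u\<rangle>\<close> at \<open>0\<close> for all \<open>u\<close>, is symmetric since \<open>U\<^sub>t\<close> is unitary, and it extends
  \<open>L\<close> on \<open>D\<close> by a Taylor estimate. Conversely it contains the adjoint of \<open>L\<close> on \<open>D\<close>
  (\<open>adjoint_subset_generator\<close>): for \<open>f\<close> in \<open>D\<close> the function \<open>\<langle>U\<^sub>t f, g\<rangle>\<close> has derivative
  \<open>- \<i> \<langle>U\<^sub>t f, h\<rangle>\<close> whenever \<open>(g, h)\<close> is in the adjoint, and density of \<open>D\<close>
  (\<open>D_dom_dense\<close>) extends this at \<open>t = 0\<close> to all square-integrable \<open>f\<close>. Hence the generator is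
  self-adjoint, and it is the only self-adjoint extension of every symmetric operator that extends
  \<open>L\<close> on \<open>D\<close> (\<open>symmetric_extension_unique_sa\<close>). The sums and multiples of operators in the theorem, of
  restrictions to \<open>D\<close> as well as of self-adjoint extensions, are of this kind.

  It remains to treat the conjugated operators. The conjugate of \<open>L\<close> on \<open>D\<close> has the domain \<open>K D\<close>, which
  is in general different from \<open>D\<close>. Here
  groups are easier to compare than operators: \<open>K\<close> conjugates the group of \<open>(w, l)\<close> into the group of
  \<open>(\<kappa> w, l \<circ> \<kappa>)\<close> on the whole Hilbert space (\<open>K_l2_shift_op\<close>), so it does the same with the
  generators.
\<close>

section \<open>The Hilbert space of square-integrable functions\<close>

lemma rep_l2_mem [simp]: "rep_l2 F \<in> square_integrable"
  using Quotient3_rep_reflp[OF Quotient3_l2, of F] by (simp add: l2_rel_def)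

lemma abs_rep_l2 [simp]: "abs_l2 (rep_l2 F) = F"
  by (rule Quotient3_abs_rep [OF Quotient3_l2])

lemma abs_l2_eq_iff:
  assumes "f \<in> square_integrable" "g \<in> square_integrable"
  shows "abs_l2 f = abs_l2 g \<longleftrightarrow> (AE a in lborel. f a = g a)"
  using Quotient3_rel [OF Quotient3_l2, of f g] assms by (simp add: l2_rel_def)

lemma rep_abs_l2_AE:
  assumes "f \<in> square_integrable"
  shows "AE a in lborel. rep_l2 (abs_l2 f) a = f a"
  using abs_l2_eq_iff[OF rep_l2_mem assms, of "abs_l2 f"] by simp

lemma abs_l2_cases:
  obtains f where "f \<in> square_integrable" "F = abs_l2 f"
  using abs_rep_l2 rep_l2_mem by metis

lemma cinner_abs_l2:
  assumes "f \<in> square_integrable" "g \<in> square_integrable"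
  shows "cinner (abs_l2 f) (abs_l2 g) = (LINT a|lborel. f a * cnj (g a))"
  using assms by (simp add: cinner.abs_eq l2_rel_def)

lemma add_abs_l2:
  assumes "f \<in> square_integrable" "g \<in> square_integrable"
  shows "abs_l2 f + abs_l2 g = abs_l2 (\<lambda>a. f a + g a)"
  using assms by (simp add: plus_l2.abs_eq l2_rel_def)

lemma scaleR_abs_l2:
  assumes "f \<in> square_integrable"
  shows "r *\<^sub>R abs_l2 f = abs_l2 (\<lambda>a. complex_of_real r * f a)"
  using assms by (simp add: scaleR_l2.abs_eq l2_rel_def)

lemma square_integrable_uminus:
  "f \<in> square_integrable \<Longrightarrow> (\<lambda>a. - f a) \<in> square_integrable"
  using square_integrable_cmult[of f "-1"] by simp

lemma square_integrable_diff:
  "f \<in> square_integrable \<Longrightarrow> g \<in> square_integrable \<Longrightarrow> (\<lambda>a. f a - g a) \<in> square_integrable"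
  using square_integrable_add[OF _ square_integrable_uminus, of f g] by simp

lemma diff_abs_l2:
  assumes "f \<in> square_integrable" "g \<in> square_integrable"
  shows "abs_l2 f - abs_l2 g = abs_l2 (\<lambda>a. f a - g a)"
  using add_abs_l2[OF assms(1) square_integrable_uminus[OF assms(2)]] scaleR_abs_l2[OF assms(2), of "-1"]
  by (metis (no_types, lifting) ext diff_conv_add_uminus mult_minus1 of_real_1 of_real_minus scaleR_minus1_left)

lemma cinner_commute: "cinner F G = cnj (cinner G F)"
  unfolding cinner.rep_eq
  using Bochner_Integration.integral_cnj [of lborel "\<lambda>a. rep_l2 G a * cnj (rep_l2 F a)"]
  by (simp add: mult.commute del: Bochner_Integration.integral_cnj)

lemma cinner_add_left: "cinner (F + G) H = cinner F H + cinner G H"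
  by transfer (simp add: l2_rel_def distrib_right square_integrable_mult_cnj)

lemma cinner_scaleR_left: "cinner (r *\<^sub>R F) G = of_real r * cinner F G"
  by transfer (simp add: mult.assoc)

lemma cinner_diff_left: "cinner (F - G) H = cinner F H - cinner G H"
  using cinner_add_left[of "F - G" G H] by simp

lemma cinner_add_right: "cinner F (G + H) = cinner F G + cinner F H"
  by (metis cinner_add_left cinner_commute complex_cnj_add)

lemma cinner_scaleR_right: "cinner F (r *\<^sub>R G) = of_real r * cinner F G"
  by (metis cinner_scaleR_left cinner_commute complex_cnj_mult complex_cnj_complex_of_real)

lemma norm_abs_l2_power2:
  assumes "f \<in> square_integrable"
  shows "(norm (abs_l2 f))\<^sup>2 = (LINT a|lborel. (cmod (f a))\<^sup>2)"
proof -
  have "cinner (abs_l2 f) (abs_l2 f) = of_real (LINT a|lborel. (cmod (f a))\<^sup>2)"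
    unfolding cinner_abs_l2[OF assms assms] complex_norm_square [symmetric] of_real_power [symmetric]
    by (rule integral_complex_of_real)
  then have "inner (abs_l2 f) (abs_l2 f) = (LINT a|lborel. (cmod (f a))\<^sup>2)"
    by (simp add: inner_l2_def)
  then show ?thesis
    by (simp add: power2_norm_eq_inner)
qed

lemma square_integrable_dominated:
  assumes "f \<in> borel_measurable borel" "g \<in> square_integrable"
    and "\<And>a. cmod (f a) \<le> c * cmod (g a)"
  shows "f \<in> square_integrable"
proof -
  have *: "(cmod (f a))\<^sup>2 \<le> c\<^sup>2 * (cmod (g a))\<^sup>2" for a
    using power_mono[OF assms(3)[of a] norm_ge_zero, of 2] by (simp add: power_mult_distrib)
  have "integrable lborel (\<lambda>a. c\<^sup>2 * (cmod (g a))\<^sup>2)"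
    using assms(2) by (simp add: square_integrable_def)
  then have "integrable lborel (\<lambda>a. (cmod (f a))\<^sup>2)"
    by (rule Bochner_Integration.integrable_bound) (use assms(1) * in auto)
  then show ?thesis
    using assms(1) by (simp add: square_integrable_def)
qed

lemma norm_abs_l2_le:
  assumes "f \<in> square_integrable" "g \<in> square_integrable" "c \<ge> 0"
    and "\<And>a. cmod (f a) \<le> c * cmod (g a)"
  shows "norm (abs_l2 f) \<le> c * norm (abs_l2 g)"
proof (rule power2_le_imp_le)
  have *: "(cmod (f a))\<^sup>2 \<le> c\<^sup>2 * (cmod (g a))\<^sup>2" for a
    using power_mono[OF assms(4)[of a] norm_ge_zero, of 2] by (simp add: power_mult_distrib)
  have "(LINT a|lborel. (cmod (f a))\<^sup>2) \<le> (LINT a|lborel. c\<^sup>2 * (cmod (g a))\<^sup>2)"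
    by (rule integral_mono) (use assms * in \<open>auto simp: square_integrable_def\<close>)
  then show "(norm (abs_l2 f))\<^sup>2 \<le> (c * norm (abs_l2 g))\<^sup>2"
    using assms by (simp add: norm_abs_l2_power2 power_mult_distrib)
qed (use assms in auto)

text \<open>
  The real Cauchy-Schwarz inequality, applied to the absolute values of two functions, gives the
  complex one.
\<close>

lemma cinner_bound: "cmod (cinner F G) \<le> norm F * norm G"
proof -
  obtain f where f: "f \<in> square_integrable" "F = abs_l2 f" by (rule abs_l2_cases)
  obtain g where g: "g \<in> square_integrable" "G = abs_l2 g" by (rule abs_l2_cases)
  define f' where "f' = (\<lambda>a. complex_of_real (cmod (f a)))"
  define g' where "g' = (\<lambda>a. complex_of_real (cmod (g a)))"
  have f': "f' \<in> square_integrable" "g' \<in> square_integrable"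
    using f g by (auto simp: f'_def g'_def square_integrable_def)
  have eq: "cinner (abs_l2 f') (abs_l2 g') = of_real (LINT a|lborel. cmod (f a) * cmod (g a))"
    unfolding cinner_abs_l2[OF f'] integral_complex_of_real[symmetric] by (simp add: f'_def g'_def)
  have "cmod (cinner F G) \<le> (LINT a|lborel. cmod (f a) * cmod (g a))"
    unfolding f g cinner_abs_l2[OF f(1) g(1)]
    by (rule order_trans[OF integral_norm_bound]) (simp add: norm_mult)
  also have "\<dots> = inner (abs_l2 f') (abs_l2 g')"
    by (simp add: inner_l2_def eq)
  also have "\<dots> \<le> norm (abs_l2 f') * norm (abs_l2 g')"
    by (rule norm_cauchy_schwarz)
  also have "norm (abs_l2 f') = norm F"
    unfolding f by (intro antisym norm_abs_l2_le[where c = 1, simplified] f f') (auto simp: f'_def)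
  also have "norm (abs_l2 g') = norm G"
    unfolding g by (intro antisym norm_abs_l2_le[where c = 1, simplified] g f') (auto simp: g'_def)
  finally show ?thesis .
qed

text \<open>
  The common form of the unitary maps in this theory: composition with a measure-preserving map,
  followed by multiplication by a phase. Under the assumptions of the locale below the choice of the
  representative does not matter.
\<close>

definition weighted_comp ::
    "(real ^ 'n::finite \<Rightarrow> complex) \<Rightarrow> (real ^ 'n \<Rightarrow> real ^ 'n) \<Rightarrow> 'n l2 \<Rightarrow> 'n l2" where
  "weighted_comp m \<tau> F = abs_l2 (\<lambda>a. m a * rep_l2 F (\<tau> a))"

locale weighted_composition =
  fixes m :: "real ^ 'n::finite \<Rightarrow> complex" and \<tau> :: "real ^ 'n \<Rightarrow> real ^ 'n"
  assumes m_measurable [measurable]: "m \<in> borel_measurable borel"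
    and norm_m [simp]: "cmod (m a) = 1"
    and tau_measurable [measurable]: "\<tau> \<in> borel_measurable borel"
    and measure_preserving: "distr lborel borel \<tau> = lborel"
begin

lemma integral_comp:
  fixes f :: "real ^ 'n \<Rightarrow> 'b::{banach, second_countable_topology}"
  assumes "f \<in> borel_measurable borel"
  shows "(LINT a|lborel. f (\<tau> a)) = (LINT a|lborel. f a)"
  using integral_distr[of \<tau> lborel borel f] assms by (simp add: measure_preserving)

lemma integrable_comp:
  fixes f :: "real ^ 'n \<Rightarrow> 'b::{banach, second_countable_topology}"
  assumes "integrable lborel f"
  shows "integrable lborel (\<lambda>a. f (\<tau> a))"
  using integrable_distr[of \<tau> lborel borel f] assms by (simp add: measure_preserving)

lemma square_integrable_weighted_comp:
  assumes "f \<in> square_integrable"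
  shows "(\<lambda>a. m a * f (\<tau> a)) \<in> square_integrable"
  using assms integrable_comp[of "\<lambda>a. (cmod (f a))\<^sup>2"]
  by (auto simp: square_integrable_def norm_mult)

lemma weighted_comp_abs_l2:
  assumes "f \<in> square_integrable"
  shows "weighted_comp m \<tau> (abs_l2 f) = abs_l2 (\<lambda>a. m a * f (\<tau> a))"
proof -
  have "AE a in distr lborel borel \<tau>. rep_l2 (abs_l2 f) a = f a"
    unfolding measure_preserving by (rule rep_abs_l2_AE[OF assms])
  then have "AE a in lborel. rep_l2 (abs_l2 f) (\<tau> a) = f (\<tau> a)"
    by (rule AE_distrD[rotated]) simp
  then show ?thesis
    unfolding weighted_comp_def
    by (subst abs_l2_eq_iff)
      (auto intro!: square_integrable_weighted_comp assms)
qed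

lemma cinner_weighted_comp: "cinner (weighted_comp m \<tau> F) (weighted_comp m \<tau> G) = cinner F G"
proof -
  have [measurable]: "rep_l2 F \<in> borel_measurable borel" "rep_l2 G \<in> borel_measurable borel"
    using rep_l2_mem[of F] rep_l2_mem[of G] by (auto simp: square_integrable_def)
  have unit: "m a * cnj (m a) = 1" for a
    by (simp add: complex_norm_square[symmetric])
  have "m a * rep_l2 F (\<tau> a) * cnj (m a * rep_l2 G (\<tau> a)) = rep_l2 F (\<tau> a) * cnj (rep_l2 G (\<tau> a))" for a
    using unit[of a] by (simp add: mult.assoc mult.left_commute[of _ "cnj (m a)"])
      (simp add: mult.assoc[symmetric] mult.commute)
  note * = this
  have "cinner (weighted_comp m \<tau> F) (weighted_comp m \<tau> G)
      = (LINT a|lborel. m a * rep_l2 F (\<tau> a) * cnj (m a * rep_l2 G (\<tau> a)))"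
    unfolding weighted_comp_def by (intro cinner_abs_l2 square_integrable_weighted_comp rep_l2_mem)
  also have "\<dots> = (LINT a|lborel. rep_l2 F (\<tau> a) * cnj (rep_l2 G (\<tau> a)))"
    by (simp only: *)
  also have "\<dots> = cinner F G"
    by (subst integral_comp) (auto simp: cinner.rep_eq)
  finally show ?thesis .
qed

lemma norm_weighted_comp: "norm (weighted_comp m \<tau> F) = norm F"
  by (simp add: norm_eq_sqrt_inner inner_l2_def cinner_weighted_comp)

lemma weighted_comp_diff: "weighted_comp m \<tau> (F - G) = weighted_comp m \<tau> F - weighted_comp m \<tau> G"
proof -
  obtain f where f: "f \<in> square_integrable" "F = abs_l2 f" by (rule abs_l2_cases)
  obtain g where g: "g \<in> square_integrable" "G = abs_l2 g" by (rule abs_l2_cases)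
  show ?thesis
    using f g by (simp add: diff_abs_l2 weighted_comp_abs_l2 square_integrable_diff
        square_integrable_weighted_comp right_diff_distrib)
qed

end

section \<open>The span of the Gaussians\<close>

definition gaussian :: "complex ^ 'n \<Rightarrow> complex ^ 'n \<Rightarrow> real ^ 'n::finite \<Rightarrow> complex" where
  "gaussian \<alpha> \<beta> a =
     exp (- (\<Sum>i\<in>UNIV. \<alpha> $ i * complex_of_real ((a $ i)\<^sup>2) + \<beta> $ i * complex_of_real (a $ i)))"

lemma gaussian_polyI:
  assumes "\<And>i. Re (\<alpha> $ i) > 0" "polynomial_function P"
  shows "(\<lambda>a. gaussian \<alpha> \<beta> a * P a) \<in> gaussian_poly"
  using assms unfolding gaussian_poly_def gaussian_def by blast

lemma gaussian_polyE:
  assumes "f \<in> gaussian_poly"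
  obtains \<alpha> \<beta> P where "\<forall>i. Re (\<alpha> $ i) > 0" "polynomial_function P"
    "f = (\<lambda>a. gaussian \<alpha> \<beta> a * P a)"
  using assms unfolding gaussian_poly_def gaussian_def by blast

lemma gaussian_mult:
  "gaussian \<alpha> \<beta> a * gaussian \<alpha>' \<beta>' a = gaussian (\<alpha> + \<alpha>') (\<beta> + \<beta>') a"
  by (simp add: gaussian_def exp_add[symmetric] sum.distrib algebra_simps)

lemma polynomial_function_complex_iff:
  fixes P :: "'a::real_normed_vector \<Rightarrow> complex"
  shows "polynomial_function P \<longleftrightarrow>
    real_polynomial_function (\<lambda>a. Re (P a)) \<and> real_polynomial_function (\<lambda>a. Im (P a))"
  by (simp add: polynomial_function_iff_Basis_inner Basis_complex_def inner_complex_def)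

lemma polynomial_function_complex_mult:
  fixes P Q :: "'a::real_normed_vector \<Rightarrow> complex"
  assumes "polynomial_function P" "polynomial_function Q"
  shows "polynomial_function (\<lambda>a. P a * Q a)"
  using assms unfolding polynomial_function_complex_iff by auto

lemma polynomial_function_of_real:
  assumes "real_polynomial_function p"
  shows "polynomial_function (\<lambda>a. complex_of_real (p a))"
  using assms unfolding polynomial_function_complex_iff by auto

lemma gaussian_poly_cmult:
  assumes "f \<in> gaussian_poly"
  shows "(\<lambda>a. c * f a) \<in> gaussian_poly"
proof -
  obtain \<alpha> \<beta> P where *: "\<forall>i. Re (\<alpha> $ i) > 0" "polynomial_function P"
    and f: "f = (\<lambda>a. gaussian \<alpha> \<beta> a * P a)"
    using assms by (rule gaussian_polyE)
  have "(\<lambda>a. gaussian \<alpha> \<beta> a * (c * P a)) \<in> gaussian_poly"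
    by (intro gaussian_polyI *[rule_format] polynomial_function_complex_mult polynomial_function_const)
  then show ?thesis
    by (simp add: f mult.left_commute)
qed

lemma D_dom_add:
  assumes "f \<in> D_dom" "g \<in> D_dom"
  shows "(\<lambda>a. f a + g a) \<in> D_dom"
proof -
  obtain G c where G: "finite G" "G \<subseteq> gaussian_poly" "f = (\<lambda>a. \<Sum>g\<in>G. c g * g a)"
    using assms(1) by (auto simp: D_dom_def)
  obtain H d where H: "finite H" "H \<subseteq> gaussian_poly" "g = (\<lambda>a. \<Sum>g\<in>H. d g * g a)"
    using assms(2) by (auto simp: D_dom_def)
  let ?e = "\<lambda>g. (if g \<in> G then c g else 0) + (if g \<in> H then d g else 0)"
  have "f a + g a = (\<Sum>g\<in>G \<union> H. ?e g * g a)" for a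
  proof -
    have "(\<Sum>g\<in>G. c g * g a) = (\<Sum>g\<in>G \<union> H. (if g \<in> G then c g else 0) * g a)"
      using G(1) H(1) by (intro sum.mono_neutral_cong_left) auto
    moreover have "(\<Sum>g\<in>H. d g * g a) = (\<Sum>g\<in>G \<union> H. (if g \<in> H then d g else 0) * g a)"
      using G(1) H(1) by (intro sum.mono_neutral_cong_left) auto
    ultimately show ?thesis
      unfolding G(3) H(3) by (simp only: distrib_right sum.distrib)
  qed
  then show ?thesis
    unfolding D_dom_def using G H by (intro CollectI exI[of _ "G \<union> H"] exI[of _ ?e]) auto
qed

lemma gaussian_poly_in_D_dom:
  assumes "f \<in> gaussian_poly"
  shows "f \<in> D_dom"
  unfolding D_dom_def using assms by (intro CollectI exI[of _ "{f}"] exI[of _ "\<lambda>_. 1"]) auto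

lemma D_dom_zero: "(\<lambda>a. 0) \<in> D_dom"
  unfolding D_dom_def by (intro CollectI exI[of _ "{}"]) auto

text \<open>
  The coefficients of a linear combination are absorbed by the polynomial factors, so an element of
  the span is built by adding one Gaussian at a time.
\<close>

lemma D_dom_induct [consumes 1, case_names zero add]:
  assumes "f \<in> D_dom" and "Q (\<lambda>a. 0)"
    and "\<And>g h. g \<in> gaussian_poly \<Longrightarrow> h \<in> D_dom \<Longrightarrow> Q h \<Longrightarrow> Q (\<lambda>a. g a + h a)"
  shows "Q f"
proof -
  obtain G c where G: "finite G" "G \<subseteq> gaussian_poly" "f = (\<lambda>a. \<Sum>g\<in>G. c g * g a)"
    using assms(1) by (auto simp: D_dom_def)
  have "(\<lambda>a. \<Sum>g\<in>G. c g * g a) \<in> D_dom \<and> Q (\<lambda>a. \<Sum>g\<in>G. c g * g a)"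
    using G(1,2)
  proof induction
    case empty
    show ?case by (simp add: assms(2) D_dom_zero)
  next
    case (insert g G)
    then have "(\<lambda>a. c g * g a) \<in> gaussian_poly"
      by (auto intro: gaussian_poly_cmult)
    with insert show ?case
      by (simp add: D_dom_add assms(3) gaussian_poly_in_D_dom)
  qed
  then show ?thesis
    using G by simp
qed

text \<open>
  The multipliers that occur later are all of this form: polynomials (\<open>\<alpha> = \<beta> = 0\<close>), Gaussians, and
  phases that are linear in \<open>a\<close> (\<open>\<alpha> = 0\<close> and \<open>\<beta>\<close> imaginary).
\<close>

lemma D_dom_mult:
  assumes "f \<in> D_dom" "\<And>i. Re (\<alpha> $ i) \<ge> 0" "polynomial_function P"
  shows "(\<lambda>a. gaussian \<alpha> \<beta> a * P a * f a) \<in> D_dom"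
  using assms(1)
proof (induction f rule: D_dom_induct)
  case zero
  show ?case by (simp add: D_dom_zero)
next
  case (add g h)
  obtain \<alpha>' \<beta>' Q where g: "\<forall>i. Re (\<alpha>' $ i) > 0" "polynomial_function Q"
    "g = (\<lambda>a. gaussian \<alpha>' \<beta>' a * Q a)"
    using add(1) by (rule gaussian_polyE)
  have "gaussian \<alpha> \<beta> a * P a * g a = gaussian (\<alpha> + \<alpha>') (\<beta> + \<beta>') a * (P a * Q a)" for a
    unfolding gaussian_mult[symmetric] g(3) by (simp only: mult_ac)
  moreover have "(\<lambda>a. gaussian (\<alpha> + \<alpha>') (\<beta> + \<beta>') a * (P a * Q a)) \<in> D_dom"
    by (intro gaussian_poly_in_D_dom gaussian_polyI polynomial_function_complex_mult assms g[rule_format])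
      (simp add: add_nonneg_pos assms g)
  ultimately have "(\<lambda>a. gaussian \<alpha> \<beta> a * P a * g a) \<in> D_dom"
    by (simp only:)
  from D_dom_add[OF this add(3)] show ?case
    by (simp only: distrib_left)
qed

lemma gaussian_zero [simp]: "gaussian 0 0 a = 1"
  by (simp add: gaussian_def)

lemma D_dom_poly_mult:
  assumes "f \<in> D_dom" "polynomial_function P"
  shows "(\<lambda>a. P a * f a) \<in> D_dom"
  using D_dom_mult[OF assms(1) _ assms(2), of 0 0] by simp

lemma D_dom_cmult: "f \<in> D_dom \<Longrightarrow> (\<lambda>a. c * f a) \<in> D_dom"
  by (intro D_dom_poly_mult) auto

lemma exp_square_eq_gaussian:
  "complex_of_real (exp (- c * (norm a)\<^sup>2)) = gaussian (vec (of_real c)) 0 a"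
  by (simp add: gaussian_def norm_vec_def L2_set_def sum_nonneg sum_distrib_left sum_negf exp_of_real[symmetric])

subsection \<open>Gaussian bounds\<close>

text \<open>
  All \<open>\<epsilon>\<close> are admitted so that in a product each factor can use \<open>\<epsilon> / 2\<close>, and so that a polynomial uses up
  only a part of the decay of the Gaussian in front of it.
\<close>

lemma polynomial_exp_bound:
  assumes "real_polynomial_function p" "\<epsilon> > 0"
  shows "\<exists>C\<ge>0. \<forall>a. \<bar>p a\<bar> \<le> C * exp (\<epsilon> * (norm a)\<^sup>2)"
  using assms
proof (induction p arbitrary: \<epsilon> rule: real_polynomial_function.induct)
  case (linear f)
  obtain K where K: "K > 0" "\<And>x. norm (f x) \<le> norm x * K"
    using bounded_linear.pos_bounded[OF linear(1)] by blast
  have "\<bar>f a\<bar> \<le> (K * (1 + 1/\<epsilon>)) * exp (\<epsilon> * (norm a)\<^sup>2)" for a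
  proof -
    have "norm a \<le> 1 + (norm a)\<^sup>2"
      using zero_le_power2[of "norm a - 1"] by (simp add: power2_diff) (smt (verit) zero_le_power2)
    also have "\<dots> \<le> (1 + 1/\<epsilon>) * (1 + \<epsilon> * (norm a)\<^sup>2)"
      using linear(2) by (simp add: field_simps)
    also have "\<dots> \<le> (1 + 1/\<epsilon>) * exp (\<epsilon> * (norm a)\<^sup>2)"
      using linear(2) by (intro mult_left_mono exp_ge_add_one_self) auto
    finally have "norm a * K \<le> ((1 + 1/\<epsilon>) * exp (\<epsilon> * (norm a)\<^sup>2)) * K"
      using K(1) by (intro mult_right_mono) auto
    then show ?thesis
      using K(2)[of a] by (simp add: mult_ac)
  qed
  then show ?case
    using K linear(2) by (intro exI[of _ "K * (1 + 1/\<epsilon>)"]) auto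
next
  case (const c)
  have "\<bar>c\<bar> \<le> \<bar>c\<bar> * exp (\<epsilon> * (norm a)\<^sup>2)" for a :: 'a
    using const by (simp add: mult_le_cancel_left1)
  then show ?case
    by (intro exI[of _ "\<bar>c\<bar>"]) auto
next
  case (add f g)
  obtain C where C: "C \<ge> 0" "\<And>a. \<bar>f a\<bar> \<le> C * exp (\<epsilon> * (norm a)\<^sup>2)"
    using add.IH(1)[OF add.prems] by blast
  obtain C' where C': "C' \<ge> 0" "\<And>a. \<bar>g a\<bar> \<le> C' * exp (\<epsilon> * (norm a)\<^sup>2)"
    using add.IH(2)[OF add.prems] by blast
  have "\<bar>f a + g a\<bar> \<le> (C + C') * exp (\<epsilon> * (norm a)\<^sup>2)" for a
    using C(2)[of a] C'(2)[of a] by (simp add: distrib_right)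
  then show ?case
    using C C' by (intro exI[of _ "C + C'"]) auto
next
  case (mult f g)
  then have *: "\<epsilon> / 2 > 0" by simp
  obtain C where C: "C \<ge> 0" "\<And>a. \<bar>f a\<bar> \<le> C * exp (\<epsilon> / 2 * (norm a)\<^sup>2)"
    using mult.IH(1)[OF *] by blast
  obtain C' where C': "C' \<ge> 0" "\<And>a. \<bar>g a\<bar> \<le> C' * exp (\<epsilon> / 2 * (norm a)\<^sup>2)"
    using mult.IH(2)[OF *] by blast
  have "\<bar>f a * g a\<bar> \<le> (C * C') * exp (\<epsilon> * (norm a)\<^sup>2)" for a
  proof -
    have "\<bar>f a * g a\<bar> \<le> (C * exp (\<epsilon> / 2 * (norm a)\<^sup>2)) * (C' * exp (\<epsilon> / 2 * (norm a)\<^sup>2))"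
      unfolding abs_mult by (intro mult_mono C C') (use C in auto)
    also have "\<dots> = (C * C') * exp (\<epsilon> / 2 * (norm a)\<^sup>2 + \<epsilon> / 2 * (norm a)\<^sup>2)"
      unfolding exp_add by (simp only: mult_ac)
    finally show ?thesis by (simp add: field_simps)
  qed
  then show ?case
    using C C' by (intro exI[of _ "C * C'"]) auto
qed

text \<open>
  Half of the quadratic decay absorbs the linear term of the exponent, by
  \<open>b r \<le> d / 2 r\<^sup>2 + b\<^sup>2 / (2 d)\<close>.
\<close>

lemma gaussian_bound:
  fixes \<alpha> \<beta> :: "complex ^ 'n::finite"
  assumes "\<And>i. Re (\<alpha> $ i) > 0"
  shows "\<exists>C \<delta>. C \<ge> 0 \<and> \<delta> > 0 \<and> (\<forall>a. cmod (gaussian \<alpha> \<beta> a) \<le> C * exp (- \<delta> * (norm a)\<^sup>2))"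
proof -
  define d where "d = Min (range (\<lambda>i. Re (\<alpha> $ i)))"
  have d: "d > 0" "\<And>i. d \<le> Re (\<alpha> $ i)"
    using assms by (auto simp: d_def)
  define b where "b = (\<Sum>i\<in>UNIV. \<bar>Re (\<beta> $ i)\<bar>)"
  have "cmod (gaussian \<alpha> \<beta> a) \<le> exp (b\<^sup>2 / (2 * d)) * exp (- (d / 2) * (norm a)\<^sup>2)" for a
  proof -
    have "d * (norm a)\<^sup>2 = (\<Sum>i\<in>UNIV. d * (a $ i)\<^sup>2)"
      by (simp add: norm_vec_def L2_set_def sum_nonneg sum_distrib_left)
    also have "\<dots> \<le> (\<Sum>i\<in>UNIV. Re (\<alpha> $ i) * (a $ i)\<^sup>2)"
      by (intro sum_mono mult_right_mono d) auto
    finally have 1: "d * (norm a)\<^sup>2 \<le> (\<Sum>i\<in>UNIV. Re (\<alpha> $ i) * (a $ i)\<^sup>2)" .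
    have "- (\<Sum>i\<in>UNIV. Re (\<beta> $ i) * a $ i) \<le> (\<Sum>i\<in>UNIV. \<bar>Re (\<beta> $ i) * a $ i\<bar>)"
      using sum_abs[of "\<lambda>i. Re (\<beta> $ i) * a $ i" UNIV] by linarith
    also have "\<dots> \<le> (\<Sum>i\<in>UNIV. \<bar>Re (\<beta> $ i)\<bar> * norm a)"
      unfolding abs_mult by (intro sum_mono mult_left_mono) (use component_le_norm_cart in auto)
    finally have 2: "- (\<Sum>i\<in>UNIV. Re (\<beta> $ i) * a $ i) \<le> b * norm a"
      by (simp add: b_def sum_distrib_right)
    have "0 \<le> (d * norm a - b)\<^sup>2 / (2 * d)"
      using d by simp
    also have "\<dots> = d / 2 * (norm a)\<^sup>2 - b * norm a + b\<^sup>2 / (2 * d)"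
      using d(1) by (simp add: power2_eq_square field_simps)
    finally have 3: "b * norm a \<le> d / 2 * (norm a)\<^sup>2 + b\<^sup>2 / (2 * d)"
      by simp
    have "Re (- (\<Sum>i\<in>UNIV. \<alpha> $ i * complex_of_real ((a $ i)\<^sup>2) + \<beta> $ i * complex_of_real (a $ i)))
        = - (\<Sum>i\<in>UNIV. Re (\<alpha> $ i) * (a $ i)\<^sup>2) - (\<Sum>i\<in>UNIV. Re (\<beta> $ i) * a $ i)"
      by (simp add: sum.distrib del: of_real_power)
    also have "\<dots> \<le> b\<^sup>2 / (2 * d) + (- (d / 2) * (norm a)\<^sup>2)"
      using 1 2 3 by linarith
    finally show ?thesis
      unfolding gaussian_def norm_exp_eq_Re exp_add[symmetric] by simp
  qed
  then show ?thesis
    using d by (intro exI[of _ "exp (b\<^sup>2 / (2 * d))"] exI[of _ "d / 2"]) auto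
qed

text \<open>
  This gives square-integrability. As the bound survives a bounded translation, up to the constants, it
  also dominates the translates that occur in the Taylor estimate for the unitary group.
\<close>

lemma D_dom_bound:
  assumes "f \<in> D_dom"
  shows "\<exists>C \<delta>. C \<ge> 0 \<and> \<delta> > 0 \<and> (\<forall>a. cmod (f a) \<le> C * exp (- \<delta> * (norm a)\<^sup>2))"
  using assms
proof (induction f rule: D_dom_induct)
  case zero
  show ?case by (intro exI[of _ 0] exI[of _ 1]) auto
next
  case (add g h)
  obtain C1 d1 where h: "C1 \<ge> 0" "d1 > 0" "\<And>a. cmod (h a) \<le> C1 * exp (- d1 * (norm a)\<^sup>2)"
    using add by blast
  obtain \<alpha> \<beta> P where \<alpha>: "\<forall>i. Re (\<alpha> $ i) > 0" and P: "polynomial_function P"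
    and g: "g = (\<lambda>a. gaussian \<alpha> \<beta> a * P a)"
    using add(1) by (rule gaussian_polyE)
  obtain C2 d2 where C2: "C2 \<ge> 0" "d2 > 0" "\<And>a. cmod (gaussian \<alpha> \<beta> a) \<le> C2 * exp (- d2 * (norm a)\<^sup>2)"
    using gaussian_bound[of \<alpha> \<beta>] \<alpha> by blast
  then have d2: "d2 / 2 > 0" by simp
  obtain C3 where C3: "C3 \<ge> 0" "\<And>a. \<bar>Re (P a)\<bar> \<le> C3 * exp (d2 / 2 * (norm a)\<^sup>2)"
    using polynomial_exp_bound[OF _ d2] P polynomial_function_complex_iff by metis
  obtain C4 where C4: "C4 \<ge> 0" "\<And>a. \<bar>Im (P a)\<bar> \<le> C4 * exp (d2 / 2 * (norm a)\<^sup>2)"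
    using polynomial_exp_bound[OF _ d2] P polynomial_function_complex_iff by metis
  define \<delta> where "\<delta> = min d1 (d2 / 2)"
  have \<delta>: "- d1 * (norm a)\<^sup>2 \<le> - \<delta> * (norm a)\<^sup>2" "- (d2 / 2) * (norm a)\<^sup>2 \<le> - \<delta> * (norm a)\<^sup>2"
    for a :: "real ^ 'a"
    by (intro mult_right_mono; simp add: \<delta>_def)+
  define C where "C = C2 * (C3 + C4) + C1"
  have "cmod (g a + h a) \<le> C * exp (- \<delta> * (norm a)\<^sup>2)" for a
  proof -
    have "cmod (P a) \<le> (C3 + C4) * exp (d2 / 2 * (norm a)\<^sup>2)"
      using C3(2)[of a] C4(2)[of a] cmod_le[of "P a"] by (simp add: distrib_right)
    then have "cmod (g a) \<le> (C2 * exp (- d2 * (norm a)\<^sup>2)) * ((C3 + C4) * exp (d2 / 2 * (norm a)\<^sup>2))"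
      unfolding g norm_mult by (intro mult_mono C2) (use C2 C3 C4 in auto)
    also have "\<dots> = C2 * (C3 + C4) * (exp (- d2 * (norm a)\<^sup>2) * exp (d2 / 2 * (norm a)\<^sup>2))"
      by (simp only: mult_ac)
    also have "exp (- d2 * (norm a)\<^sup>2) * exp (d2 / 2 * (norm a)\<^sup>2) = exp (- (d2 / 2) * (norm a)\<^sup>2)"
      unfolding exp_add[symmetric] by (simp add: field_simps)
    also have "C2 * (C3 + C4) * exp (- (d2 / 2) * (norm a)\<^sup>2) \<le> C2 * (C3 + C4) * exp (- \<delta> * (norm a)\<^sup>2)"
      using C2 C3 C4 by (intro mult_left_mono) (use \<delta>[of a] in auto)
    finally have 1: "cmod (g a) \<le> C2 * (C3 + C4) * exp (- \<delta> * (norm a)\<^sup>2)" .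
    have "cmod (h a) \<le> C1 * exp (- d1 * (norm a)\<^sup>2)"
      by (rule h)
    also have "\<dots> \<le> C1 * exp (- \<delta> * (norm a)\<^sup>2)"
      using h by (intro mult_left_mono) (use \<delta>[of a] in auto)
    finally show ?thesis
      using 1 norm_triangle_ineq[of "g a" "h a"] unfolding C_def by (simp add: distrib_right)
  qed
  then show ?case
    using h C2 C3 C4 d2 by (intro exI[of _ C] exI[of _ \<delta>]) (auto simp: C_def \<delta>_def)
qed

lemma D_dom_continuous:
  assumes "f \<in> D_dom"
  shows "continuous_on UNIV f"
  using assms
proof (induction f rule: D_dom_induct)
  case (add g h)
  then obtain \<alpha> \<beta> P where P: "polynomial_function P"
    and g: "g = (\<lambda>a. gaussian \<alpha> \<beta> a * P a)"
    using gaussian_polyE by metis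
  have "continuous_on UNIV P"
    using P by (simp add: continuous_at_imp_continuous_on continuous_polymonial_function)
  with add(3) show ?case
    unfolding g gaussian_def by (intro continuous_intros)
qed simp

text \<open>
  The integral of \<open>exp (- 2 \<delta> |a|\<^sup>2)\<close> is a product over the coordinates of integrals of multiples
  of a normal density.
\<close>

lemma square_integrable_exp_norm:
  assumes "\<delta> > 0"
  shows "(\<lambda>a :: real ^ 'n::finite. complex_of_real (exp (- \<delta> * (norm a)\<^sup>2))) \<in> square_integrable"
proof -
  define s where "s = 1 / (2 * sqrt \<delta>)"
  have s: "s > 0" "2 * s\<^sup>2 = 1 / (2 * \<delta>)"
    using assms by (auto simp: s_def power_divide)
  have exp_eq: "exp (- 2 * \<delta> * t\<^sup>2) = sqrt (2 * pi * s\<^sup>2) * normal_density 0 s t" for t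
    using s assms by (simp add: normal_density_def)
  have "integrable lborel (\<lambda>t::real. exp (- 2 * \<delta> * t\<^sup>2))"
    unfolding exp_eq using s by (intro integrable_mult_right) auto
  then have fin: "(\<integral>\<^sup>+ t. ennreal (exp (- 2 * \<delta> * t\<^sup>2)) \<partial>lborel) < \<infinity>"
    by (simp add: integrable_iff_bounded)
  have prod: "(cmod (complex_of_real (exp (- \<delta> * (norm a)\<^sup>2))))\<^sup>2
      = (\<Prod>b\<in>Basis. exp (- 2 * \<delta> * (a \<bullet> b)\<^sup>2))" for a :: "real ^ 'n"
  proof -
    have "(norm a)\<^sup>2 = (\<Sum>b\<in>Basis. (a \<bullet> b)\<^sup>2)"
      by (subst norm_eq_sqrt_inner, subst euclidean_inner) (simp add: power2_eq_square sum_nonneg)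
    then show ?thesis
      by (simp add: exp_sum[symmetric] sum_distrib_left[symmetric] sum_negf exp_double[symmetric] power2_eq_square exp_add[symmetric])
  qed
  have "(\<integral>\<^sup>+ a. ennreal ((cmod (complex_of_real (exp (- \<delta> * (norm (a :: real ^ 'n))\<^sup>2))))\<^sup>2) \<partial>lborel)
      = (\<integral>\<^sup>+ a. (\<Prod>b\<in>Basis. ennreal (exp (- 2 * \<delta> * ((a :: real ^ 'n) \<bullet> b)\<^sup>2))) \<partial>lborel)"
    unfolding prod by (intro nn_integral_cong) (simp add: prod_ennreal)
  also have "\<dots> = (\<Prod>b\<in>(Basis :: (real ^ 'n) set). \<integral>\<^sup>+ t. ennreal (exp (- 2 * \<delta> * t\<^sup>2)) \<partial>lborel)"
    by (rule nn_integral_lborel_prod) auto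
  also have "\<dots> < \<infinity>"
    using fin by (simp add: power_less_top_ennreal)
  finally show ?thesis
    unfolding square_integrable_def by (simp add: integrable_iff_bounded)
qed

lemma D_dom_square_integrable:
  assumes "f \<in> D_dom"
  shows "f \<in> square_integrable"
proof -
  obtain C \<delta> where C: "\<delta> > 0" "\<And>a. cmod (f a) \<le> C * exp (- \<delta> * (norm a)\<^sup>2)"
    using D_dom_bound[OF assms] by blast
  show ?thesis
    by (rule square_integrable_dominated[OF _ square_integrable_exp_norm[OF C(1)], where c = C])
      (use C D_dom_continuous[OF assms] in \<open>auto intro: borel_measurable_continuous_onI\<close>)
qed

subsection \<open>Density\<close>

lemma abs_l2_tendsto:
  assumes "\<And>n. f n \<in> borel_measurable borel" "F \<in> borel_measurable borel" "g \<in> square_integrable"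
    and bound: "\<And>n a. cmod (f n a) \<le> cmod (g a)" "\<And>a. cmod (F a) \<le> cmod (g a)"
    and lim: "AE a in lborel. (\<lambda>n. f n a) \<longlonglongrightarrow> F a"
  shows "(\<lambda>n. abs_l2 (f n)) \<longlonglongrightarrow> abs_l2 F"
proof -
  have f: "f n \<in> square_integrable" for n
    by (rule square_integrable_dominated[where c = 1]) (use assms in auto)
  have F: "F \<in> square_integrable"
    by (rule square_integrable_dominated[where c = 1]) (use assms in auto)
  note [measurable] = assms(1,2)
  have "(\<lambda>n. LINT a|lborel. (cmod (f n a - F a))\<^sup>2) \<longlonglongrightarrow> (LINT a|(lborel :: (real ^ 'a) measure). (0 :: real))"
  proof (rule integral_dominated_convergence)
    show "integrable lborel (\<lambda>a. 4 * (cmod (g a))\<^sup>2)"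
      using assms(3) by (simp add: square_integrable_def)
    show "AE a in lborel. (\<lambda>n. (cmod (f n a - F a))\<^sup>2) \<longlonglongrightarrow> 0"
      using lim
    proof eventually_elim
      case (elim a)
      then have "(\<lambda>n. f n a - F a) \<longlonglongrightarrow> 0"
        by (simp add: LIM_zero)
      from tendsto_power[OF tendsto_norm[OF this], of 2] show ?case by simp
    qed
    show "AE a in lborel. norm ((cmod (f n a - F a))\<^sup>2) \<le> 4 * (cmod (g a))\<^sup>2" for n
    proof (rule AE_I2)
      fix a
      have "cmod (f n a - F a) \<le> 2 * cmod (g a)"
        using norm_triangle_ineq4[of "f n a" "F a"] bound(1)[of n a] bound(2)[of a] by linarith
      from power_mono[OF this norm_ge_zero, of 2]
      show "norm ((cmod (f n a - F a))\<^sup>2) \<le> 4 * (cmod (g a))\<^sup>2"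
        by (simp add: power_mult_distrib)
    qed
  qed measurable
  then have "(\<lambda>n. (norm (abs_l2 (f n) - abs_l2 F))\<^sup>2) \<longlonglongrightarrow> 0"
    using f F by (simp add: diff_abs_l2 norm_abs_l2_power2 square_integrable_diff)
  from tendsto_real_sqrt[OF this] have "(\<lambda>n. norm (abs_l2 (f n) - abs_l2 F)) \<longlonglongrightarrow> 0"
    by simp
  then show ?thesis
    by (rule LIM_zero_cancel[OF tendsto_norm_zero_cancel])
qed

text \<open>
  The components of this map are Gaussians times polynomials, hence every polynomial in them maps \<open>D\<close>
  to itself by multiplication. The map is injective with bounded range: the closure of the range is a compact set on which the
  Stone-Weierstrass theorem applies.
\<close>

definition gauss_embed :: "real ^ 'n::finite \<Rightarrow> real \<times> (real ^ 'n)" where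
  "gauss_embed a = (exp (- (norm a)\<^sup>2), exp (- (norm a)\<^sup>2) *\<^sub>R a)"

lemma bounded_gauss_embed: "bounded (range gauss_embed)"
proof -
  have "norm (gauss_embed a) \<le> 2" for a :: "real ^ 'a"
  proof -
    have "norm a \<le> 1 + (norm a)\<^sup>2"
      using zero_le_power2[of "norm a - 1"] by (simp add: power2_diff) (smt (verit) zero_le_power2)
    also have "\<dots> \<le> exp ((norm a)\<^sup>2)"
      by (rule exp_ge_add_one_self)
    finally have "exp (- (norm a)\<^sup>2) * norm a \<le> 1"
      by (simp add: exp_minus field_simps)
    moreover have "exp (- (norm a)\<^sup>2) \<le> 1" by simp
    moreover have "norm (gauss_embed a) \<le> exp (- (norm a)\<^sup>2) + exp (- (norm a)\<^sup>2) * norm a"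
      using norm_Pair_le[of "exp (- (norm a)\<^sup>2)" "exp (- (norm a)\<^sup>2) *\<^sub>R a"]
      unfolding gauss_embed_def by simp
    ultimately show ?thesis by linarith
  qed
  then show ?thesis
    by (auto simp: bounded_iff)
qed

lemma D_dom_gauss_mult:
  assumes "f \<in> D_dom"
  shows "(\<lambda>a. of_real (exp (- (norm a)\<^sup>2)) * f a) \<in> D_dom"
proof -
  have "complex_of_real (exp (- (norm a)\<^sup>2)) = gaussian (vec 1) 0 a" for a :: "real ^ 'a"
    using exp_square_eq_gaussian[of 1 a] by simp
  then show ?thesis
    using D_dom_mult[OF assms, of "vec 1" "\<lambda>_. 1" 0] by simp
qed

text \<open>
  By induction on the polynomial. The statement for all \<open>f\<close> in \<open>D\<close> makes the case of a product a
  composition of multiplications.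
\<close>

lemma D_dom_poly_gauss_embed:
  assumes "real_polynomial_function q" "f \<in> D_dom"
  shows "(\<lambda>a. of_real (q (gauss_embed a)) * f a) \<in> D_dom"
  using assms
proof (induction q arbitrary: f rule: real_polynomial_function.induct)
  case (linear q)
  interpret q: bounded_linear q by fact
  have eq: "q (gauss_embed a) = exp (- (norm a)\<^sup>2) * (q (1, 0) + q (0, a))" for a :: "real ^ 'a"
  proof -
    have "gauss_embed a = exp (- (norm a)\<^sup>2) *\<^sub>R ((1, 0) + (0, a))"
      by (simp add: gauss_embed_def)
    then show ?thesis
      by (simp only: q.add q.scaleR real_scaleR_def)
  qed
  have "bounded_linear (\<lambda>a :: real ^ 'a. q (0, a))"
    by (intro bounded_linear_compose[OF linear(1)] bounded_linear_Pair bounded_linear_zero bounded_linear_ident)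
  then have "real_polynomial_function (\<lambda>a :: real ^ 'a. q (1, 0) + q (0, a))"
    by (intro real_polynomial_function.intros)
  then have "(\<lambda>a. of_real (exp (- (norm a)\<^sup>2)) * (of_real (q (1, 0) + q (0, a)) * f a)) \<in> D_dom"
    by (intro D_dom_gauss_mult D_dom_poly_mult polynomial_function_of_real linear)
  then show ?case
    by (simp add: eq mult.assoc)
next
  case (const c)
  then show ?case by (intro D_dom_cmult)
next
  case (add p q)
  from D_dom_add[OF add.IH(1)[OF add.prems] add.IH(2)[OF add.prems]] show ?case
    by (simp add: distrib_right)
next
  case (mult p q)
  from mult.IH(1)[OF mult.IH(2)[OF mult.prems]] show ?case
    by (simp add: mult.assoc)
qed

lemma D_dom_complex_poly_gauss_embed:
  assumes "polynomial_function p" "f \<in> D_dom"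
  shows "(\<lambda>a. p (gauss_embed a) * f a) \<in> D_dom"
proof -
  have "(\<lambda>a. of_real (Re (p (gauss_embed a))) * f a + \<i> * (of_real (Im (p (gauss_embed a))) * f a)) \<in> D_dom"
    using assms(1) unfolding polynomial_function_complex_iff
    by (intro D_dom_add D_dom_cmult D_dom_poly_gauss_embed assms) auto
  moreover have "p x * f a = of_real (Re (p x)) * f a + \<i> * (of_real (Im (p x)) * f a)" for x a
    by (subst complex_eq[of "p x"]) (simp add: algebra_simps)
  ultimately show ?thesis by simp
qed

abbreviation std_gaussian :: "real ^ 'n::finite \<Rightarrow> complex" where
  "std_gaussian a \<equiv> complex_of_real (exp (- (norm a)\<^sup>2))"

lemma std_gaussian_D_dom: "std_gaussian \<in> D_dom"
proof -
  have "(\<lambda>a :: real ^ 'a. gaussian (vec 1) 0 a * 1) \<in> gaussian_poly"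
    by (intro gaussian_polyI) auto
  moreover have "(\<lambda>a :: real ^ 'a. gaussian (vec 1) 0 a * 1) = std_gaussian"
    using exp_square_eq_gaussian[of 1, where 'a = 'a] by (simp add: fun_eq_iff del: of_real_exp)
  ultimately show ?thesis
    by (metis gaussian_poly_in_D_dom)
qed

text \<open>
  On the compact closure of the range, \<open>\<phi>\<close> is a uniform limit of polynomials \<open>p\<close>. A uniform error
  becomes an error in the Hilbert space after multiplication by a fixed Gaussian.
\<close>

lemma gauss_embed_approx:
  fixes \<phi> :: "real \<times> (real ^ 'n::finite) \<Rightarrow> complex"
  assumes "continuous_on UNIV \<phi>"
  shows "abs_l2 (\<lambda>a. \<phi> (gauss_embed a) * std_gaussian a) \<in> closure (abs_l2 ` D_dom)"
    and "(\<lambda>a. \<phi> (gauss_embed a) * std_gaussian a) \<in> square_integrable"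
proof -
  define K where "K = closure (range (gauss_embed :: real ^ 'n \<Rightarrow> _))"
  have K: "compact K" "\<And>a. gauss_embed a \<in> K"
    using bounded_gauss_embed closure_subset[of "range (gauss_embed :: real ^ 'n \<Rightarrow> _)"]
    by (auto simp: K_def compact_closure)
  have cont: "continuous_on K \<phi>"
    using assms by (rule continuous_on_subset) auto
  have G: "(std_gaussian :: real ^ 'n \<Rightarrow> _) \<in> square_integrable"
    by (rule D_dom_square_integrable[OF std_gaussian_D_dom])
  have cont_embed: "continuous_on UNIV (gauss_embed :: real ^ 'n \<Rightarrow> _)"
    unfolding gauss_embed_def by (intro continuous_intros)
  have "bounded (\<phi> ` K)"
    using cont K by (intro compact_imp_bounded compact_continuous_image)
  then obtain B where B: "\<And>x. x \<in> K \<Longrightarrow> cmod (\<phi> x) \<le> B"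
    by (auto simp: bounded_iff)
  have "continuous_on UNIV (\<lambda>a. \<phi> (gauss_embed a) * std_gaussian a)"
    by (intro continuous_intros continuous_on_compose2[OF assms cont_embed]) auto
  then have "(\<lambda>a. \<phi> (gauss_embed a) * std_gaussian a) \<in> borel_measurable borel"
    by (rule borel_measurable_continuous_onI)
  then show sq: "(\<lambda>a. \<phi> (gauss_embed a) * std_gaussian a) \<in> square_integrable"
    by (rule square_integrable_dominated[OF _ G, where c = B]) (simp add: norm_mult B K)
  show "abs_l2 (\<lambda>a. \<phi> (gauss_embed a) * std_gaussian a) \<in> closure (abs_l2 ` D_dom)"
    unfolding closure_approachable
  proof (intro allI impI)
    fix e :: real assume "e > 0"
    define N where "N = norm (abs_l2 (std_gaussian :: real ^ 'n \<Rightarrow> _)) + 1"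
    have N: "N > 0" by (simp add: N_def add_nonneg_pos)
    obtain p where p: "polynomial_function p" "\<And>x. x \<in> K \<Longrightarrow> cmod (\<phi> x - p x) < e / N"
      using Stone_Weierstrass_polynomial_function[OF K(1) cont, of "e / N"] N \<open>e > 0\<close> by auto
    have D: "(\<lambda>a. p (gauss_embed a) * std_gaussian a) \<in> D_dom"
      by (intro D_dom_complex_poly_gauss_embed p std_gaussian_D_dom)
    have "norm (abs_l2 (\<lambda>a. p (gauss_embed a) * std_gaussian a)
        - abs_l2 (\<lambda>a. \<phi> (gauss_embed a) * std_gaussian a)) \<le> e / N * norm (abs_l2 (std_gaussian :: real ^ 'n \<Rightarrow> _))"
      unfolding diff_abs_l2[OF D_dom_square_integrable[OF D] sq]
    proof (rule norm_abs_l2_le[OF square_integrable_diff[OF D_dom_square_integrable[OF D] sq] G])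
      show "cmod (p (gauss_embed a) * std_gaussian a - \<phi> (gauss_embed a) * std_gaussian a)
          \<le> e / N * cmod (std_gaussian a)" for a
        using p(2)[OF K(2)[of a]] unfolding left_diff_distrib[symmetric] norm_mult
        by (intro mult_right_mono) (auto simp: norm_minus_commute)
    qed (use N \<open>e > 0\<close> in auto)
    also have "\<dots> < e / N * N"
      using N \<open>e > 0\<close> by (intro mult_strict_left_mono) (auto simp: N_def)
    finally show "\<exists>y\<in>abs_l2 ` D_dom. dist y (abs_l2 (\<lambda>a. \<phi> (gauss_embed a) * std_gaussian a)) < e"
      using D N by (intro bexI[of _ "abs_l2 (\<lambda>a. p (gauss_embed a) * std_gaussian a)"]) (auto simp: dist_norm)
  qed
qed

text \<open>
  As a function of \<open>u = exp (- |a|\<^sup>2)\<close> this vanishes where \<open>u \<le> 1 / c\<close>, that is for large \<open>a\<close>, and it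
  is \<open>1\<close> where \<open>u \<ge> 2 / c\<close>.
\<close>

definition cutoff :: "real \<Rightarrow> real \<Rightarrow> real" where
  "cutoff c u = max 0 (min 1 (c * u - 1))"

definition clip :: "real \<Rightarrow> complex \<Rightarrow> complex" where
  "clip c z = z /\<^sub>R max 1 (cmod z / c)"

lemma continuous_on_clip: "continuous_on UNIV (clip c)"
  unfolding clip_def divide_inverse[of "cmod _" c] by (intro continuous_intros) auto

lemma norm_clip: "cmod (clip c z) = cmod z / max 1 (cmod z / c)"
  by (simp add: clip_def divide_inverse abs_of_pos mult.commute)

lemma norm_clip_le:
  assumes "c > 0"
  shows "cmod (clip c z) \<le> c" "cmod (clip c z) \<le> cmod z"
proof -
  have "cmod z \<le> c * max 1 (cmod z / c)"
    using assms by (simp add: max_def field_simps)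
  then show "cmod (clip c z) \<le> c"
    unfolding norm_clip by (simp add: divide_le_eq less_max_iff_disj)
  have "cmod z * 1 \<le> cmod z * max 1 (cmod z / c)"
    by (intro mult_left_mono) auto
  then show "cmod (clip c z) \<le> cmod z"
    unfolding norm_clip by (simp add: divide_le_eq less_max_iff_disj)
qed

text \<open>
  Away from the zeros of the cutoff, \<open>a\<close> is recovered from \<open>(u, v) = gauss_embed a\<close> as \<open>v / u\<close>. With the
  denominator \<open>max (1 / c) u\<close> instead of \<open>u\<close> this is continuous everywhere, and the cutoff hides the
  places where the two differ.
\<close>

lemma cutoff_clip_approx:
  assumes "continuous_on UNIV \<psi>" "c > 0"
  shows "abs_l2 (\<lambda>a. of_real (cutoff c (exp (- (norm a)\<^sup>2))) * \<psi> a * std_gaussian a) \<in> closure (abs_l2 ` D_dom)"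
proof -
  define \<phi> where "\<phi> = (\<lambda>x. of_real (cutoff c (fst x)) * \<psi> ((1 / max (1 / c) (fst x)) *\<^sub>R snd x))"
  have "max (1 / c) u \<noteq> 0" for u
    using assms(2) by (metis less_max_iff_disj less_irrefl zero_less_divide_1_iff)
  then have "continuous_on UNIV \<phi>"
    unfolding \<phi>_def cutoff_def
    by (intro continuous_intros continuous_on_compose2[OF assms(1)]) auto
  moreover have "\<phi> (gauss_embed a) = of_real (cutoff c (exp (- (norm a)\<^sup>2))) * \<psi> a" for a
  proof (cases "exp (- (norm a)\<^sup>2) \<le> 1 / c")
    case True
    then have "c * exp (- (norm a)\<^sup>2) \<le> 1"
      using assms(2) by (simp add: field_simps)
    then have "cutoff c (exp (- (norm a)\<^sup>2)) = 0"
      by (simp add: cutoff_def)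
    then show ?thesis
      by (simp add: \<phi>_def gauss_embed_def)
  next
    case False
    then have "max (1 / c) (exp (- (norm a)\<^sup>2)) = exp (- (norm a)\<^sup>2)"
      by simp
    then show ?thesis
      by (simp add: \<phi>_def gauss_embed_def)
  qed
  ultimately show ?thesis
    using gauss_embed_approx(1)[of \<phi>] by simp
qed

lemma cutoff_bounds: "0 \<le> cutoff c u" "cutoff c u \<le> 1"
  by (auto simp: cutoff_def)

text \<open>
  Let \<open>h\<close> be the quotient of a square-integrable \<open>f\<close> by a fixed Gaussian. Being measurable, \<open>h\<close> is the
  limit almost everywhere of continuous functions. After clipping and cutting off at level \<open>c\<close>, these
  converge in the weighted space by dominated convergence; then \<open>c\<close> tends to infinity.
\<close>

theorem D_dom_dense: "closure (abs_l2 ` (D_dom :: (real ^ 'n::finite \<Rightarrow> complex) set)) = UNIV"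
proof (intro equalityI subsetI UNIV_I)
  fix F :: "'n l2"
  let ?C = "closure (abs_l2 ` (D_dom :: (real ^ 'n::finite \<Rightarrow> complex) set))"
  obtain f where f: "f \<in> square_integrable" "F = abs_l2 f" by (rule abs_l2_cases)
  have [measurable]: "f \<in> borel_measurable borel"
    using f by (simp add: square_integrable_def)
  define h where "h = (\<lambda>a. f a / std_gaussian a)"
  have [measurable]: "h \<in> borel_measurable borel"
    unfolding h_def by measurable
  have hG: "h a * std_gaussian a = f a" for a
    by (simp add: h_def)
  have "h measurable_on UNIV"
    by (rule lebesgue_measurable_imp_measurable_on) (auto intro: measurable_completion)
  then obtain N g where g: "negligible N" "\<And>n. continuous_on UNIV (g n)"
    "\<And>x. x \<notin> N \<Longrightarrow> (\<lambda>n. g n x) \<longlonglongrightarrow> h x"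
    unfolding measurable_on_def by auto
  have ae: "AE x in lborel. (\<lambda>n. g n x) \<longlonglongrightarrow> h x"
  proof -
    have "AE x in lebesgue. x \<notin> N"
      using g(1) by (intro AE_not_in) (simp add: negligible_iff_null_sets)
    then have "AE x in lborel. x \<notin> N"
      by (simp add: AE_completion_iff)
    then show ?thesis
      by eventually_elim (rule g)
  qed
  have G: "(std_gaussian :: real ^ 'n \<Rightarrow> _) \<in> square_integrable"
    by (rule D_dom_square_integrable[OF std_gaussian_D_dom])
  have [measurable]: "cutoff c \<in> borel_measurable borel" for c
    unfolding cutoff_def by measurable
  have [measurable]: "clip c \<in> borel_measurable borel" for c
    by (rule borel_measurable_continuous_onI[OF continuous_on_clip])
  have [measurable]: "g n \<in> borel_measurable borel" for n
    by (rule borel_measurable_continuous_onI[OF g(2)])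
  have bound: "cmod (of_real (cutoff c (exp (- (norm a)\<^sup>2))) * clip c z * std_gaussian a) \<le> cmod (of_real c * std_gaussian a)"
    "cmod (of_real (cutoff c (exp (- (norm a)\<^sup>2))) * clip c z * std_gaussian a) \<le> cmod (z * std_gaussian a)"
    if "c > 0" for c z and a :: "real ^ 'n"
  proof -
    have "cutoff c (exp (- (norm a)\<^sup>2)) * cmod (clip c z) \<le> 1 * c"
      by (intro mult_mono norm_clip_le cutoff_bounds that) auto
    then show "cmod (of_real (cutoff c (exp (- (norm a)\<^sup>2))) * clip c z * std_gaussian a) \<le> cmod (of_real c * std_gaussian a)"
      unfolding norm_mult using cutoff_bounds(1) that by (intro mult_right_mono) auto
    have "cutoff c (exp (- (norm a)\<^sup>2)) * cmod (clip c z) \<le> 1 * cmod z"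
      by (intro mult_mono norm_clip_le cutoff_bounds that) auto
    then show "cmod (of_real (cutoff c (exp (- (norm a)\<^sup>2))) * clip c z * std_gaussian a) \<le> cmod (z * std_gaussian a)"
      unfolding norm_mult using cutoff_bounds(1) that by (intro mult_right_mono) auto
  qed
  have "abs_l2 (\<lambda>a. of_real (cutoff c (exp (- (norm a)\<^sup>2))) * clip c (h a) * std_gaussian a) \<in> ?C"
    if "c > 0" for c
  proof (rule closed_sequentially[OF closed_closure])
    show "abs_l2 (\<lambda>a. of_real (cutoff c (exp (- (norm a)\<^sup>2))) * clip c (g n a) * std_gaussian a) \<in> ?C" for n
      by (intro cutoff_clip_approx that continuous_on_compose2[OF continuous_on_clip g(2)]) auto
    show "(\<lambda>n. abs_l2 (\<lambda>a. of_real (cutoff c (exp (- (norm a)\<^sup>2))) * clip c (g n a) * std_gaussian a))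
      \<longlonglongrightarrow> abs_l2 (\<lambda>a. of_real (cutoff c (exp (- (norm a)\<^sup>2))) * clip c (h a) * std_gaussian a)"
    proof (rule abs_l2_tendsto[OF _ _ square_integrable_cmult[OF G, of "of_real c"] bound(1) bound(1)])
      show "AE a in lborel. (\<lambda>n. of_real (cutoff c (exp (- (norm a)\<^sup>2))) * clip c (g n a) * std_gaussian a)
          \<longlonglongrightarrow> of_real (cutoff c (exp (- (norm a)\<^sup>2))) * clip c (h a) * std_gaussian a"
        using ae
      proof eventually_elim
        case (elim a)
        have "isCont (clip c) (h a)"
          using continuous_on_clip[of c] by (simp add: continuous_on_eq_continuous_at)
        then show ?case
          by (intro tendsto_intros isCont_tendsto_compose[OF _ elim])
      qed
    qed (use that in measurable)
  qed
  note * = this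
  show "F \<in> ?C"
  proof (rule closed_sequentially[OF closed_closure])
    let ?f = "\<lambda>n a. of_real (cutoff (real (Suc n)) (exp (- (norm a)\<^sup>2))) * clip (real (Suc n)) (h a) * std_gaussian a"
    show "abs_l2 (?f n) \<in> ?C" for n
      by (rule *) simp
    have "(\<lambda>n. abs_l2 (?f n)) \<longlonglongrightarrow> abs_l2 (\<lambda>a. h a * std_gaussian a)"
    proof (rule abs_l2_tendsto[OF _ _ _ bound(2) order_refl])
      show "(\<lambda>a. h a * std_gaussian a) \<in> square_integrable"
        using f by (simp add: hG)
      show "AE a in lborel. (\<lambda>n. ?f n a) \<longlonglongrightarrow> h a * std_gaussian a"
      proof (rule AE_I2, rule tendsto_eventually)
        fix a :: "real ^ 'n"
        let ?u = "exp (- (norm a)\<^sup>2)"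
        obtain M where M: "real M > cmod (h a)" "real M > 2 / ?u"
          by (metis max_less_iff_conj reals_Archimedean2)
        show "eventually (\<lambda>n. ?f n a = h a * std_gaussian a) sequentially"
        proof (rule eventually_sequentiallyI[of M])
          fix n assume "n \<ge> M"
          then have n: "real (Suc n) \<ge> cmod (h a)" "real (Suc n) > 2 / ?u"
            using M by auto
          have "clip (real (Suc n)) (h a) = h a"
            using n(1) by (simp add: clip_def max_def field_simps)
          moreover have "cutoff (real (Suc n)) ?u = 1"
            using n(2) by (simp add: cutoff_def divide_less_eq)
          ultimately show "?f n a = h a * std_gaussian a"
            by simp
        qed
      qed
    qed simp_all
    then show "(\<lambda>n. abs_l2 (?f n)) \<longlonglongrightarrow> F"
      by (simp only: hG f(2))
  qed
qed

subsection \<open>Directional derivatives\<close>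

definition dir_deriv :: "real ^ 'n::finite \<Rightarrow> (real ^ 'n \<Rightarrow> complex) \<Rightarrow> real ^ 'n \<Rightarrow> complex" where
  "dir_deriv w f a = vector_derivative (\<lambda>t. f (a + t *\<^sub>R w)) (at 0)"

lemma real_polynomial_dir_deriv:
  assumes "real_polynomial_function p"
  shows "\<exists>p'. real_polynomial_function p' \<and>
    (\<forall>a. ((\<lambda>t. p (a + t *\<^sub>R w)) has_real_derivative p' a) (at 0))"
  using assms
proof (induction p rule: real_polynomial_function.induct)
  case (linear f)
  interpret bounded_linear f by fact
  have "((\<lambda>t. f (a + t *\<^sub>R w)) has_real_derivative f w) (at 0)" for a
    unfolding add scaleR by (auto intro!: derivative_eq_intros)
  then show ?case
    by (intro exI[of _ "\<lambda>_. f w"]) auto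
next
  case (const c)
  show ?case by (intro exI[of _ "\<lambda>_. 0"]) auto
next
  case (add f g)
  then obtain f' g' where "real_polynomial_function f'" "real_polynomial_function g'"
    "\<And>a. ((\<lambda>t. f (a + t *\<^sub>R w)) has_real_derivative f' a) (at 0)"
    "\<And>a. ((\<lambda>t. g (a + t *\<^sub>R w)) has_real_derivative g' a) (at 0)"
    by metis
  then show ?case
    by (intro exI[of _ "\<lambda>a. f' a + g' a"]) (auto intro!: derivative_intros)
next
  case (mult f g)
  then obtain f' g' where *: "real_polynomial_function f'" "real_polynomial_function g'"
    "\<And>a. ((\<lambda>t. f (a + t *\<^sub>R w)) has_real_derivative f' a) (at 0)"
    "\<And>a. ((\<lambda>t. g (a + t *\<^sub>R w)) has_real_derivative g' a) (at 0)"
    by metis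
  have "((\<lambda>t. f (a + t *\<^sub>R w) * g (a + t *\<^sub>R w)) has_real_derivative f' a * g a + g' a * f a) (at 0)" for a
    using DERIV_mult[OF *(3,4), of a a] by simp
  then show ?case
    using * mult.hyps by (intro exI[of _ "\<lambda>a. f' a * g a + g' a * f a"]) auto
qed

lemma polynomial_dir_deriv:
  fixes P :: "real ^ 'n::finite \<Rightarrow> complex"
  assumes "polynomial_function P"
  shows "\<exists>P'. polynomial_function P' \<and>
    (\<forall>a. ((\<lambda>t. P (a + t *\<^sub>R w)) has_vector_derivative P' a) (at 0))"
proof -
  obtain p' where p': "real_polynomial_function p'"
    "\<And>a. ((\<lambda>t. Re (P (a + t *\<^sub>R w))) has_real_derivative p' a) (at 0)"
    using real_polynomial_dir_deriv[of "\<lambda>a. Re (P a)" w] assms polynomial_function_complex_iff by blast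
  obtain q' where q': "real_polynomial_function q'"
    "\<And>a. ((\<lambda>t. Im (P (a + t *\<^sub>R w))) has_real_derivative q' a) (at 0)"
    using real_polynomial_dir_deriv[of "\<lambda>a. Im (P a)" w] assms polynomial_function_complex_iff by blast
  show ?thesis
    using p' q' by (intro exI[of _ "\<lambda>a. Complex (p' a) (q' a)"])
      (simp add: polynomial_function_complex_iff has_vector_derivative_complex_iff)
qed

lemma gaussian_dir_deriv:
  "((\<lambda>t. gaussian \<alpha> \<beta> (a + t *\<^sub>R w)) has_vector_derivative
     gaussian \<alpha> \<beta> a * - (\<Sum>i\<in>UNIV. (2 * \<alpha> $ i * of_real (a $ i) + \<beta> $ i) * of_real (w $ i))) (at 0)"
proof -
  define A where "A = (\<Sum>i\<in>UNIV. \<alpha> $ i * complex_of_real ((a $ i)\<^sup>2) + \<beta> $ i * complex_of_real (a $ i))"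
  define B where "B = (\<Sum>i\<in>UNIV. (2 * \<alpha> $ i * of_real (a $ i) + \<beta> $ i) * of_real (w $ i))"
  define C where "C = (\<Sum>i\<in>UNIV. \<alpha> $ i * of_real ((w $ i)\<^sup>2))"
  have eq: "gaussian \<alpha> \<beta> (a + t *\<^sub>R w) = exp (- (A + of_real t * B + (of_real t)\<^sup>2 * C))" for t
    by (simp add: gaussian_def A_def B_def C_def sum.distrib sum_distrib_left power2_sum algebra_simps
        power_mult_distrib)
  have "((\<lambda>z. exp (- (A + z * B + z\<^sup>2 * C))) has_field_derivative exp (- A) * - B) (at (of_real 0))"
    by (auto intro!: derivative_eq_intros)
  then have "((\<lambda>t. exp (- (A + of_real t * B + (of_real t)\<^sup>2 * C))) has_vector_derivative exp (- A) * - B) (at 0)"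
    by (rule has_vector_derivative_real_field)
  then show ?thesis
    unfolding eq by (simp add: A_def B_def gaussian_def)
qed

lemma polynomial_component: "polynomial_function (\<lambda>a. complex_of_real (a $ i))"
  by (intro polynomial_function_of_real real_polynomial_function.intros) (rule bounded_linear_vec_nth)

text \<open>
  The derivative of \<open>exp (- Q) P\<close> in a direction is \<open>exp (- Q) (P' - Q' P)\<close> with derivatives in that
  direction, again a Gaussian times a polynomial.
\<close>

lemma D_dom_dir_deriv_exists:
  assumes "f \<in> D_dom"
  shows "\<exists>f'\<in>D_dom. \<forall>a. ((\<lambda>t. f (a + t *\<^sub>R w)) has_vector_derivative f' a) (at 0)"
  using assms
proof (induction f rule: D_dom_induct)
  case zero
  show ?case by (intro bexI[of _ "\<lambda>_. 0"]) (auto simp: D_dom_zero)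
next
  case (add g h)
  obtain h' where h': "h' \<in> D_dom" "\<And>a. ((\<lambda>t. h (a + t *\<^sub>R w)) has_vector_derivative h' a) (at 0)"
    using add by blast
  obtain \<alpha> \<beta> P where \<alpha>: "\<forall>i. Re (\<alpha> $ i) > 0" and P: "polynomial_function P"
    and g: "g = (\<lambda>a. gaussian \<alpha> \<beta> a * P a)"
    using add(1) by (rule gaussian_polyE)
  obtain P' where P': "polynomial_function P'"
    "\<And>a. ((\<lambda>t. P (a + t *\<^sub>R w)) has_vector_derivative P' a) (at 0)"
    using polynomial_dir_deriv[OF P] by metis
  define R where
    "R = (\<lambda>a :: real ^ 'a. - (\<Sum>i\<in>UNIV. (2 * \<alpha> $ i * of_real (a $ i) + \<beta> $ i) * of_real (w $ i)))"
  have R: "polynomial_function R"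
    unfolding R_def by (intro polynomial_function_minus polynomial_function_sum finite
        polynomial_function_complex_mult polynomial_function_add polynomial_component polynomial_function_const)
  have "((\<lambda>t. g (a + t *\<^sub>R w)) has_vector_derivative gaussian \<alpha> \<beta> a * (P' a + R a * P a)) (at 0)" for a
    using has_vector_derivative_mult[OF gaussian_dir_deriv[of \<alpha> \<beta> a w] P'(2)[of a]]
    unfolding g R_def by (simp add: algebra_simps)
  moreover have "(\<lambda>a. gaussian \<alpha> \<beta> a * (P' a + R a * P a)) \<in> D_dom"
    by (intro gaussian_poly_in_D_dom gaussian_polyI polynomial_function_add
        polynomial_function_complex_mult P P' R \<alpha>[rule_format])
  ultimately show ?case
    using h' by (intro bexI[of _ "\<lambda>a. gaussian \<alpha> \<beta> a * (P' a + R a * P a) + h' a"])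
      (auto intro!: D_dom_add has_vector_derivative_add)
qed

lemma D_dom_has_dir_deriv:
  assumes "f \<in> D_dom"
  shows "((\<lambda>t. f (a + t *\<^sub>R w)) has_vector_derivative dir_deriv w f (a + t *\<^sub>R w)) (at t)"
    and "dir_deriv w f \<in> D_dom"
proof -
  obtain f' where f': "f' \<in> D_dom" "\<And>a. ((\<lambda>t. f (a + t *\<^sub>R w)) has_vector_derivative f' a) (at 0)"
    using D_dom_dir_deriv_exists[OF assms, of w] by blast
  have eq: "dir_deriv w f = f'"
    unfolding dir_deriv_def using f'(2) by (intro ext vector_derivative_at)
  show "dir_deriv w f \<in> D_dom"
    using f' eq by simp
  have "((\<lambda>s. f (a + t *\<^sub>R w + s *\<^sub>R w)) has_vector_derivative f' (a + t *\<^sub>R w)) (at (t - t))"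
    using f'(2) by simp
  then have "((\<lambda>s. f (a + t *\<^sub>R w + s *\<^sub>R w)) \<circ> (\<lambda>s. s - t) has_vector_derivative
      1 *\<^sub>R f' (a + t *\<^sub>R w)) (at t)"
    by (intro vector_diff_chain_at) (auto intro!: derivative_eq_intros)
  then show "((\<lambda>t. f (a + t *\<^sub>R w)) has_vector_derivative dir_deriv w f (a + t *\<^sub>R w)) (at t)"
    unfolding eq by (simp add: o_def algebra_simps)
qed

text \<open>
  Total differentiability is needed for the linearity of \<open>dir_deriv w\<close> in \<open>w\<close>.
\<close>

lemma D_dom_differentiable:
  assumes "f \<in> D_dom"
  shows "f differentiable (at a)"
  using assms
proof (induction f rule: D_dom_induct)
  case (add g h)
  then obtain \<alpha> \<beta> P where P: "polynomial_function P"
    and g: "g = (\<lambda>a. gaussian \<alpha> \<beta> a * P a)"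
    using gaussian_polyE by metis
  define q where
    "q = (\<lambda>a :: real ^ 'a. - (\<Sum>i\<in>UNIV. \<alpha> $ i * (complex_of_real (a $ i) * complex_of_real (a $ i)) +
       \<beta> $ i * complex_of_real (a $ i)))"
  have "polynomial_function q"
    unfolding q_def by (intro polynomial_function_minus polynomial_function_sum finite
        polynomial_function_complex_mult polynomial_function_add polynomial_component polynomial_function_const)
  then have q: "q differentiable (at a)"
    by (rule differentiable_at_polynomial_function)
  have "(exp has_derivative (*) (exp (q a))) (at (q a))"
    using DERIV_exp[of "q a"] by (simp add: has_field_derivative_def)
  then have "(exp \<circ> q) differentiable (at a)"
    by (intro differentiable_chain_at q) (rule differentiableI)
  moreover have "gaussian \<alpha> \<beta> = exp \<circ> q"
    by (rule ext) (simp add: gaussian_def q_def power2_eq_square)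
  ultimately have "gaussian \<alpha> \<beta> differentiable (at a)"
    by simp
  moreover have "P differentiable (at a)"
    by (intro differentiable_at_polynomial_function P)
  ultimately show ?case
    using add unfolding g by (intro differentiable_add differentiable_mult)
qed simp

lemma dir_deriv_eq_frechet:
  assumes "(f has_derivative F) (at a)"
  shows "dir_deriv w f a = F w"
  unfolding dir_deriv_def
proof (rule vector_derivative_at)
  have "((\<lambda>t. a + t *\<^sub>R w) has_vector_derivative w) (at 0)"
    by (auto intro!: derivative_eq_intros)
  then have "((\<lambda>t. a + t *\<^sub>R w) has_derivative (\<lambda>t. t *\<^sub>R w)) (at 0)"
    by (simp add: has_vector_derivative_def)
  from diff_chain_at[OF this, of f F] assms
  have "((\<lambda>t. f (a + t *\<^sub>R w)) has_derivative (\<lambda>t. F (t *\<^sub>R w))) (at 0)"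
    by (simp add: o_def)
  then show "((\<lambda>t. f (a + t *\<^sub>R w)) has_vector_derivative F w) (at 0)"
    using has_derivative_linear[OF assms] by (simp add: has_vector_derivative_def linear_scale)
qed

lemma D_dom_dir_deriv_linear:
  assumes "f \<in> D_dom"
  shows "dir_deriv (r *\<^sub>R v + s *\<^sub>R w) f a = of_real r * dir_deriv v f a + of_real s * dir_deriv w f a"
proof -
  obtain F where F: "(f has_derivative F) (at a)"
    using D_dom_differentiable[OF assms] unfolding differentiable_def by blast
  then have "F (r *\<^sub>R v + s *\<^sub>R w) = r *\<^sub>R F v + s *\<^sub>R F w"
    using has_derivative_linear[OF F] by (simp add: linear_add linear_scale)
  then show ?thesis
    unfolding dir_deriv_eq_frechet[OF F] by (simp add: scaleR_conv_of_real)
qed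

section \<open>The unitary group generated by a first-order operator\<close>

definition lin_op ::
    "real ^ 'n::finite \<Rightarrow> real ^ 'n \<Rightarrow> (real ^ 'n \<Rightarrow> complex) \<Rightarrow> real ^ 'n \<Rightarrow> complex" where
  "lin_op w l f a = \<i> * dir_deriv w f a + of_real (l \<bullet> a) * f a"

text \<open>
  The solution of \<open>\<partial>\<^sub>t u = - \<i> L u\<close> with initial value \<open>f\<close> for \<open>L = lin_op w l\<close>. The phase is the
  integral of \<open>- (l \<bullet> (a + s w))\<close> over \<open>s\<close> from \<open>0\<close> to \<open>t\<close>; its quadratic term is what makes
  \<open>shift_fun_add\<close> true.
\<close>

definition shift_fun ::
    "real ^ 'n::finite \<Rightarrow> real ^ 'n \<Rightarrow> real \<Rightarrow> (real ^ 'n \<Rightarrow> complex) \<Rightarrow> real ^ 'n \<Rightarrow> complex" where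
  "shift_fun w l t f a = cis (- (t * (l \<bullet> a) + t\<^sup>2 / 2 * (l \<bullet> w))) * f (a + t *\<^sub>R w)"

lemma real_polynomial_inner: "real_polynomial_function (\<lambda>a. l \<bullet> a)"
  by (intro real_polynomial_function.intros) (rule bounded_linear_inner_right)

lemma D_dom_lin_op:
  assumes "f \<in> D_dom"
  shows "lin_op w l f \<in> D_dom"
  unfolding lin_op_def
  by (intro D_dom_add D_dom_cmult D_dom_poly_mult D_dom_has_dir_deriv assms
      polynomial_function_of_real real_polynomial_inner)

text \<open>
  A translation by \<open>b\<close> replaces \<open>\<beta>\<close> by \<open>\<beta> + 2 \<alpha> b\<close> and adds a constant to the exponent; the quadratic part
  keeps its diagonal form.
\<close>

lemma D_dom_translate:
  assumes "f \<in> D_dom"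
  shows "(\<lambda>a. f (a + b)) \<in> D_dom"
  using assms
proof (induction f rule: D_dom_induct)
  case zero
  show ?case by (rule D_dom_zero)
next
  case (add g h)
  obtain \<alpha> \<beta> P where \<alpha>: "\<forall>i. Re (\<alpha> $ i) > 0" and P: "polynomial_function P"
    and g: "g = (\<lambda>a. gaussian \<alpha> \<beta> a * P a)"
    using add(1) by (rule gaussian_polyE)
  have "gaussian \<alpha> \<beta> (a + b) = gaussian \<alpha> (\<chi> i. \<beta> $ i + 2 * \<alpha> $ i * of_real (b $ i)) a * gaussian \<alpha> \<beta> b" for a
    unfolding gaussian_def exp_add[symmetric] minus_add_distrib[symmetric] sum.distrib[symmetric]
    by (intro arg_cong[of _ _ exp] arg_cong[of _ _ uminus] sum.cong) (simp_all add: power2_sum algebra_simps)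
  then have "(\<lambda>a. g (a + b)) = (\<lambda>a. gaussian \<alpha> (\<chi> i. \<beta> $ i + 2 * \<alpha> $ i * of_real (b $ i)) a *
      (gaussian \<alpha> \<beta> b * P (a + b)))"
    by (simp add: g mult.assoc)
  moreover have "polynomial_function (P \<circ> (\<lambda>a. a + b))"
    by (intro polynomial_function_compose P polynomial_function_add polynomial_function_id polynomial_function_const)
  ultimately have "(\<lambda>a. g (a + b)) \<in> D_dom"
    using \<alpha> by (auto simp: o_def intro!: gaussian_poly_in_D_dom gaussian_polyI polynomial_function_complex_mult)
  from D_dom_add[OF this add(3)] show ?case .
qed

lemma D_dom_shift_fun:
  assumes "f \<in> D_dom"
  shows "shift_fun w l t f \<in> D_dom"
proof -
  have "cis (- (t * (l \<bullet> a) + t\<^sup>2 / 2 * (l \<bullet> w))) =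
      gaussian 0 (\<chi> i. \<i> * of_real (t * l $ i)) a * cis (- (t\<^sup>2 / 2 * (l \<bullet> w)))" for a
    by (simp add: gaussian_def cis_conv_exp exp_add[symmetric] inner_vec_def sum_distrib_left algebra_simps)
  then show ?thesis
    unfolding shift_fun_def using D_dom_mult[OF D_dom_translate[OF assms], of 0 "\<lambda>_. cis (- (t\<^sup>2 / 2 * (l \<bullet> w)))"]
    by simp
qed

lemma shift_fun_0 [simp]: "shift_fun w l 0 f = f"
  by (simp add: shift_fun_def fun_eq_iff)

lemma shift_fun_add: "shift_fun w l s (shift_fun w l t f) = shift_fun w l (s + t) f"
proof
  fix a
  have "- (s * (l \<bullet> a) + s\<^sup>2 / 2 * (l \<bullet> w)) + - (t * (l \<bullet> (a + s *\<^sub>R w)) + t\<^sup>2 / 2 * (l \<bullet> w))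
      = - ((s + t) * (l \<bullet> a) + (s + t)\<^sup>2 / 2 * (l \<bullet> w))"
    by (simp add: inner_add_right power2_sum field_simps)
  moreover have "a + s *\<^sub>R w + t *\<^sub>R w = a + (s + t) *\<^sub>R w"
    by (simp add: scaleR_add_left)
  ultimately show "shift_fun w l s (shift_fun w l t f) a = shift_fun w l (s + t) f a"
    unfolding shift_fun_def mult.assoc[symmetric] cis_mult by (simp only:)
qed

lemma cis_has_vector_derivative:
  "((\<lambda>t. cis (- (t * p + t\<^sup>2 / 2 * q))) has_vector_derivative
     cis (- (t * p + t\<^sup>2 / 2 * q)) * (- \<i> * of_real (p + t * q))) (at t)"
proof -
  have "((\<lambda>z. exp (\<i> * - (z * of_real p + z\<^sup>2 / 2 * of_real q))) has_field_derivative
      exp (\<i> * - (of_real t * of_real p + (of_real t)\<^sup>2 / 2 * of_real q)) * (- \<i> * of_real (p + t * q)))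
      (at (of_real t))"
    by (auto intro!: derivative_eq_intros simp: algebra_simps)
  from has_vector_derivative_real_field[OF this] show ?thesis
    by (simp add: cis_conv_exp)
qed

lemma shift_fun_has_derivative:
  assumes "f \<in> D_dom"
  shows "((\<lambda>t. shift_fun w l t f a) has_vector_derivative - \<i> * shift_fun w l t (lin_op w l f) a) (at t)"
  unfolding shift_fun_def
  using has_vector_derivative_mult[OF cis_has_vector_derivative[of "l \<bullet> a" "l \<bullet> w" t]
      D_dom_has_dir_deriv(1)[OF assms, of a w t]]
  by (rule has_vector_derivative_eq_rhs) (simp add: lin_op_def algebra_simps)

lemma shift_fun_bound:
  assumes "f \<in> D_dom"
  shows "\<exists>M\<in>square_integrable. \<forall>t a. \<bar>t\<bar> \<le> 1 \<longrightarrow> cmod (shift_fun w l t f a) \<le> cmod (M a)"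
proof -
  obtain C \<delta> where C: "C \<ge> 0" "\<delta> > 0" "\<And>a. cmod (f a) \<le> C * exp (- \<delta> * (norm a)\<^sup>2)"
    using D_dom_bound[OF assms] by blast
  define M where "M a = of_real (C * exp (\<delta> * (norm w)\<^sup>2)) * complex_of_real (exp (- (\<delta> / 2) * (norm a)\<^sup>2))" for a :: "real ^ 'a"
  have "M \<in> square_integrable"
    unfolding M_def by (intro square_integrable_cmult square_integrable_exp_norm) (use C in auto)
  moreover have "cmod (shift_fun w l t f a) \<le> cmod (M a)" if "\<bar>t\<bar> \<le> 1" for t a
  proof -
    have "(norm a)\<^sup>2 \<le> (norm (a + t *\<^sub>R w) + norm (t *\<^sub>R w))\<^sup>2"
      using norm_triangle_ineq4[of "a + t *\<^sub>R w" "t *\<^sub>R w"] by (intro power_mono) auto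
    also have "\<dots> \<le> 2 * (norm (a + t *\<^sub>R w))\<^sup>2 + 2 * (norm (t *\<^sub>R w))\<^sup>2"
      using zero_le_power2[of "norm (a + t *\<^sub>R w) - norm (t *\<^sub>R w)"] by (simp add: power2_sum power2_diff)
    finally have "(norm a)\<^sup>2 \<le> 2 * (norm (a + t *\<^sub>R w))\<^sup>2 + 2 * (norm (t *\<^sub>R w))\<^sup>2" .
    moreover have "(norm (t *\<^sub>R w))\<^sup>2 \<le> (norm w)\<^sup>2"
      using that by (intro power_mono) (auto simp: mult_left_le_one_le)
    ultimately have "(norm a)\<^sup>2 \<le> 2 * (norm (a + t *\<^sub>R w))\<^sup>2 + 2 * (norm w)\<^sup>2"
      by linarith
    then have "\<delta> / 2 * (norm a)\<^sup>2 \<le> \<delta> / 2 * (2 * (norm (a + t *\<^sub>R w))\<^sup>2 + 2 * (norm w)\<^sup>2)"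
      using C by (intro mult_left_mono) auto
    then have *: "- \<delta> * (norm (a + t *\<^sub>R w))\<^sup>2 \<le> \<delta> * (norm w)\<^sup>2 + - (\<delta> / 2) * (norm a)\<^sup>2"
      by (simp add: algebra_simps)
    have "cmod (shift_fun w l t f a) = cmod (f (a + t *\<^sub>R w))"
      by (simp add: shift_fun_def norm_mult)
    also have "\<dots> \<le> C * exp (- \<delta> * (norm (a + t *\<^sub>R w))\<^sup>2)"
      by (rule C)
    also have "\<dots> \<le> C * exp (\<delta> * (norm w)\<^sup>2 + - (\<delta> / 2) * (norm a)\<^sup>2)"
      using * C by (intro mult_left_mono) auto
    also have "\<dots> = cmod (M a)"
      unfolding exp_add M_def norm_mult norm_of_real using C by simp
    finally show ?thesis .
  qed
  ultimately show ?thesis by blast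
qed

text \<open>
  The second derivative in \<open>t\<close> is \<open>- shift_fun w l t (L (L f))\<close>, where \<open>L (L f)\<close> is again in \<open>D\<close> and
  therefore satisfies a bound that is uniform in \<open>t\<close>.
\<close>

lemma shift_fun_taylor:
  assumes "f \<in> D_dom"
  shows "\<exists>M\<in>square_integrable. \<forall>t a. \<bar>t\<bar> \<le> 1 \<longrightarrow>
    cmod (shift_fun w l t f a - f a + \<i> * of_real t * lin_op w l f a) \<le> t\<^sup>2 * cmod (M a)"
proof -
  obtain M where M: "M \<in> square_integrable"
    "\<And>t a. \<bar>t\<bar> \<le> 1 \<Longrightarrow> cmod (shift_fun w l t (lin_op w l (lin_op w l f)) a) \<le> cmod (M a)"
    using shift_fun_bound[OF D_dom_lin_op[OF D_dom_lin_op[OF assms]]] by metis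
  have 1: "cmod (shift_fun w l t (lin_op w l f) a - lin_op w l f a) \<le> \<bar>t\<bar> * cmod (M a)" if "\<bar>t\<bar> \<le> 1" for t a
  proof -
    have "norm (shift_fun w l t (lin_op w l f) a - shift_fun w l 0 (lin_op w l f) a) \<le> cmod (M a) * norm (t - 0)"
    proof (rule differentiable_bound[of "{-1..1}"])
      fix s :: real assume s: "s \<in> {-1..1}"
      show "((\<lambda>t. shift_fun w l t (lin_op w l f) a) has_derivative
          (\<lambda>h. h *\<^sub>R (- \<i> * shift_fun w l s (lin_op w l (lin_op w l f)) a))) (at s within {-1..1})"
        using shift_fun_has_derivative[OF D_dom_lin_op[OF assms]]
        unfolding has_vector_derivative_def by (rule has_derivative_at_withinI)
      show "onorm (\<lambda>h. h *\<^sub>R (- \<i> * shift_fun w l s (lin_op w l (lin_op w l f)) a)) \<le> cmod (M a)"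
        using M(2)[of s a] s by (intro onorm_le) (auto simp: norm_mult mult.commute mult_left_mono)
    qed (use that in auto)
    then show ?thesis by (simp add: mult.commute)
  qed
  have "cmod (shift_fun w l t f a - f a + \<i> * of_real t * lin_op w l f a) \<le> t\<^sup>2 * cmod (M a)"
    if t: "\<bar>t\<bar> \<le> 1" for t a
  proof -
    have "norm (shift_fun w l t f a - shift_fun w l 0 f a - (t - 0) *\<^sub>R (- \<i> * shift_fun w l 0 (lin_op w l f) a))
        \<le> norm (t - 0) * (\<bar>t\<bar> * cmod (M a))"
    proof (rule vector_differentiable_bound_linearization[of "{-\<bar>t\<bar>..\<bar>t\<bar>}"])
      fix s assume s: "s \<in> {-\<bar>t\<bar>..\<bar>t\<bar>}"
      show "((\<lambda>t. shift_fun w l t f a) has_vector_derivative - \<i> * shift_fun w l s (lin_op w l f) a)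
          (at s within {-\<bar>t\<bar>..\<bar>t\<bar>})"
        using shift_fun_has_derivative[OF assms] by (rule has_vector_derivative_at_within)
      have "\<bar>s\<bar> * cmod (M a) \<le> \<bar>t\<bar> * cmod (M a)"
        using s by (intro mult_right_mono) auto
      moreover have "norm (- \<i> * shift_fun w l s (lin_op w l f) a - - \<i> * shift_fun w l 0 (lin_op w l f) a)
          = cmod (shift_fun w l s (lin_op w l f) a - lin_op w l f a)"
        unfolding right_diff_distrib[symmetric] norm_mult by simp
      moreover have "\<bar>s\<bar> \<le> 1" using s t by auto
      ultimately show "norm (- \<i> * shift_fun w l s (lin_op w l f) a - - \<i> * shift_fun w l 0 (lin_op w l f) a)
          \<le> \<bar>t\<bar> * cmod (M a)"
        using 1[of s a] by linarith
    qed (auto simp: closed_segment_eq_real_ivl)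
    then show ?thesis
      by (simp add: scaleR_conv_of_real power2_eq_square mult_ac)
  qed
  then show ?thesis
    using M(1) by blast
qed

subsection \<open>The unitary group and its generator\<close>

definition shift_op ::
    "real ^ 'n::finite \<Rightarrow> real ^ 'n \<Rightarrow> real \<Rightarrow> 'n l2 \<Rightarrow> 'n l2" where
  "shift_op w l t =
     weighted_comp (\<lambda>a. cis (- (t * (l \<bullet> a) + t\<^sup>2 / 2 * (l \<bullet> w)))) (\<lambda>a. a + t *\<^sub>R w)"

lemma weighted_composition_shift:
  "weighted_composition (\<lambda>a :: real ^ 'n::finite. cis (- (t * (l \<bullet> a) + t\<^sup>2 / 2 * (l \<bullet> w)))) (\<lambda>a. a + t *\<^sub>R w)"
proof
  show "(\<lambda>a. cis (- (t * (l \<bullet> a) + t\<^sup>2 / 2 * (l \<bullet> w)))) \<in> borel_measurable borel"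
    by (intro borel_measurable_continuous_onI continuous_intros)
  show "distr lborel borel (\<lambda>a. a + t *\<^sub>R w) = lborel"
    using lborel_distr_plus[of "t *\<^sub>R w"] by (simp add: add.commute[of _ "t *\<^sub>R w"])
qed auto

lemma shift_fun_eq:
  "shift_fun w l t f = (\<lambda>a. cis (- (t * (l \<bullet> a) + t\<^sup>2 / 2 * (l \<bullet> w))) * f (a + t *\<^sub>R w))"
  by (rule ext) (rule shift_fun_def)

lemma shift_op_abs_l2:
  assumes "f \<in> square_integrable"
  shows "shift_op w l t (abs_l2 f) = abs_l2 (shift_fun w l t f)"
  unfolding shift_op_def shift_fun_eq
  by (rule weighted_composition.weighted_comp_abs_l2[OF weighted_composition_shift assms])

lemma square_integrable_shift_fun:
  assumes "f \<in> square_integrable"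
  shows "shift_fun w l t f \<in> square_integrable"
  unfolding shift_fun_eq
  by (rule weighted_composition.square_integrable_weighted_comp[OF weighted_composition_shift assms])

lemma shift_op_add: "shift_op w l s (shift_op w l t F) = shift_op w l (s + t) F"
proof -
  obtain f where "f \<in> square_integrable" "F = abs_l2 f" by (rule abs_l2_cases)
  then show ?thesis
    by (simp add: shift_op_abs_l2 square_integrable_shift_fun shift_fun_add)
qed

lemma shift_op_0 [simp]: "shift_op w l 0 F = F"
proof -
  obtain f where "f \<in> square_integrable" "F = abs_l2 f" by (rule abs_l2_cases)
  then show ?thesis
    by (simp add: shift_op_abs_l2)
qed

lemma cinner_shift_op: "cinner (shift_op w l t F) (shift_op w l t G) = cinner F G"
  unfolding shift_op_def by (rule weighted_composition.cinner_weighted_comp[OF weighted_composition_shift])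

lemma norm_shift_op: "norm (shift_op w l t F) = norm F"
  unfolding shift_op_def by (rule weighted_composition.norm_weighted_comp[OF weighted_composition_shift])

lemma shift_op_diff: "shift_op w l t (F - G) = shift_op w l t F - shift_op w l t G"
  unfolding shift_op_def by (rule weighted_composition.weighted_comp_diff[OF weighted_composition_shift])

lemma cinner_shift_op_left: "cinner (shift_op w l t F) G = cinner F (shift_op w l (- t) G)"
  using cinner_shift_op[of w l t F "shift_op w l (- t) G"] by (simp add: shift_op_add)

text \<open>
  The generator in the weak sense: only the matrix coefficients of the group are differentiated. The
  factor is \<open>- \<i>\<close> so that it extends \<open>L\<close> and not \<open>- \<i> L\<close>. In this form the inclusion of an adjoint operator,
  which is itself defined by matrix coefficients, can be proved without a limit in norm.
\<close>

definition generator :: "(real \<Rightarrow> 'n::finite l2 \<Rightarrow> 'n l2) \<Rightarrow> 'n op" where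
  "generator U =
     {(g, h). \<forall>u. ((\<lambda>t. cinner (U t g) u) has_vector_derivative - \<i> * cinner h u) (at 0)}"

lemma has_vector_derivative_at_0I:
  fixes f :: "real \<Rightarrow> 'a::real_normed_vector"
  assumes "\<And>e. e > 0 \<Longrightarrow> \<exists>d>0. \<forall>t. \<bar>t\<bar> < d \<longrightarrow> norm (f t - f 0 - t *\<^sub>R v) \<le> e * \<bar>t\<bar>"
  shows "(f has_vector_derivative v) (at 0)"
  unfolding has_vector_derivative_def has_derivative_at_alt
  using assms by (simp add: bounded_linear_scaleR_left)

lemma norm_shift_op_remainder:
  assumes "f \<in> D_dom"
  shows "\<exists>C\<ge>0. \<forall>t. \<bar>t\<bar> \<le> 1 \<longrightarrow>
    norm (abs_l2 (\<lambda>a. shift_fun w l t f a - f a + \<i> * of_real t * lin_op w l f a)) \<le> t\<^sup>2 * C"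
proof -
  obtain M where M: "M \<in> square_integrable"
    "\<And>t a. \<bar>t\<bar> \<le> 1 \<Longrightarrow> cmod (shift_fun w l t f a - f a + \<i> * of_real t * lin_op w l f a) \<le> t\<^sup>2 * cmod (M a)"
    using shift_fun_taylor[OF assms, of w l] by metis
  have "norm (abs_l2 (\<lambda>a. shift_fun w l t f a - f a + \<i> * of_real t * lin_op w l f a)) \<le> t\<^sup>2 * norm (abs_l2 M)"
    if "\<bar>t\<bar> \<le> 1" for t
    by (intro norm_abs_l2_le M that square_integrable_add square_integrable_diff square_integrable_cmult
        D_dom_square_integrable D_dom_shift_fun D_dom_lin_op assms zero_le_power2)
  then show ?thesis
    by (intro exI[of _ "norm (abs_l2 M)"]) auto
qed

lemma op_on_D_subset_generator: "op_on_D (lin_op w l) \<subseteq> generator (shift_op w l)"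
proof -
  have "((\<lambda>t. cinner (shift_op w l t (abs_l2 f)) u) has_vector_derivative - \<i> * cinner (abs_l2 (lin_op w l f)) u) (at 0)"
    if f: "f \<in> D_dom" for f and u :: "'a l2"
  proof (rule has_vector_derivative_at_0I)
    fix e :: real assume "e > 0"
    obtain C where C: "C \<ge> 0" "\<And>t. \<bar>t\<bar> \<le> 1 \<Longrightarrow>
      norm (abs_l2 (\<lambda>a. shift_fun w l t f a - f a + \<i> * of_real t * lin_op w l f a)) \<le> t\<^sup>2 * C"
      using norm_shift_op_remainder[OF f, of w l] by metis
    obtain v where v: "v \<in> square_integrable" "u = abs_l2 v" by (rule abs_l2_cases)
    note sq = D_dom_square_integrable[OF f] D_dom_square_integrable[OF D_dom_shift_fun[OF f]]
      D_dom_square_integrable[OF D_dom_lin_op[OF f]]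
    define d where "d = min 1 (e / (C * norm u + 1))"
    have pos: "C * norm u + 1 > 0" using C by (simp add: add_nonneg_pos)
    show "\<exists>d>0. \<forall>t. \<bar>t\<bar> < d \<longrightarrow> norm (cinner (shift_op w l t (abs_l2 f)) u - cinner (shift_op w l 0 (abs_l2 f)) u
        - t *\<^sub>R (- \<i> * cinner (abs_l2 (lin_op w l f)) u)) \<le> e * \<bar>t\<bar>"
    proof (intro exI[of _ d] conjI allI impI)
      show "d > 0" using pos \<open>e > 0\<close> by (simp add: d_def)
      fix t assume t: "\<bar>t\<bar> < d"
      have "cinner (shift_op w l t (abs_l2 f)) u - cinner (shift_op w l 0 (abs_l2 f)) u
          - t *\<^sub>R (- \<i> * cinner (abs_l2 (lin_op w l f)) u)
          = cinner (abs_l2 (\<lambda>a. shift_fun w l t f a - f a + \<i> * of_real t * lin_op w l f a)) u"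
      proof -
        note int = square_integrable_mult_cnj[OF sq(1) v(1)] square_integrable_mult_cnj[OF sq(2) v(1), of w l t]
          square_integrable_mult_cnj[OF sq(3) v(1), of w l]
        have "cinner (abs_l2 (\<lambda>a. shift_fun w l t f a - f a + \<i> * of_real t * lin_op w l f a)) u
          = (LINT a|lborel. shift_fun w l t f a * cnj (v a) - f a * cnj (v a)
              + (\<i> * of_real t) * (lin_op w l f a * cnj (v a)))"
          unfolding v(2)
          by (subst cinner_abs_l2) (auto intro!: square_integrable_add square_integrable_diff
              square_integrable_cmult sq v simp: algebra_simps)
        also have "\<dots> = cinner (abs_l2 (shift_fun w l t f)) u - cinner (abs_l2 f) u
            + (\<i> * of_real t) * cinner (abs_l2 (lin_op w l f)) u"
          using int v sq by (simp add: cinner_abs_l2)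
        finally show ?thesis
          by (simp add: shift_op_abs_l2 sq scaleR_conv_of_real)
      qed
      also have "cmod \<dots> \<le> norm (abs_l2 (\<lambda>a. shift_fun w l t f a - f a + \<i> * of_real t * lin_op w l f a)) * norm u"
        by (rule cinner_bound)
      also have "\<dots> \<le> (t\<^sup>2 * C) * norm u"
        using t by (intro mult_right_mono C) (auto simp: d_def)
      also have "\<dots> = \<bar>t\<bar> * (\<bar>t\<bar> * (C * norm u))"
        by (simp add: power2_eq_square)
      also have "\<dots> \<le> \<bar>t\<bar> * e"
      proof (rule mult_left_mono)
        have "\<bar>t\<bar> * (C * norm u) \<le> \<bar>t\<bar> * (C * norm u + 1)"
          by (intro mult_left_mono) auto
        also have "\<dots> \<le> e"
          using t pos by (simp add: d_def field_simps)
        finally show "\<bar>t\<bar> * (C * norm u) \<le> e" .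
      qed auto
      finally show "norm (cinner (shift_op w l t (abs_l2 f)) u - cinner (shift_op w l 0 (abs_l2 f)) u
        - t *\<^sub>R (- \<i> * cinner (abs_l2 (lin_op w l f)) u)) \<le> e * \<bar>t\<bar>"
        by (simp add: mult.commute)
    qed
  qed
  then show ?thesis
    by (auto simp: op_on_D_def generator_def)
qed

lemma cnj_cinner_shift_op:
  "cinner (shift_op w l t F) G = cnj (cinner (shift_op w l (- t) G) F)"
  by (metis cinner_commute cinner_shift_op_left)

lemma has_vector_derivative_cnj_reflect:
  assumes "(f has_vector_derivative v) (at 0)"
  shows "((\<lambda>t. cnj (f (- t))) has_vector_derivative - cnj v) (at 0)"
proof -
  have "((\<lambda>t. - t) has_vector_derivative -1) (at (0::real))"
    by (auto intro!: derivative_eq_intros)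
  from vector_diff_chain_at[OF this, of f v] assms
  have "((\<lambda>t. f (- t)) has_vector_derivative - v) (at 0)"
    by (simp add: o_def)
  from has_vector_derivative_cnj[OF this] show ?thesis by simp
qed

text \<open>
  Differentiate \<open>\<langle>U\<^sub>t f, g\<rangle> = \<langle>f, U\<^sub>-\<^sub>t g\<rangle>\<close> at \<open>t = 0\<close> in both ways.
\<close>

lemma generator_symmetric: "generator (shift_op w l) \<subseteq> op_adjoint (generator (shift_op w l))"
proof -
  have "cinner f' g = cinner f h" if "(f, f') \<in> generator (shift_op w l)" "(g, h) \<in> generator (shift_op w l)"
    for f f' g h
  proof -
    have "((\<lambda>t. cinner (shift_op w l t f) g) has_vector_derivative - \<i> * cinner f' g) (at 0)"
      using that by (auto simp: generator_def)
    moreover have "((\<lambda>t. cinner (shift_op w l t g) f) has_vector_derivative - \<i> * cinner h f) (at 0)"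
      using that by (auto simp: generator_def)
    from has_vector_derivative_cnj_reflect[OF this]
    have "((\<lambda>t. cinner (shift_op w l t f) g) has_vector_derivative - \<i> * cinner f h) (at 0)"
      by (simp add: cnj_cinner_shift_op[of w l _ f g] cinner_commute[of f h])
    ultimately have "- \<i> * cinner f' g = - \<i> * cinner f h"
      by (rule vector_derivative_unique_at)
    then show ?thesis by simp
  qed
  then show ?thesis
    unfolding op_adjoint_def by blast
qed

lemma shift_op_continuous_on_D:
  assumes "f \<in> D_dom" "e > 0"
  shows "\<exists>d>0. d \<le> 1 \<and> (\<forall>t. \<bar>t\<bar> < d \<longrightarrow> norm (shift_op w l t (abs_l2 f) - abs_l2 f) \<le> e)"
proof -
  obtain C where C: "C \<ge> 0" "\<And>t. \<bar>t\<bar> \<le> 1 \<Longrightarrow>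
    norm (abs_l2 (\<lambda>a. shift_fun w l t f a - f a + \<i> * of_real t * lin_op w l f a)) \<le> t\<^sup>2 * C"
    using norm_shift_op_remainder[OF assms(1), of w l] by metis
  note sq = D_dom_square_integrable[OF assms(1)] D_dom_square_integrable[OF D_dom_shift_fun[OF assms(1)]]
    D_dom_square_integrable[OF D_dom_lin_op[OF assms(1)]]
  define N where "N = norm (abs_l2 (lin_op w l f))"
  have pos: "C + N + 1 > 0" using C by (simp add: N_def add_nonneg_pos)
  define d where "d = min 1 (e / (C + N + 1))"
  have "norm (shift_op w l t (abs_l2 f) - abs_l2 f) \<le> e" if t: "\<bar>t\<bar> < d" for t
  proof -
    have t1: "\<bar>t\<bar> \<le> 1" using t by (simp add: d_def)
    define r where "r = (\<lambda>a. shift_fun w l t f a - f a + \<i> * of_real t * lin_op w l f a)"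
    define s where "s = (\<lambda>a. \<i> * of_real t * lin_op w l f a)"
    have rs: "r \<in> square_integrable" "s \<in> square_integrable"
      unfolding r_def s_def by (intro square_integrable_add square_integrable_diff square_integrable_cmult sq)+
    have "shift_op w l t (abs_l2 f) - abs_l2 f = abs_l2 r - abs_l2 s"
      using sq rs by (simp add: shift_op_abs_l2 diff_abs_l2) (simp add: r_def s_def)
    also have "norm \<dots> \<le> norm (abs_l2 r) + norm (abs_l2 s)"
      by (rule norm_triangle_ineq4)
    also have "norm (abs_l2 s) \<le> \<bar>t\<bar> * N"
      unfolding N_def by (rule norm_abs_l2_le[OF rs(2) sq(3)]) (auto simp: s_def norm_mult)
    also have "norm (abs_l2 r) \<le> t\<^sup>2 * C"
      unfolding r_def by (rule C(2)[OF t1])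
    also have "t\<^sup>2 * C \<le> \<bar>t\<bar> * C"
      using t1 C(1) mult_left_le_one_le[of "\<bar>t\<bar>" "\<bar>t\<bar>"] by (intro mult_right_mono) (auto simp: power2_eq_square)
    also have "\<bar>t\<bar> * C + \<bar>t\<bar> * N \<le> \<bar>t\<bar> * (C + N + 1)"
      by (simp add: algebra_simps)
    also have "\<dots> \<le> e"
      using t pos by (simp add: d_def field_simps)
    finally show ?thesis by simp
  qed
  then show ?thesis
    using pos assms(2) by (intro exI[of _ d]) (auto simp: d_def)
qed

lemma D_dom_approx:
  fixes u :: "'n::finite l2"
  assumes "e > 0"
  obtains f where "f \<in> D_dom" "norm (u - abs_l2 f) < e"
proof -
  have "u \<in> closure (abs_l2 ` D_dom)"
    by (simp add: D_dom_dense)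
  then obtain f where "f \<in> D_dom" "dist (abs_l2 f) u < e"
    using assms unfolding closure_approachable by blast
  then show ?thesis
    by (intro that) (auto simp: dist_norm norm_minus_commute)
qed

lemma op_adjointD:
  "(g, h) \<in> op_adjoint T \<Longrightarrow> (f, f') \<in> T \<Longrightarrow> cinner f' g = cinner f h"
  by (auto simp: op_adjoint_def)

text \<open>
  As \<open>U\<^sub>t f\<close> is again in \<open>D\<close>, the defining property of the adjoint applies to it at every time \<open>t\<close>.
\<close>

lemma adjoint_flow_derivative:
  assumes "(g, h) \<in> op_adjoint (op_on_D (lin_op w l))" "f \<in> D_dom"
  shows "((\<lambda>t. cinner (shift_op w l t (abs_l2 f)) g) has_vector_derivative
    - \<i> * cinner (shift_op w l t (abs_l2 f)) h) (at t)"
proof -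
  define f' where "f' = shift_fun w l t f"
  have f': "f' \<in> D_dom" "abs_l2 f' = shift_op w l t (abs_l2 f)"
    unfolding f'_def by (auto intro!: D_dom_shift_fun assms simp: shift_op_abs_l2 D_dom_square_integrable[OF assms(2)])
  then have pair: "(abs_l2 f', abs_l2 (lin_op w l f')) \<in> op_on_D (lin_op w l)"
    unfolding op_on_D_def by blast
  have "((\<lambda>s. cinner (shift_op w l s (abs_l2 f')) g) has_vector_derivative - \<i> * cinner (abs_l2 (lin_op w l f')) g) (at 0)"
    using subsetD[OF op_on_D_subset_generator pair] by (simp add: generator_def)
  also have "cinner (abs_l2 (lin_op w l f')) g = cinner (abs_l2 f') h"
    by (rule op_adjointD[OF assms(1) pair])
  finally have "((\<lambda>s. cinner (shift_op w l (s + t) (abs_l2 f)) g) has_vector_derivative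
      - \<i> * cinner (shift_op w l t (abs_l2 f)) h) (at (t - t))"
    by (simp add: f'(2) shift_op_add)
  moreover have "((\<lambda>s. s - t) has_vector_derivative 1) (at t)"
    by (auto intro!: derivative_eq_intros)
  ultimately have "((\<lambda>s. cinner (shift_op w l (s + t) (abs_l2 f)) g) \<circ> (\<lambda>s. s - t) has_vector_derivative
      1 *\<^sub>R (- \<i> * cinner (shift_op w l t (abs_l2 f)) h)) (at t)"
    by (intro vector_diff_chain_at)
  then show ?thesis
    by (simp add: o_def)
qed

text \<open>
  By unitarity it suffices to differentiate \<open>\<langle>U\<^sub>t u, g\<rangle>\<close> at \<open>t = 0\<close> for an arbitrary \<open>u\<close>. For \<open>u\<close> in
  \<open>D\<close> the derivative is \<open>- \<i> \<langle>U\<^sub>t u, h\<rangle>\<close>, so the mean value theorem bounds the error of the linear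
  approximation by \<open>|t| |h|\<close> times the largest displacement \<open>|U\<^sub>s u - u|\<close> with \<open>|s| \<le> |t|\<close>. For
  general \<open>u\<close> two approximations from \<open>D\<close> are used. A fixed one, \<open>f0\<close>, controls the displacement, and one
  that depends on \<open>t\<close>, \<open>f\<close>, is so close to \<open>u\<close> that replacing \<open>u\<close> by \<open>f\<close> costs only a small multiple of
  \<open>|t|\<close>.
\<close>

lemma adjoint_subset_generator:
  "op_adjoint (op_on_D (lin_op w l)) \<subseteq> generator (shift_op w l)"
proof clarify
  fix g h assume gh: "(g, h) \<in> op_adjoint (op_on_D (lin_op w l))"
  let ?U = "shift_op w l"
  have "((\<lambda>t. cinner (?U t u) g) has_vector_derivative - \<i> * cinner u h) (at 0)" for u
  proof (rule has_vector_derivative_at_0I)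
    fix e :: real assume "e > 0"
    \<comment> \<open>The displacement of \<open>f\<close> is at most \<open>5 \<epsilon>\<close> and contributes \<open>5 |h|\<close>; replacing \<open>u\<close> by \<open>f\<close> contributes
      \<open>2 |g|\<close> from the values at \<open>t\<close> and \<open>0\<close> and \<open>|h|\<close> from the linear term.\<close>
    define c where "c = 6 * norm h + 2 * norm g + 1"
    have "c > 0" by (simp add: c_def add_nonneg_pos)
    define \<epsilon> where "\<epsilon> = e / c"
    have \<epsilon>: "\<epsilon> > 0" "\<epsilon> * c = e"
      using \<open>c > 0\<close> \<open>e > 0\<close> by (auto simp: \<epsilon>_def)
    obtain f0 where f0: "f0 \<in> D_dom" "norm (u - abs_l2 f0) < \<epsilon>"
      using D_dom_approx[OF \<epsilon>(1)] by blast
    obtain d where d: "d > 0" "d \<le> 1" "\<And>t. \<bar>t\<bar> < d \<Longrightarrow> norm (?U t (abs_l2 f0) - abs_l2 f0) \<le> \<epsilon>"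
      using shift_op_continuous_on_D[OF f0(1) \<epsilon>(1)] by metis
    show "\<exists>d>0. \<forall>t. \<bar>t\<bar> < d \<longrightarrow>
      norm (cinner (?U t u) g - cinner (?U 0 u) g - t *\<^sub>R (- \<i> * cinner u h)) \<le> e * \<bar>t\<bar>"
    proof (intro exI[of _ d] conjI allI impI d(1))
      fix t assume t: "\<bar>t\<bar> < d"
      show "norm (cinner (?U t u) g - cinner (?U 0 u) g - t *\<^sub>R (- \<i> * cinner u h)) \<le> e * \<bar>t\<bar>"
      proof (cases "t = 0")
        case False
        then have "\<bar>t\<bar> * \<epsilon> > 0" using \<epsilon> by simp
        then obtain f where f: "f \<in> D_dom" "norm (u - abs_l2 f) < \<bar>t\<bar> * \<epsilon>"
          using D_dom_approx by blast
        have "\<bar>t\<bar> * \<epsilon> \<le> 1 * \<epsilon>"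
          using t d \<epsilon> by (intro mult_right_mono) auto
        with f have f_u: "norm (u - abs_l2 f) < \<epsilon>" by simp
        define r where "r = u - abs_l2 f"
        have ff0: "norm (abs_l2 f - abs_l2 f0) \<le> 2 * \<epsilon>"
          using norm_triangle_ineq4[of "u - abs_l2 f0" "u - abs_l2 f"] f0(2) f_u by simp
        have move: "norm (?U s (abs_l2 f) - abs_l2 f) \<le> 5 * \<epsilon>" if "\<bar>s\<bar> < d" for s
        proof -
          have "?U s (abs_l2 f) - abs_l2 f
              = ?U s (abs_l2 f - abs_l2 f0) + (?U s (abs_l2 f0) - abs_l2 f0) - (abs_l2 f - abs_l2 f0)"
            by (simp add: shift_op_diff)
          also have "norm \<dots> \<le> norm (?U s (abs_l2 f - abs_l2 f0)) + norm (?U s (abs_l2 f0) - abs_l2 f0)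
              + norm (abs_l2 f - abs_l2 f0)"
            by (intro order_trans[OF norm_triangle_ineq4] add_right_mono norm_triangle_ineq)
          finally show ?thesis
            using ff0 d(3)[OF that] unfolding norm_shift_op by linarith
        qed
        have "norm (cinner (?U t (abs_l2 f)) g - cinner (?U 0 (abs_l2 f)) g
            - (t - 0) *\<^sub>R (- \<i> * cinner (?U 0 (abs_l2 f)) h)) \<le> norm (t - 0) * (5 * \<epsilon> * norm h)"
        proof (rule vector_differentiable_bound_linearization[of "{-\<bar>t\<bar>..\<bar>t\<bar>}"])
          fix s assume "s \<in> {-\<bar>t\<bar>..\<bar>t\<bar>}"
          then have s: "\<bar>s\<bar> < d" using t by auto
          show "((\<lambda>t. cinner (?U t (abs_l2 f)) g) has_vector_derivative - \<i> * cinner (?U s (abs_l2 f)) h)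
              (at s within {-\<bar>t\<bar>..\<bar>t\<bar>})"
            by (rule has_vector_derivative_at_within[OF adjoint_flow_derivative[OF gh f(1)]])
          have "norm (- \<i> * cinner (?U s (abs_l2 f)) h - - \<i> * cinner (?U 0 (abs_l2 f)) h)
              = cmod (cinner (?U s (abs_l2 f) - abs_l2 f) h)"
            unfolding right_diff_distrib[symmetric] norm_mult by (simp add: cinner_diff_left)
          also have "\<dots> \<le> norm (?U s (abs_l2 f) - abs_l2 f) * norm h"
            by (rule cinner_bound)
          also have "\<dots> \<le> 5 * \<epsilon> * norm h"
            by (intro mult_right_mono move s) auto
          finally show "norm (- \<i> * cinner (?U s (abs_l2 f)) h - - \<i> * cinner (?U 0 (abs_l2 f)) h) \<le> 5 * \<epsilon> * norm h" .
        qed (auto simp: closed_segment_eq_real_ivl)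
        then have main: "norm (cinner (?U t (abs_l2 f)) g - cinner (abs_l2 f) g
            - t *\<^sub>R (- \<i> * cinner (abs_l2 f) h)) \<le> \<bar>t\<bar> * (5 * \<epsilon> * norm h)"
          by simp
        have r: "norm r \<le> \<bar>t\<bar> * \<epsilon>"
          using f(2) by (simp add: r_def)
        have r1: "cmod (cinner (?U t r) g) \<le> \<bar>t\<bar> * \<epsilon> * norm g"
          using cinner_bound[of "?U t r" g] mult_right_mono[OF r, of "norm g"] by (simp add: norm_shift_op)
        have r2: "cmod (cinner r g) \<le> \<bar>t\<bar> * \<epsilon> * norm g"
          using cinner_bound[of r g] mult_right_mono[OF r, of "norm g"] by simp
        have r3: "cmod (t *\<^sub>R (- \<i> * cinner r h)) \<le> \<bar>t\<bar> * (\<epsilon> * norm h)"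
        proof -
          have "\<bar>t\<bar> * \<epsilon> \<le> \<epsilon>" using \<open>\<bar>t\<bar> * \<epsilon> \<le> 1 * \<epsilon>\<close> by simp
          with r have "norm r * norm h \<le> \<epsilon> * norm h"
            by (intro mult_right_mono) auto
          with cinner_bound[of r h] have "cmod (cinner r h) \<le> \<epsilon> * norm h" by simp
          then show ?thesis by (simp add: norm_mult mult_left_mono)
        qed
        have "cinner (?U t u) g - cinner (?U 0 u) g - t *\<^sub>R (- \<i> * cinner u h)
            = (cinner (?U t (abs_l2 f)) g - cinner (abs_l2 f) g - t *\<^sub>R (- \<i> * cinner (abs_l2 f) h))
              + cinner (?U t r) g - cinner r g - t *\<^sub>R (- \<i> * cinner r h)"
          by (simp add: r_def shift_op_diff cinner_diff_left right_diff_distrib scaleR_diff_right)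
        also have "cmod \<dots> \<le> cmod (cinner (?U t (abs_l2 f)) g - cinner (abs_l2 f) g - t *\<^sub>R (- \<i> * cinner (abs_l2 f) h))
              + cmod (cinner (?U t r) g) + cmod (cinner r g) + cmod (t *\<^sub>R (- \<i> * cinner r h))"
          by (intro order_trans[OF norm_triangle_ineq4] add_right_mono norm_triangle_ineq)
        also have "\<dots> \<le> \<bar>t\<bar> * (5 * \<epsilon> * norm h) + \<bar>t\<bar> * \<epsilon> * norm g + \<bar>t\<bar> * \<epsilon> * norm g + \<bar>t\<bar> * (\<epsilon> * norm h)"
          by (intro add_mono main r1 r2 r3)
        also have "\<dots> = \<bar>t\<bar> * (\<epsilon> * (6 * norm h + 2 * norm g))"
          by (simp add: algebra_simps)
        also have "\<dots> \<le> \<bar>t\<bar> * (\<epsilon> * c)"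
          using \<epsilon>(1) by (intro mult_left_mono) (auto simp: c_def)
        finally show ?thesis
          using \<epsilon>(2) by (simp add: mult.commute)
      qed simp
    qed
  qed
  from has_vector_derivative_cnj_reflect[OF this]
  have "((\<lambda>t. cinner (?U t g) u) has_vector_derivative - \<i> * cinner h u) (at 0)" for u
    by (simp add: cnj_cinner_shift_op[of w l _ g u] cinner_commute[of h u])
  then show "(g, h) \<in> generator ?U"
    by (simp add: generator_def)
qed

subsection \<open>Self-adjoint extensions\<close>

lemma op_adjoint_antimono: "S \<subseteq> T \<Longrightarrow> op_adjoint T \<subseteq> op_adjoint S"
  by (auto simp: op_adjoint_def)

lemma generator_self_adjoint: "self_adjoint (generator (shift_op w l))"
proof -
  have "closure (Domain (generator (shift_op w l))) = UNIV"
  proof -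
    have "abs_l2 ` D_dom \<subseteq> Domain (generator (shift_op w l))"
      using op_on_D_subset_generator[of w l] by (auto simp: op_on_D_def)
    from closure_mono[OF this] show ?thesis
      by (auto simp: D_dom_dense)
  qed
  moreover have "op_adjoint (generator (shift_op w l)) \<subseteq> generator (shift_op w l)"
    by (rule order_trans[OF op_adjoint_antimono[OF op_on_D_subset_generator] adjoint_subset_generator])
  ultimately show ?thesis
    using generator_symmetric unfolding self_adjoint_def by blast
qed

text \<open>
  A self-adjoint extension \<open>B\<close> of \<open>S\<close> lies in the adjoint of \<open>S\<close> and hence in \<open>A\<close>. Taking adjoints
  reverses the inclusion \<open>B \<subseteq> A\<close>.
\<close>

lemma essentially_self_adjointI:
  assumes "self_adjoint A" "S \<subseteq> A" "op_adjoint S \<subseteq> A"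
  shows "unique_sa_extension S" "sa_extension S = A"
proof -
  have unique: "B = A" if "self_adjoint B" "S \<subseteq> B" for B
  proof -
    have "B \<subseteq> A"
      using op_adjoint_antimono[OF that(2)] that(1) assms(3) by (auto simp: self_adjoint_def)
    moreover from op_adjoint_antimono[OF this] have "A \<subseteq> B"
      using that(1) assms(1) by (simp add: self_adjoint_def)
    ultimately show ?thesis by blast
  qed
  show "unique_sa_extension S"
    unfolding unique_sa_extension_def using assms unique by blast
  show "sa_extension S = A"
    unfolding sa_extension_def by (rule the_equality) (use assms unique in blast)+
qed

text \<open>
  Larger operators have smaller adjoints, so \<open>T\<close> inherits the inclusion of its adjoint in the generator
  from \<open>L\<close> on \<open>D\<close>, and symmetry puts \<open>T\<close> itself below the generator.
\<close>

lemma symmetric_extension_unique_sa: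
  assumes "op_on_D (lin_op w l) \<subseteq> T" "T \<subseteq> op_adjoint T"
  shows "unique_sa_extension T" "sa_extension T = generator (shift_op w l)"
proof -
  have "op_adjoint T \<subseteq> generator (shift_op w l)"
    by (rule order_trans[OF op_adjoint_antimono[OF assms(1)] adjoint_subset_generator])
  note * = generator_self_adjoint order_trans[OF assms(2) this] this
  show "unique_sa_extension T" "sa_extension T = generator (shift_op w l)"
    by (rule essentially_self_adjointI[OF *])+
qed

lemma op_on_D_symmetric: "op_on_D (lin_op w l) \<subseteq> op_adjoint (op_on_D (lin_op w l))"
  by (rule order_trans[OF op_on_D_subset_generator
      order_trans[OF generator_symmetric op_adjoint_antimono[OF op_on_D_subset_generator]]])

lemma symmetric_op_add:
  assumes "S \<subseteq> op_adjoint S" "T \<subseteq> op_adjoint T"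
  shows "op_add S T \<subseteq> op_adjoint (op_add S T)"
proof -
  have "cinner x' y = cinner x y'" if "(x, x') \<in> S" "(y, y') \<in> S" for x x' y y'
    using assms(1) that by (auto simp: op_adjoint_def)
  moreover have "cinner x' y = cinner x y'" if "(x, x') \<in> T" "(y, y') \<in> T" for x x' y y'
    using assms(2) that by (auto simp: op_adjoint_def)
  ultimately show ?thesis
    unfolding op_add_def op_adjoint_def
    by (auto simp: cinner_add_left cinner_add_right intro!: arg_cong2[of _ _ _ _ "(+)"])
qed

lemma symmetric_op_scale:
  assumes "T \<subseteq> op_adjoint T"
  shows "op_scale r T \<subseteq> op_adjoint (op_scale r T)"
proof -
  have "cinner x' y = cinner x y'" if "(x, x') \<in> T" "(y, y') \<in> T" for x x' y y'
    using assms that by (auto simp: op_adjoint_def)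
  then show ?thesis
    unfolding op_scale_def op_adjoint_def
    by (auto simp: cinner_scaleR_left cinner_scaleR_right)
qed

section \<open>The linear substitution\<close>

lemma nn_integral_lborel_translate:
  fixes f :: "'a::euclidean_space \<Rightarrow> ennreal"
  assumes [measurable]: "f \<in> borel_measurable borel"
  shows "(\<integral>\<^sup>+ y. f (y + c) \<partial>lborel) = (\<integral>\<^sup>+ y. f y \<partial>lborel)"
proof -
  have "(\<integral>\<^sup>+ y. f y \<partial>lborel) = (\<integral>\<^sup>+ y. f y \<partial>distr lborel borel ((+) c))"
    by (simp only: lborel_distr_plus)
  also have "\<dots> = (\<integral>\<^sup>+ y. f (c + y) \<partial>lborel)"
    by (rule nn_integral_distr) auto
  finally show ?thesis by (simp add: add.commute)
qed

lemma nn_integral_lborel_reflect: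
  fixes f :: "'a::euclidean_space \<Rightarrow> ennreal"
  assumes [measurable]: "f \<in> borel_measurable borel"
  shows "(\<integral>\<^sup>+ y. f (c - y) \<partial>lborel) = (\<integral>\<^sup>+ y. f y \<partial>lborel)"
proof -
  have "(\<integral>\<^sup>+ y. f y \<partial>lborel) = (\<integral>\<^sup>+ y. f y \<partial>distr lborel borel (\<lambda>y. c + (- 1) *\<^sub>R y))"
    using lborel_affine[of "- 1" c] by (simp add: density_1)
  also have "\<dots> = (\<integral>\<^sup>+ y. f (c + (- 1) *\<^sub>R y) \<partial>lborel)"
    by (rule nn_integral_distr) auto
  finally show ?thesis by simp
qed

text \<open>
  The argument for the uniqueness of Haar measure. For nonnegative \<open>f\<close> and \<open>g\<close>, the invariance under
  translations and reflections and the interchange of integrals give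
  \<open>(\<integral> f \<circ> \<tau>) (\<integral> g) = (\<integral> f) (\<integral> g \<circ> \<tau>)\<close>. As \<open>\<tau>\<close> is an involution, there is an integrable positive \<open>g\<close> with
  \<open>g \<circ> \<tau> = g\<close>, and its integral can be cancelled.
\<close>

lemma linear_involution_preserves_lborel:
  fixes \<tau> :: "real ^ 'n::finite \<Rightarrow> real ^ 'n"
  assumes lin: "linear \<tau>" and inv: "\<And>a. \<tau> (\<tau> a) = a"
  shows "distr lborel borel \<tau> = lborel"
proof (rule measure_eqI)
  have [measurable]: "\<tau> \<in> borel_measurable borel"
    using lin by (intro borel_measurable_continuous_onI linear_continuous_on) (simp add: linear_conv_bounded_linear)
  fix A assume "A \<in> sets (distr lborel borel \<tau>)"
  then have [measurable]: "A \<in> sets borel" by simp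
  define f where "f = (indicator A :: real ^ 'n \<Rightarrow> ennreal)"
  define g where "g = (\<lambda>x :: real ^ 'n. ennreal (exp (- (norm x)\<^sup>2 - (norm (\<tau> x))\<^sup>2)))"
  have [measurable]: "f \<in> borel_measurable borel" "g \<in> borel_measurable borel"
    unfolding f_def g_def by measurable
  have g_inv: "g (\<tau> x) = g x" for x
    by (simp add: g_def inv)
  have sub: "\<tau> (x + (- \<tau> y)) = \<tau> x - y" for x y
    using linear_diff[OF lin, of x "\<tau> y"] by (simp add: inv)
  let ?I = "\<lambda>h :: real ^ 'n \<Rightarrow> ennreal. \<integral>\<^sup>+ x. h x \<partial>lborel"
  have "?I (\<lambda>x. f (\<tau> x)) * ?I g = (\<integral>\<^sup>+ x. \<integral>\<^sup>+ y. f (\<tau> x) * g y \<partial>lborel \<partial>lborel)"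
    by (simp add: nn_integral_cmult nn_integral_multc)
  also have "\<dots> = (\<integral>\<^sup>+ x. \<integral>\<^sup>+ y. f (\<tau> x) * g (y + \<tau> x) \<partial>lborel \<partial>lborel)"
    by (simp add: nn_integral_cmult nn_integral_lborel_translate)
  also have "\<dots> = (\<integral>\<^sup>+ y. \<integral>\<^sup>+ x. f (\<tau> x) * g (y + \<tau> x) \<partial>lborel \<partial>lborel)"
    by (rule lborel_pair.Fubini') measurable
  also have "\<dots> = (\<integral>\<^sup>+ y. \<integral>\<^sup>+ x. f (\<tau> x - y) * g (\<tau> x) \<partial>lborel \<partial>lborel)"
  proof (rule nn_integral_cong)
    fix y
    \<comment> \<open>Translation by \<open>- \<tau> y\<close> becomes translation by \<open>- y\<close> after \<open>\<tau>\<close>.\<close>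
    have "(\<integral>\<^sup>+ x. f (\<tau> (x + (- \<tau> y))) * g (y + \<tau> (x + (- \<tau> y))) \<partial>lborel) = (\<integral>\<^sup>+ x. f (\<tau> x) * g (y + \<tau> x) \<partial>lborel)"
      by (rule nn_integral_lborel_translate) measurable
    then show "(\<integral>\<^sup>+ x. f (\<tau> x) * g (y + \<tau> x) \<partial>lborel) = (\<integral>\<^sup>+ x. f (\<tau> x - y) * g (\<tau> x) \<partial>lborel)"
      unfolding sub by simp
  qed
  also have "\<dots> = (\<integral>\<^sup>+ x. \<integral>\<^sup>+ y. f (\<tau> x - y) * g (\<tau> x) \<partial>lborel \<partial>lborel)"
    by (rule lborel_pair.Fubini') measurable
  also have "\<dots> = ?I f * ?I g"
    by (simp add: nn_integral_cmult nn_integral_multc nn_integral_lborel_reflect g_inv)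
  finally have eq: "?I (\<lambda>x. f (\<tau> x)) * ?I g = ?I f * ?I g" .
  have "?I g \<noteq> 0"
  proof
    assume "?I g = 0"
    then have "AE x in (lborel :: (real ^ 'n) measure). g x = 0"
      by (simp add: nn_integral_0_iff_AE)
    then have "AE x in (lborel :: (real ^ 'n) measure). False"
      by (simp add: g_def)
    then show False
      by (simp add: ae_filter_eq_bot_iff)
  qed
  moreover have "?I g < \<infinity>"
  proof -
    have "integrable lborel (\<lambda>x :: real ^ 'n. (cmod (complex_of_real (exp (- (1 / 2) * (norm x)\<^sup>2))))\<^sup>2)"
      using square_integrable_exp_norm[of "1/2", where 'n = 'n] by (simp add: square_integrable_def)
    moreover have "(cmod (complex_of_real (exp (- (1 / 2) * (norm x)\<^sup>2))))\<^sup>2 = exp (- (norm x)\<^sup>2)" for x :: "real ^ 'n"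
      by (simp add: exp_double[symmetric])
    ultimately have "?I (\<lambda>x. ennreal (exp (- (norm x)\<^sup>2))) < \<infinity>"
      by (simp add: integrable_iff_bounded)
    moreover have "?I g \<le> ?I (\<lambda>x. ennreal (exp (- (norm x)\<^sup>2)))"
      unfolding g_def by (intro nn_integral_mono ennreal_leI) simp
    ultimately show ?thesis by simp
  qed
  ultimately have "?I (\<lambda>x. f (\<tau> x)) = ?I f"
    using eq by (auto simp: ennreal_mult_cancel_left mult.commute[of _ "?I g"])
  moreover have "emeasure (distr lborel borel \<tau>) A = ?I (\<lambda>x. f (\<tau> x))"
    unfolding f_def by (subst nn_integral_distr[symmetric, of \<tau> lborel borel]) auto
  ultimately show "emeasure (distr lborel borel \<tau>) A = emeasure lborel A"
    by (simp add: f_def)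
qed simp

lemma real_pos_part: "real_of_int (pos_part x) = max (real_of_int x) 0"
  by (simp add: pos_part_def)

text \<open>
  In the form on the right the second summand is cancelled by the contribution of the substituted
  variable \<open>a\<^sub>k\<close> in \<open>exch_row_K_subst\<close>.
\<close>

lemma pos_part_mutation:
  "(\<bar>x\<bar> * y + x * \<bar>y\<bar>) div 2 = pos_part x * y + x * pos_part (- y)"
  by (cases "x \<ge> 0"; cases "y \<ge> 0") (auto simp: pos_part_def max_def abs_if)

lemma exch_diag_zero:
  assumes "D_seed \<Gamma>"
  shows "exch \<Gamma> $ k $ k = 0"
proof -
  have "real_of_int (exch \<Gamma> $ k $ k) * inverse (real (skew \<Gamma> $ k)) = 0"
    using assms unfolding D_seed_def by (metis mult_minus_left equal_neg_zero)
  moreover have "skew \<Gamma> $ k > 0"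
    using assms unfolding D_seed_def by blast
  ultimately show ?thesis by simp
qed

lemma linear_K_subst: "linear (K_subst k \<Gamma>)"
  by (rule linearI) (auto simp: K_subst_def vec_eq_iff algebra_simps sum.distrib sum_distrib_left)

lemma K_subst_involution:
  assumes "D_seed \<Gamma>"
  shows "K_subst k \<Gamma> (K_subst k \<Gamma> a) = a"
proof -
  have 0: "pos_part (- exch \<Gamma> $ k $ k) = 0"
    using exch_diag_zero[OF assms, of k] by (simp add: pos_part_def)
  have "of_int (pos_part (- exch \<Gamma> $ k $ j)) * K_subst k \<Gamma> a $ j = of_int (pos_part (- exch \<Gamma> $ k $ j)) * a $ j" for j
    using 0 by (cases "j = k") (auto simp: K_subst_def)
  then have "(\<Sum>j\<in>UNIV. of_int (pos_part (- exch \<Gamma> $ k $ j)) * K_subst k \<Gamma> a $ j)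
    = (\<Sum>j\<in>UNIV. of_int (pos_part (- exch \<Gamma> $ k $ j)) * a $ j)"
    by (intro sum.cong) auto
  then show ?thesis
    unfolding K_subst_def[of k \<Gamma> "K_subst k \<Gamma> a"] vec_eq_iff by (simp add: K_subst_def)
qed

lemma K_fun_eq: "K_fun k \<Gamma> f = (\<lambda>a. f (K_subst k \<Gamma> a))"
  by (rule ext) (rule K_fun_def)

lemma inv_K_fun:
  assumes "D_seed \<Gamma>"
  shows "inv (K_fun k \<Gamma>) = K_fun k \<Gamma>"
  by (rule inv_equality) (simp_all add: K_fun_eq K_subst_involution[OF assms])

lemma weighted_composition_K:
  assumes "D_seed \<Gamma>"
  shows "weighted_composition (\<lambda>_. 1) (K_subst k \<Gamma>)"
proof
  show "K_subst k \<Gamma> \<in> borel_measurable borel"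
    using linear_K_subst[of k \<Gamma>]
    by (intro borel_measurable_continuous_onI linear_continuous_on) (simp add: linear_conv_bounded_linear)
  show "distr lborel borel (K_subst k \<Gamma>) = lborel"
    by (intro linear_involution_preserves_lborel linear_K_subst K_subst_involution assms)
qed auto

lemma K_l2_eq: "K_l2 k \<Gamma> = weighted_comp (\<lambda>_. 1) (K_subst k \<Gamma>)"
  by (rule ext) (simp add: K_l2_def weighted_comp_def K_fun_eq)

lemma K_l2_abs_l2:
  assumes "D_seed \<Gamma>" "f \<in> square_integrable"
  shows "K_l2 k \<Gamma> (abs_l2 f) = abs_l2 (\<lambda>a. f (K_subst k \<Gamma> a))"
  unfolding K_l2_eq using weighted_composition.weighted_comp_abs_l2[OF weighted_composition_K[OF assms(1)] assms(2)]
  by simp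

lemma K_l2_involution:
  assumes "D_seed \<Gamma>"
  shows "K_l2 k \<Gamma> (K_l2 k \<Gamma> F) = F"
proof -
  obtain f where f: "f \<in> square_integrable" "F = abs_l2 f" by (rule abs_l2_cases)
  then show ?thesis
    using weighted_composition.square_integrable_weighted_comp[OF weighted_composition_K[OF assms] f(1)]
    by (simp add: K_l2_abs_l2 assms K_subst_involution)
qed

lemma inv_K_l2:
  assumes "D_seed \<Gamma>"
  shows "inv (K_l2 k \<Gamma>) = K_l2 k \<Gamma>"
  by (rule inv_equality) (simp_all add: K_l2_involution[OF assms])

lemma cinner_K_l2:
  assumes "D_seed \<Gamma>"
  shows "cinner (K_l2 k \<Gamma> F) (K_l2 k \<Gamma> G) = cinner F G"
  unfolding K_l2_eq by (rule weighted_composition.cinner_weighted_comp[OF weighted_composition_K[OF assms]])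

text \<open>
  On functions \<open>\<kappa> (\<kappa> a + t w) = a + t \<kappa> w\<close>, and the phases agree because \<open>l' \<bullet> w = l \<bullet> \<kappa> w\<close> as well.
\<close>

lemma K_l2_shift_op:
  assumes "D_seed \<Gamma>" and l: "\<And>a. l' \<bullet> K_subst k \<Gamma> a = l \<bullet> a"
  shows "K_l2 k \<Gamma> (shift_op w l' t (K_l2 k \<Gamma> F)) = shift_op (K_subst k \<Gamma> w) l t F"
proof -
  obtain f where f: "f \<in> square_integrable" "F = abs_l2 f" by (rule abs_l2_cases)
  let ?\<kappa> = "K_subst k \<Gamma>"
  have sq: "(\<lambda>a. f (?\<kappa> a)) \<in> square_integrable"
    using weighted_composition.square_integrable_weighted_comp[OF weighted_composition_K[OF assms(1)] f(1)]
    by simp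
  have lw: "l' \<bullet> w = l \<bullet> ?\<kappa> w"
    using l[of "?\<kappa> w"] by (simp add: K_subst_involution[OF assms(1)])
  have add: "?\<kappa> (?\<kappa> a + t *\<^sub>R w) = a + t *\<^sub>R ?\<kappa> w" for a
    by (simp add: linear_add[OF linear_K_subst] linear_scale[OF linear_K_subst] K_subst_involution[OF assms(1)])
  have "K_l2 k \<Gamma> (shift_op w l' t (K_l2 k \<Gamma> F)) = abs_l2 (\<lambda>a. shift_fun w l' t (\<lambda>a. f (?\<kappa> a)) (?\<kappa> a))"
    by (simp add: f K_l2_abs_l2 assms(1) shift_op_abs_l2 sq square_integrable_shift_fun)
  also have "(\<lambda>a. shift_fun w l' t (\<lambda>a. f (?\<kappa> a)) (?\<kappa> a)) = shift_fun (?\<kappa> w) l t f"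
    by (rule ext) (simp only: shift_fun_def add l lw)
  finally show ?thesis
    by (simp add: f shift_op_abs_l2)
qed

lemma op_conj_K_iff:
  assumes "D_seed \<Gamma>"
  shows "(f, g) \<in> op_conj (K_l2 k \<Gamma>) T \<longleftrightarrow> (K_l2 k \<Gamma> f, K_l2 k \<Gamma> g) \<in> T"
  unfolding op_conj_def inv_K_l2[OF assms] using K_l2_involution[OF assms, of k] by (auto, metis)

lemma op_conj_generator:
  assumes "D_seed \<Gamma>" "\<And>a. l' \<bullet> K_subst k \<Gamma> a = l \<bullet> a"
  shows "op_conj (K_l2 k \<Gamma>) (generator (shift_op w l')) = generator (shift_op (K_subst k \<Gamma> w) l)"
proof -
  let ?K = "K_l2 k \<Gamma>"
  have 1: "cinner (shift_op w l' t (?K g)) (?K u) = cinner (shift_op (K_subst k \<Gamma> w) l t g) u" for t g u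
    using cinner_K_l2[OF assms(1), of k "shift_op w l' t (?K g)" "?K u"]
    by (simp add: K_l2_shift_op[OF assms] K_l2_involution[OF assms(1)])
  have surj: "(\<forall>u. P u) \<longleftrightarrow> (\<forall>u. P (?K u))" for P
    by (metis K_l2_involution[OF assms(1)])
  have "(g, h) \<in> op_conj ?K (generator (shift_op w l')) \<longleftrightarrow> (g, h) \<in> generator (shift_op (K_subst k \<Gamma> w) l)" for g h
    unfolding op_conj_K_iff[OF assms(1)] generator_def mem_Collect_eq prod.case
    by (subst surj) (simp only: 1 cinner_K_l2[OF assms(1)])
  then show ?thesis by auto
qed

lemma op_conj_mono: "S \<subseteq> T \<Longrightarrow> op_conj U S \<subseteq> op_conj U T"
  by (auto simp: op_conj_def)

lemma op_conj_adjoint: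
  assumes "D_seed \<Gamma>"
  shows "op_adjoint (op_conj (K_l2 k \<Gamma>) S) \<subseteq> op_conj (K_l2 k \<Gamma>) (op_adjoint S)"
proof clarify
  let ?K = "K_l2 k \<Gamma>"
  fix g h assume gh: "(g, h) \<in> op_adjoint (op_conj ?K S)"
  have "cinner f' (?K g) = cinner f (?K h)" if "(f, f') \<in> S" for f f'
  proof -
    have "(?K f, ?K f') \<in> op_conj ?K S"
      unfolding op_conj_K_iff[OF assms] using that by (simp add: K_l2_involution[OF assms])
    from op_adjointD[OF gh this] have "cinner (?K f') g = cinner (?K f) h" .
    then show ?thesis
      using cinner_K_l2[OF assms, of k f' "?K g"] cinner_K_l2[OF assms, of k f "?K h"]
      by (simp add: K_l2_involution[OF assms])
  qed
  then show "(g, h) \<in> op_conj ?K (op_adjoint S)"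
    unfolding op_conj_K_iff[OF assms] by (auto simp: op_adjoint_def)
qed

section \<open>The operators of a seed\<close>

text \<open>
  The momentum part of an old operator is \<open>1 / 2 d\<^sub>i\<^sup>-\<^sup>1 (2 \<pi> \<i> \<hbar>) \<partial>\<^sub>i\<close>, which is \<open>\<i>\<close> times the derivative in
  this direction. The new operators use twice this direction.
\<close>

definition momentum_dir :: "real \<Rightarrow> 'n::finite seed \<Rightarrow> 'n \<Rightarrow> real ^ 'n" where
  "momentum_dir hbar \<Gamma> i = axis i (pi * hbar / real (skew \<Gamma> $ i))"

definition exch_row :: "'n::finite seed \<Rightarrow> 'n \<Rightarrow> real ^ 'n" where
  "exch_row \<Gamma> i = (\<chi> j. real_of_int (exch \<Gamma> $ i $ j))"

text \<open>
  The sign \<open>\<sigma>\<close> is \<open>1\<close> for the operators without tilde and \<open>- 1\<close> for those with tilde.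
\<close>

definition pos_row :: "int \<Rightarrow> 'n::finite seed \<Rightarrow> 'n \<Rightarrow> real ^ 'n" where
  "pos_row \<sigma> \<Gamma> i = (\<chi> j. real_of_int (pos_part (\<sigma> * exch \<Gamma> $ i $ j)))"

lemma dir_deriv_axis:
  assumes "f differentiable (at a)"
  shows "dir_deriv (axis i c) f a = of_real c * partial_deriv i f a"
proof -
  obtain F where F: "(f has_derivative F) (at a)"
    using assms unfolding differentiable_def by blast
  have "axis i c = c *\<^sub>R axis i 1"
    by (simp add: axis_def vec_eq_iff)
  then have "F (axis i c) = c *\<^sub>R F (axis i 1)"
    using linear_scale[OF has_derivative_linear[OF F]] by simp
  moreover have "partial_deriv i f a = dir_deriv (axis i 1) f a"
    by (simp add: partial_deriv_def dir_deriv_def)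
  ultimately show ?thesis
    by (simp add: dir_deriv_eq_frechet[OF F] scaleR_conv_of_real)
qed

lemma sum_q_hat: "(\<Sum>j\<in>UNIV. of_int (c j) * q_hat j f a) = of_real ((\<chi> j. real_of_int (c j)) \<bullet> a) * f a"
  by (simp add: q_hat_def inner_vec_def sum_distrib_right mult.assoc)

lemma x_old_eq_lin_op:
  assumes "f differentiable (at a)"
  shows "x_old hbar \<Gamma> i f a = lin_op (momentum_dir hbar \<Gamma> i) (- 1 *\<^sub>R exch_row \<Gamma> i) f a"
    and "xt_old hbar \<Gamma> i f a = lin_op (momentum_dir hbar \<Gamma> i) (1 *\<^sub>R exch_row \<Gamma> i) f a"
  unfolding x_old_def xt_old_def lin_op_def momentum_dir_def exch_row_def sum_q_hat dir_deriv_axis[OF assms] p_hat_def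
  by (simp_all add: field_simps)

lemma x_new_eq_lin_op:
  assumes "f differentiable (at a)"
  shows "x_new hbar \<Gamma> i f a = lin_op (2 *\<^sub>R momentum_dir hbar \<Gamma> i) (- pos_row 1 \<Gamma> i) f a"
    and "xt_new hbar \<Gamma> i f a = lin_op (2 *\<^sub>R momentum_dir hbar \<Gamma> i) (- pos_row (- 1) \<Gamma> i) f a"
proof -
  have "2 *\<^sub>R momentum_dir hbar \<Gamma> i = axis i (2 * (pi * hbar / real (skew \<Gamma> $ i)))"
    by (simp add: momentum_dir_def axis_def vec_eq_iff)
  then show "x_new hbar \<Gamma> i f a = lin_op (2 *\<^sub>R momentum_dir hbar \<Gamma> i) (- pos_row 1 \<Gamma> i) f a"
    "xt_new hbar \<Gamma> i f a = lin_op (2 *\<^sub>R momentum_dir hbar \<Gamma> i) (- pos_row (- 1) \<Gamma> i) f a"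
    unfolding x_new_def xt_new_def lin_op_def pos_row_def sum_q_hat p_hat_def
    by (simp_all add: field_simps dir_deriv_axis[OF assms])
qed

lemma skew_mutation [simp]: "skew (mutation k \<Gamma>) = skew \<Gamma>"
  by (simp add: mutation_def)

lemma exch_mutation_k [simp]:
  "exch (mutation k \<Gamma>) $ k $ j = - exch \<Gamma> $ k $ j" "exch (mutation k \<Gamma>) $ i $ k = - exch \<Gamma> $ i $ k"
  by (simp_all add: mutation_def)

lemma exch_mutation:
  assumes "i \<noteq> k" "j \<noteq> k"
  shows "exch (mutation k \<Gamma>) $ i $ j = exch \<Gamma> $ i $ j
    + (pos_part (exch \<Gamma> $ i $ k) * exch \<Gamma> $ k $ j + exch \<Gamma> $ i $ k * pos_part (- exch \<Gamma> $ k $ j))"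
  using assms by (simp add: mutation_def pos_part_mutation)

lemma K_subst_axis:
  "K_subst k \<Gamma> (axis i c) = (if i = k then - axis k c else axis i c) + axis k (of_int (pos_part (- exch \<Gamma> $ k $ i)) * c)"
proof -
  have "(\<Sum>j\<in>UNIV. of_int (pos_part (- exch \<Gamma> $ k $ j)) * axis i c $ j) = of_int (pos_part (- exch \<Gamma> $ k $ i)) * c"
    by (simp add: axis_def if_distrib[of "\<lambda>x. _ * x"] cong: if_cong)
  then show ?thesis
    by (auto simp: K_subst_def vec_eq_iff axis_def)
qed

text \<open>
  The substitution adds \<open>[- \<epsilon>\<^sub>k\<^sub>i]\<^sub>+ / d\<^sub>i\<close> to the component \<open>k\<close>, and skew-symmetrizability turns this into
  \<open>[\<epsilon>\<^sub>i\<^sub>k]\<^sub>+ / d\<^sub>k\<close>.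
\<close>

lemma K_subst_momentum_dir:
  assumes "D_seed \<Gamma>" "i \<noteq> k"
  shows "K_subst k \<Gamma> (momentum_dir hbar (mutation k \<Gamma>) i)
    = momentum_dir hbar \<Gamma> i + of_int (pos_part (exch \<Gamma> $ i $ k)) *\<^sub>R momentum_dir hbar \<Gamma> k"
proof -
  have d: "real (skew \<Gamma> $ i) > 0" "real (skew \<Gamma> $ k) > 0"
    using assms(1) by (auto simp: D_seed_def)
  have "real_of_int (exch \<Gamma> $ i $ k) * inverse (real (skew \<Gamma> $ k)) = - real_of_int (exch \<Gamma> $ k $ i) * inverse (real (skew \<Gamma> $ i))"
    using assms(1) unfolding D_seed_def by blast
  then have "max (real_of_int (exch \<Gamma> $ i $ k) * inverse (real (skew \<Gamma> $ k))) 0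
      = max (- real_of_int (exch \<Gamma> $ k $ i) * inverse (real (skew \<Gamma> $ i))) 0"
    by simp
  then have "real_of_int (pos_part (exch \<Gamma> $ i $ k)) * inverse (real (skew \<Gamma> $ k))
      = real_of_int (pos_part (- exch \<Gamma> $ k $ i)) * inverse (real (skew \<Gamma> $ i))"
    using d by (simp add: real_pos_part max_mult_distrib_right)
  then have "pi * hbar * (real_of_int (pos_part (- exch \<Gamma> $ k $ i)) * inverse (real (skew \<Gamma> $ i)))
      = pi * hbar * (real_of_int (pos_part (exch \<Gamma> $ i $ k)) * inverse (real (skew \<Gamma> $ k)))"
    by simp
  then have "axis k (real_of_int (pos_part (- exch \<Gamma> $ k $ i)) * (pi * hbar / real (skew \<Gamma> $ i)))
      = real_of_int (pos_part (exch \<Gamma> $ i $ k)) *\<^sub>R axis k (pi * hbar / real (skew \<Gamma> $ k))"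
    by (simp add: axis_def vec_eq_iff divide_inverse mult_ac)
  then show ?thesis
    using assms(2) by (simp add: momentum_dir_def K_subst_axis)
qed

lemma K_subst_momentum_dir_k:
  assumes "D_seed \<Gamma>"
  shows "K_subst k \<Gamma> (momentum_dir hbar (mutation k \<Gamma>) k) = - momentum_dir hbar \<Gamma> k"
  unfolding momentum_dir_def K_subst_axis using exch_diag_zero[OF assms, of k]
  by (simp add: pos_part_def axis_def vec_eq_iff)

text \<open>
  The substituted variable \<open>a\<^sub>k\<close> contributes \<open>- \<epsilon>\<^sub>i\<^sub>k (- a\<^sub>k + \<Sum>\<^sub>j [- \<epsilon>\<^sub>k\<^sub>j]\<^sub>+ a\<^sub>j)\<close>. The sum cancels the second
  summand of the mutation rule in \<open>exch_mutation\<close> and leaves \<open>\<epsilon>\<^sub>i\<^sub>j + [\<epsilon>\<^sub>i\<^sub>k]\<^sub>+ \<epsilon>\<^sub>k\<^sub>j\<close>.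
\<close>

lemma exch_row_K_subst:
  assumes "D_seed \<Gamma>" "i \<noteq> k"
  shows "exch_row (mutation k \<Gamma>) i \<bullet> K_subst k \<Gamma> a
    = (exch_row \<Gamma> i + of_int (pos_part (exch \<Gamma> $ i $ k)) *\<^sub>R exch_row \<Gamma> k) \<bullet> a"
proof -
  let ?e = "\<lambda>i j. real_of_int (exch \<Gamma> $ i $ j)"
  let ?b = "\<lambda>j. real_of_int (pos_part (- exch \<Gamma> $ k $ j))"
  let ?s = "real_of_int (pos_part (exch \<Gamma> $ i $ k))"
  have kk: "exch \<Gamma> $ k $ k = 0" "?b k = 0"
    using exch_diag_zero[OF assms(1), of k] by (auto simp: pos_part_def)
  \<comment> \<open>Charging the whole sum to \<open>j = k\<close> makes the identity hold term by term; at \<open>j = k\<close> the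
    remaining terms are right because \<open>\<epsilon>\<^sub>k\<^sub>k = 0\<close>.\<close>
  have "real_of_int (exch (mutation k \<Gamma>) $ i $ j) * K_subst k \<Gamma> a $ j
      = (?e i j + ?s * ?e k j) * a $ j + ?e i k * (?b j * a $ j)
        - (if j = k then ?e i k * (\<Sum>j\<in>UNIV. ?b j * a $ j) else 0)" for j
    using kk by (cases "j = k") (simp_all add: K_subst_def exch_mutation[OF assms(2)] algebra_simps)
  then have "(\<Sum>j\<in>UNIV. real_of_int (exch (mutation k \<Gamma>) $ i $ j) * K_subst k \<Gamma> a $ j)
      = (\<Sum>j\<in>UNIV. (?e i j + ?s * ?e k j) * a $ j)"
    by (simp add: sum.distrib sum_subtractf sum_distrib_left[symmetric])
  then show ?thesis
    by (simp add: exch_row_def inner_vec_def)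
qed

lemma exch_row_K_subst_k:
  assumes "D_seed \<Gamma>"
  shows "exch_row (mutation k \<Gamma>) k \<bullet> K_subst k \<Gamma> a = - exch_row \<Gamma> k \<bullet> a"
proof -
  have "real_of_int (exch \<Gamma> $ k $ j) * K_subst k \<Gamma> a $ j = real_of_int (exch \<Gamma> $ k $ j) * a $ j" for j
    using exch_diag_zero[OF assms, of k] by (cases "j = k") (auto simp: K_subst_def)
  then have "(\<Sum>j\<in>UNIV. real_of_int (exch \<Gamma> $ k $ j) * K_subst k \<Gamma> a $ j)
      = (\<Sum>j\<in>UNIV. real_of_int (exch \<Gamma> $ k $ j) * a $ j)"
    by (intro sum.cong) auto
  then show ?thesis
    by (simp add: exch_row_def inner_vec_def sum_negf)
qed

lemma lin_op_K_subst:
  assumes "D_seed \<Gamma>"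
  shows "lin_op w l (\<lambda>a. f (K_subst k \<Gamma> a)) (K_subst k \<Gamma> a)
    = \<i> * dir_deriv (K_subst k \<Gamma> w) f a + of_real (l \<bullet> K_subst k \<Gamma> a) * f a"
  unfolding lin_op_def dir_deriv_def
  by (simp add: linear_add[OF linear_K_subst] linear_scale[OF linear_K_subst] K_subst_involution[OF assms])

lemma differentiable_K_subst:
  assumes "f \<in> D_dom"
  shows "(\<lambda>a. f (K_subst k \<Gamma> a)) differentiable (at a)"
proof -
  have "K_subst k \<Gamma> differentiable (at a)"
    by (intro bounded_linear_imp_differentiable) (simp add: linear_conv_bounded_linear[symmetric] linear_K_subst)
  from differentiable_chain_at[OF this D_dom_differentiable[OF assms]] show ?thesis
    by (simp add: o_def)
qed

lemma lin_op_combination: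
  assumes "f \<in> D_dom"
  shows "lin_op (v + s *\<^sub>R w) (l + s *\<^sub>R m) f a = lin_op v l f a + of_real s * lin_op w m f a"
  using D_dom_dir_deriv_linear[OF assms, of 1 v s w a]
  by (simp add: lin_op_def inner_add_left algebra_simps)

lemma lin_op_uminus:
  assumes "f \<in> D_dom"
  shows "lin_op (- w) (- l) f a = - lin_op w l f a"
  using D_dom_dir_deriv_linear[OF assms, of "-1" w 0 0 a]
  by (simp add: lin_op_def)

lemma op_on_D_cong:
  assumes "\<And>f a. f \<in> D_dom \<Longrightarrow> F f a = G f a"
  shows "op_on_D F = op_on_D G"
proof -
  have "F f = G f" if "f \<in> D_dom" for f
    using assms[OF that] by (rule ext)
  then show ?thesis
    by (auto simp: op_on_D_def)
qed

lemma same_sa_extensionI: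
  assumes "unique_sa_extension S \<and> sa_extension S = A" "unique_sa_extension T \<and> sa_extension T = A"
  shows "same_sa_extension S T"
  using assms by (simp add: same_sa_extension_def)

text \<open>
  The domain \<open>K D\<close> of the first operator differs from \<open>D\<close> in general, as the substitution creates mixed terms in the
  exponents. Only the generators are compared, and conjugation by \<open>K\<close> matches them exactly.
\<close>

lemma op_conj_sa_extension:
  assumes "D_seed \<Gamma>" "\<And>a. l' \<bullet> K_subst k \<Gamma> a = l \<bullet> a" "K_subst k \<Gamma> w = v"
  shows "unique_sa_extension (op_conj (K_l2 k \<Gamma>) (op_on_D (lin_op w l')))
      \<and> sa_extension (op_conj (K_l2 k \<Gamma>) (op_on_D (lin_op w l'))) = generator (shift_op v l)"
    and "unique_sa_extension (op_conj (K_l2 k \<Gamma>) (generator (shift_op w l')))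
      \<and> sa_extension (op_conj (K_l2 k \<Gamma>) (generator (shift_op w l'))) = generator (shift_op v l)"
proof -
  note gen = op_conj_generator[OF assms(1,2), of w, unfolded assms(3)]
  note sa = generator_self_adjoint[of v l]
  have 1: "op_conj (K_l2 k \<Gamma>) (op_on_D (lin_op w l')) \<subseteq> generator (shift_op v l)"
    unfolding gen[symmetric] by (intro op_conj_mono op_on_D_subset_generator)
  have 2: "op_adjoint (op_conj (K_l2 k \<Gamma>) (op_on_D (lin_op w l'))) \<subseteq> generator (shift_op v l)"
    unfolding gen[symmetric]
    by (rule order_trans[OF op_conj_adjoint[OF assms(1)] op_conj_mono[OF adjoint_subset_generator]])
  show "unique_sa_extension (op_conj (K_l2 k \<Gamma>) (op_on_D (lin_op w l')))
      \<and> sa_extension (op_conj (K_l2 k \<Gamma>) (op_on_D (lin_op w l'))) = generator (shift_op v l)"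
    using essentially_self_adjointI[OF sa 1 2] by blast
  have 3: "op_adjoint (generator (shift_op v l)) \<subseteq> generator (shift_op v l)"
    using sa by (simp add: self_adjoint_def)
  show "unique_sa_extension (op_conj (K_l2 k \<Gamma>) (generator (shift_op w l')))
      \<and> sa_extension (op_conj (K_l2 k \<Gamma>) (generator (shift_op w l'))) = generator (shift_op v l)"
    unfolding gen using essentially_self_adjointI[OF sa order_refl 3] by blast
qed

lemma op_on_D_combination_subset:
  "op_on_D (lin_op (v + s *\<^sub>R w) (l + s *\<^sub>R m))
    \<subseteq> op_add (op_on_D (lin_op v l)) (op_scale s (op_on_D (lin_op w m)))"
proof
  fix p assume "p \<in> op_on_D (lin_op (v + s *\<^sub>R w) (l + s *\<^sub>R m))"
  then obtain f where f: "f \<in> D_dom" and p: "p = (abs_l2 f, abs_l2 (lin_op (v + s *\<^sub>R w) (l + s *\<^sub>R m) f))"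
    by (auto simp: op_on_D_def)
  have sq: "lin_op v l f \<in> square_integrable" "lin_op w m f \<in> square_integrable"
    by (intro D_dom_square_integrable D_dom_lin_op f)+
  have "lin_op (v + s *\<^sub>R w) (l + s *\<^sub>R m) f = (\<lambda>a. lin_op v l f a + of_real s * lin_op w m f a)"
    by (rule ext) (rule lin_op_combination[OF f])
  then have "abs_l2 (lin_op (v + s *\<^sub>R w) (l + s *\<^sub>R m) f) = abs_l2 (lin_op v l f) + s *\<^sub>R abs_l2 (lin_op w m f)"
    using sq by (simp add: scaleR_abs_l2 add_abs_l2 square_integrable_cmult)
  then show "p \<in> op_add (op_on_D (lin_op v l)) (op_scale s (op_on_D (lin_op w m)))"
    unfolding p op_add_def op_scale_def op_on_D_def using f by blast
qed

lemma op_add_mono: "S \<subseteq> S' \<Longrightarrow> T \<subseteq> T' \<Longrightarrow> op_add S T \<subseteq> op_add S' T'"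
  unfolding op_add_def by blast

lemma op_scale_mono: "T \<subseteq> T' \<Longrightarrow> op_scale r T \<subseteq> op_scale r T'"
  unfolding op_scale_def by blast

text \<open>
  Both sums are symmetric and extend the combined first-order expression on \<open>D\<close>, the second one because
  each self-adjoint operator extends its restriction to \<open>D\<close>.
\<close>

lemma combination_sa_extension:
  fixes v w l m s
  defines "G \<equiv> generator (shift_op (v + s *\<^sub>R w) (l + s *\<^sub>R m))"
  defines "S \<equiv> op_add (op_on_D (lin_op v l)) (op_scale s (op_on_D (lin_op w m)))"
  defines "T \<equiv> op_add (generator (shift_op v l)) (op_scale s (generator (shift_op w m)))"
  shows "unique_sa_extension S \<and> sa_extension S = G" "unique_sa_extension T \<and> sa_extension T = G"
proof -
  have S: "op_on_D (lin_op (v + s *\<^sub>R w) (l + s *\<^sub>R m)) \<subseteq> S"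
    unfolding S_def by (rule op_on_D_combination_subset)
  have ST: "S \<subseteq> T"
    unfolding S_def T_def by (intro op_add_mono op_scale_mono op_on_D_subset_generator)
  have "S \<subseteq> op_adjoint S" "T \<subseteq> op_adjoint T"
    unfolding S_def T_def by (intro symmetric_op_add symmetric_op_scale op_on_D_symmetric generator_symmetric)+
  then show "unique_sa_extension S \<and> sa_extension S = G" "unique_sa_extension T \<and> sa_extension T = G"
    unfolding G_def using symmetric_extension_unique_sa[OF S] symmetric_extension_unique_sa[OF order_trans[OF S ST]] by blast+
qed

lemma op_on_D_uminus_subset:
  "op_on_D (lin_op (- w) (- l)) \<subseteq> op_scale (- 1) (op_on_D (lin_op w l))"
proof
  fix p assume "p \<in> op_on_D (lin_op (- w) (- l))"
  then obtain f where f: "f \<in> D_dom" and p: "p = (abs_l2 f, abs_l2 (lin_op (- w) (- l) f))"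
    by (auto simp: op_on_D_def)
  have sq: "lin_op w l f \<in> square_integrable"
    by (intro D_dom_square_integrable D_dom_lin_op f)
  have "lin_op (- w) (- l) f = (\<lambda>a. of_real (- 1) * lin_op w l f a)"
    by (rule ext) (simp add: lin_op_uminus[OF f])
  then have "abs_l2 (lin_op (- w) (- l) f) = (- 1) *\<^sub>R abs_l2 (lin_op w l f)"
    using scaleR_abs_l2[OF sq, of "- 1"] by simp
  then show "p \<in> op_scale (- 1) (op_on_D (lin_op w l))"
    unfolding p op_scale_def op_on_D_def using f by blast
qed

lemma uminus_sa_extension:
  fixes w l
  defines "G \<equiv> generator (shift_op (- w) (- l))"
  defines "S \<equiv> op_scale (- 1) (op_on_D (lin_op w l))"
  defines "T \<equiv> op_scale (- 1) (generator (shift_op w l))"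
  shows "unique_sa_extension S \<and> sa_extension S = G" "unique_sa_extension T \<and> sa_extension T = G"
proof -
  have S: "op_on_D (lin_op (- w) (- l)) \<subseteq> S"
    unfolding S_def by (rule op_on_D_uminus_subset)
  have ST: "S \<subseteq> T"
    unfolding S_def T_def by (intro op_scale_mono op_on_D_subset_generator)
  have "S \<subseteq> op_adjoint S" "T \<subseteq> op_adjoint T"
    unfolding S_def T_def by (intro symmetric_op_scale op_on_D_symmetric generator_symmetric)+
  then show "unique_sa_extension S \<and> sa_extension S = G" "unique_sa_extension T \<and> sa_extension T = G"
    unfolding G_def using symmetric_extension_unique_sa[OF S] symmetric_extension_unique_sa[OF order_trans[OF S ST]] by blast+
qed

text \<open>
  The sign \<open>\<sigma>\<close> covers both old operators, since the covector enters linearly.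
\<close>

lemma old_operators_mutate:
  assumes "D_seed \<Gamma>" and \<Gamma>': "\<Gamma>' = mutation k \<Gamma>"
    and X: "\<forall>\<Gamma> i f a. f differentiable (at a) \<longrightarrow>
      X \<Gamma> i f a = lin_op (momentum_dir hbar \<Gamma> i) (\<sigma> *\<^sub>R exch_row \<Gamma> i) f a"
  shows "i \<noteq> k \<Longrightarrow> f \<in> D_dom \<Longrightarrow> K_fun k \<Gamma> (X \<Gamma>' i (inv (K_fun k \<Gamma>) f)) =
            (\<lambda>a. X \<Gamma> i f a + of_int (pos_part (exch \<Gamma> $ i $ k)) * X \<Gamma> k f a)"
    and "f \<in> D_dom \<Longrightarrow> K_fun k \<Gamma> (X \<Gamma>' k (inv (K_fun k \<Gamma>) f)) = (\<lambda>a. - X \<Gamma> k f a)"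
    and "unique_sa_extension (op_on_D (X \<Gamma> i))" "unique_sa_extension (op_on_D (X \<Gamma>' i))"
    and "i \<noteq> k \<Longrightarrow> same_sa_extension
            (op_conj (K_l2 k \<Gamma>) (op_on_D (X \<Gamma>' i)))
            (op_add (op_on_D (X \<Gamma> i))
              (op_scale (of_int (pos_part (exch \<Gamma> $ i $ k))) (op_on_D (X \<Gamma> k))))"
    and "i \<noteq> k \<Longrightarrow> same_sa_extension
            (op_conj (K_l2 k \<Gamma>) (sa_extension (op_on_D (X \<Gamma>' i))))
            (op_add (sa_extension (op_on_D (X \<Gamma> i)))
              (op_scale (of_int (pos_part (exch \<Gamma> $ i $ k))) (sa_extension (op_on_D (X \<Gamma> k)))))"
    and "same_sa_extension
          (op_conj (K_l2 k \<Gamma>) (op_on_D (X \<Gamma>' k)))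
          (op_scale (- 1) (op_on_D (X \<Gamma> k)))"
    and "same_sa_extension
          (op_conj (K_l2 k \<Gamma>) (sa_extension (op_on_D (X \<Gamma>' k))))
          (op_scale (- 1) (sa_extension (op_on_D (X \<Gamma> k))))"
proof -
  note X = X[rule_format]
  let ?w = "momentum_dir hbar" and ?l = "\<lambda>\<Gamma> i. \<sigma> *\<^sub>R exch_row \<Gamma> i"
  let ?s = "real_of_int (pos_part (exch \<Gamma> $ i $ k))"
  have l: "?l \<Gamma>' i \<bullet> K_subst k \<Gamma> a = (?l \<Gamma> i + ?s *\<^sub>R ?l \<Gamma> k) \<bullet> a" if "i \<noteq> k" for a
    using exch_row_K_subst[OF assms(1) that, of a] by (simp add: \<Gamma>' inner_add_left algebra_simps)
  have lk: "?l \<Gamma>' k \<bullet> K_subst k \<Gamma> a = - ?l \<Gamma> k \<bullet> a" for a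
    using exch_row_K_subst_k[OF assms(1), of k a] by (simp add: \<Gamma>')
  have w: "K_subst k \<Gamma> (?w \<Gamma>' i) = ?w \<Gamma> i + ?s *\<^sub>R ?w \<Gamma> k" if "i \<noteq> k"
    unfolding \<Gamma>' by (rule K_subst_momentum_dir[OF assms(1) that])
  have wk: "K_subst k \<Gamma> (?w \<Gamma>' k) = - ?w \<Gamma> k"
    unfolding \<Gamma>' by (rule K_subst_momentum_dir_k[OF assms(1)])
  have op: "op_on_D (X \<Delta> j) = op_on_D (lin_op (?w \<Delta> j) (?l \<Delta> j))" for \<Delta> j
    by (intro op_on_D_cong X D_dom_differentiable)
  have K: "K_fun k \<Gamma> (X \<Gamma>' j (inv (K_fun k \<Gamma>) f)) a
      = \<i> * dir_deriv (K_subst k \<Gamma> (?w \<Gamma>' j)) f a + of_real (?l \<Gamma>' j \<bullet> K_subst k \<Gamma> a) * f a"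
    if "f \<in> D_dom" for j f a
    unfolding inv_K_fun[OF assms(1)] K_fun_eq X[OF differentiable_K_subst[OF that]] by (rule lin_op_K_subst[OF assms(1)])
  show "K_fun k \<Gamma> (X \<Gamma>' i (inv (K_fun k \<Gamma>) f)) =
      (\<lambda>a. X \<Gamma> i f a + of_int (pos_part (exch \<Gamma> $ i $ k)) * X \<Gamma> k f a)" if "i \<noteq> k" "f \<in> D_dom"
    unfolding fun_eq_iff K[OF that(2)] w[OF that(1)] l[OF that(1)] X[OF D_dom_differentiable[OF that(2)]]
    using lin_op_combination[OF that(2), of "?w \<Gamma> i" ?s "?w \<Gamma> k" "?l \<Gamma> i" "?l \<Gamma> k"]
    by (simp add: lin_op_def[of "_ + _"])
  show "K_fun k \<Gamma> (X \<Gamma>' k (inv (K_fun k \<Gamma>) f)) = (\<lambda>a. - X \<Gamma> k f a)" if "f \<in> D_dom"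
    unfolding fun_eq_iff K[OF that] wk lk X[OF D_dom_differentiable[OF that]]
    using lin_op_uminus[OF that, of "?w \<Gamma> k" "?l \<Gamma> k"]
    by (simp add: lin_op_def[of "- _"])
  have ess: "unique_sa_extension (op_on_D (X \<Delta> j))"
    "sa_extension (op_on_D (X \<Delta> j)) = generator (shift_op (?w \<Delta> j) (?l \<Delta> j))" for \<Delta> j
    unfolding op using symmetric_extension_unique_sa[OF order_refl op_on_D_symmetric] by blast+
  show "unique_sa_extension (op_on_D (X \<Gamma> i))" "unique_sa_extension (op_on_D (X \<Gamma>' i))"
    by (rule ess)+
  show "same_sa_extension (op_conj (K_l2 k \<Gamma>) (op_on_D (X \<Gamma>' i)))
      (op_add (op_on_D (X \<Gamma> i)) (op_scale ?s (op_on_D (X \<Gamma> k))))" if "i \<noteq> k"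
    unfolding op by (rule same_sa_extensionI[OF op_conj_sa_extension(1)[OF assms(1) l[OF that] w[OF that]] combination_sa_extension(1)])
  show "same_sa_extension (op_conj (K_l2 k \<Gamma>) (sa_extension (op_on_D (X \<Gamma>' i))))
      (op_add (sa_extension (op_on_D (X \<Gamma> i))) (op_scale ?s (sa_extension (op_on_D (X \<Gamma> k)))))" if "i \<noteq> k"
    unfolding ess(2) by (rule same_sa_extensionI[OF op_conj_sa_extension(2)[OF assms(1) l[OF that] w[OF that]] combination_sa_extension(2)])
  show "same_sa_extension (op_conj (K_l2 k \<Gamma>) (op_on_D (X \<Gamma>' k))) (op_scale (- 1) (op_on_D (X \<Gamma> k)))"
    unfolding op by (rule same_sa_extensionI[OF op_conj_sa_extension(1)[OF assms(1) lk wk] uminus_sa_extension(1)])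
  show "same_sa_extension (op_conj (K_l2 k \<Gamma>) (sa_extension (op_on_D (X \<Gamma>' k))))
      (op_scale (- 1) (sa_extension (op_on_D (X \<Gamma> k))))"
    unfolding ess(2) by (rule same_sa_extensionI[OF op_conj_sa_extension(2)[OF assms(1) lk wk] uminus_sa_extension(2)])
qed

text \<open>
  The directions transform as for the old operators, so an equality would force the two covectors to
  agree wherever a test function does not vanish. At the coordinate vector of \<open>k\<close> the covectors on the
  two sides of the first equality have the values \<open>[- \<sigma> \<epsilon>\<^sub>i\<^sub>k]\<^sub>+\<close> and \<open>- [\<sigma> \<epsilon>\<^sub>i\<^sub>k]\<^sub>+\<close>; at the coordinate vector of \<open>j\<close> those of the second
  are \<open>- [- \<sigma> \<epsilon>\<^sub>k\<^sub>j]\<^sub>+\<close> and \<open>[\<sigma> \<epsilon>\<^sub>k\<^sub>j]\<^sub>+\<close>.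
\<close>

lemma new_operators_do_not_mutate:
  assumes "D_seed \<Gamma>" and \<Gamma>': "\<Gamma>' = mutation k \<Gamma>" and \<sigma>: "\<sigma> = 1 \<or> \<sigma> = - 1"
    and X: "\<forall>\<Gamma> i f a. f differentiable (at a) \<longrightarrow>
      X \<Gamma> i f a = lin_op (2 *\<^sub>R momentum_dir hbar \<Gamma> i) (- pos_row \<sigma> \<Gamma> i) f a"
  shows "i \<noteq> k \<Longrightarrow> exch \<Gamma> $ i $ k \<noteq> 0 \<Longrightarrow> \<exists>f\<in>D_dom. K_fun k \<Gamma> (X \<Gamma>' i (inv (K_fun k \<Gamma>) f)) \<noteq>
            (\<lambda>a. X \<Gamma> i f a + of_int (pos_part (exch \<Gamma> $ i $ k)) * X \<Gamma> k f a)"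
    and "exch \<Gamma> $ k $ j \<noteq> 0 \<Longrightarrow> \<exists>f\<in>D_dom.
          K_fun k \<Gamma> (X \<Gamma>' k (inv (K_fun k \<Gamma>) f)) \<noteq> (\<lambda>a. - X \<Gamma> k f a)"
proof -
  note X = X[rule_format]
  let ?w = "\<lambda>\<Gamma> i. 2 *\<^sub>R momentum_dir hbar \<Gamma> i" and ?l = "\<lambda>\<Gamma> i. - pos_row \<sigma> \<Gamma> i"
  let ?s = "real_of_int (pos_part (exch \<Gamma> $ i $ k))"
  define \<phi> where "\<phi> = (std_gaussian :: real ^ 'a \<Rightarrow> complex)"
  have D: "\<phi> \<in> D_dom"
    unfolding \<phi>_def by (rule std_gaussian_D_dom)
  have nz: "\<phi> a \<noteq> 0" for a
    by (simp add: \<phi>_def)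
  have K: "K_fun k \<Gamma> (X \<Gamma>' j (inv (K_fun k \<Gamma>) \<phi>)) a
      = \<i> * dir_deriv (K_subst k \<Gamma> (?w \<Gamma>' j)) \<phi> a + of_real (?l \<Gamma>' j \<bullet> K_subst k \<Gamma> a) * \<phi> a" for j a
    unfolding inv_K_fun[OF assms(1)] K_fun_eq X[OF differentiable_K_subst[OF D]] by (rule lin_op_K_subst[OF assms(1)])
  have kk: "exch \<Gamma> $ k $ k = 0"
    by (rule exch_diag_zero[OF assms(1)])
  have \<kappa>k: "K_subst k \<Gamma> (axis k 1) = - axis k 1"
    unfolding K_subst_axis using kk by (simp add: pos_part_def axis_def vec_eq_iff)
  show "\<exists>f\<in>D_dom. K_fun k \<Gamma> (X \<Gamma>' i (inv (K_fun k \<Gamma>) f)) \<noteq>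
      (\<lambda>a. X \<Gamma> i f a + of_int (pos_part (exch \<Gamma> $ i $ k)) * X \<Gamma> k f a)" if ik: "i \<noteq> k" and ne: "exch \<Gamma> $ i $ k \<noteq> 0"
  proof (rule bexI[OF _ D], rule notI)
    let ?a = "axis k 1 :: real ^ 'a"
    assume "K_fun k \<Gamma> (X \<Gamma>' i (inv (K_fun k \<Gamma>) \<phi>)) =
      (\<lambda>a. X \<Gamma> i \<phi> a + of_int (pos_part (exch \<Gamma> $ i $ k)) * X \<Gamma> k \<phi> a)"
    from fun_cong[OF this, of ?a]
    have "\<i> * dir_deriv (K_subst k \<Gamma> (?w \<Gamma>' i)) \<phi> ?a + of_real (?l \<Gamma>' i \<bullet> K_subst k \<Gamma> ?a) * \<phi> ?a
      = lin_op (?w \<Gamma> i + ?s *\<^sub>R ?w \<Gamma> k) (?l \<Gamma> i + ?s *\<^sub>R ?l \<Gamma> k) \<phi> ?a"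
      unfolding K X[OF D_dom_differentiable[OF D]] lin_op_combination[OF D] by simp
    moreover have "K_subst k \<Gamma> (?w \<Gamma>' i) = ?w \<Gamma> i + ?s *\<^sub>R ?w \<Gamma> k"
      unfolding \<Gamma>' linear_scale[OF linear_K_subst] K_subst_momentum_dir[OF assms(1) ik]
      by (simp add: scaleR_add_right)
    ultimately have "complex_of_real (?l \<Gamma>' i \<bullet> K_subst k \<Gamma> ?a) = of_real ((?l \<Gamma> i + ?s *\<^sub>R ?l \<Gamma> k) \<bullet> ?a)"
      unfolding lin_op_def using nz[of ?a] by (metis add_left_cancel mult_right_cancel)
    then have "?l \<Gamma>' i \<bullet> K_subst k \<Gamma> ?a = (?l \<Gamma> i + ?s *\<^sub>R ?l \<Gamma> k) \<bullet> ?a"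
      by (simp only: of_real_eq_iff)
    then have "pos_row \<sigma> \<Gamma>' i $ k = - pos_row \<sigma> \<Gamma> i $ k - ?s * pos_row \<sigma> \<Gamma> k $ k"
      unfolding \<kappa>k by (simp add: inner_axis inner_add_left)
    then show False
      using ne kk \<sigma> by (auto simp: pos_row_def \<Gamma>' pos_part_def max_def split: if_splits)
  qed
  show "\<exists>f\<in>D_dom. K_fun k \<Gamma> (X \<Gamma>' k (inv (K_fun k \<Gamma>) f)) \<noteq> (\<lambda>a. - X \<Gamma> k f a)" if ne: "exch \<Gamma> $ k $ j \<noteq> 0"
  proof (rule bexI[OF _ D], rule notI)
    let ?a = "axis j 1 :: real ^ 'a"
    assume "K_fun k \<Gamma> (X \<Gamma>' k (inv (K_fun k \<Gamma>) \<phi>)) = (\<lambda>a. - X \<Gamma> k \<phi> a)"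
    from fun_cong[OF this, of ?a]
    have "\<i> * dir_deriv (K_subst k \<Gamma> (?w \<Gamma>' k)) \<phi> ?a + of_real (?l \<Gamma>' k \<bullet> K_subst k \<Gamma> ?a) * \<phi> ?a
      = lin_op (- ?w \<Gamma> k) (- ?l \<Gamma> k) \<phi> ?a"
      unfolding K X[OF D_dom_differentiable[OF D]] lin_op_uminus[OF D] .
    moreover have "K_subst k \<Gamma> (?w \<Gamma>' k) = - ?w \<Gamma> k"
      unfolding \<Gamma>' linear_scale[OF linear_K_subst] K_subst_momentum_dir_k[OF assms(1)] by simp
    ultimately have "complex_of_real (?l \<Gamma>' k \<bullet> K_subst k \<Gamma> ?a) = of_real (- ?l \<Gamma> k \<bullet> ?a)"
      unfolding lin_op_def using nz[of ?a] by (metis add_left_cancel mult_right_cancel)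
    then have "?l \<Gamma>' k \<bullet> K_subst k \<Gamma> ?a = - ?l \<Gamma> k \<bullet> ?a"
      by (simp only: of_real_eq_iff)
    moreover have "j \<noteq> k" using ne kk by auto
    then have "K_subst k \<Gamma> ?a = ?a + axis k (of_int (pos_part (- exch \<Gamma> $ k $ j)))"
      by (simp add: K_subst_axis)
    ultimately have "- pos_row \<sigma> \<Gamma>' k $ j - pos_row \<sigma> \<Gamma>' k $ k * of_int (pos_part (- exch \<Gamma> $ k $ j)) = pos_row \<sigma> \<Gamma> k $ j"
      by (simp add: inner_axis inner_add_right)
    then show False
      using ne kk \<sigma> by (auto simp: pos_row_def \<Gamma>' pos_part_def max_def split: if_splits)
  qed
qed

theorem lemma111:
  fixes hbar :: real and \<Gamma> \<Gamma>' :: "'n::finite seed" and k :: 'n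
  assumes "hbar > 0" and "hbar \<notin> \<rat>"
    and "D_seed \<Gamma>"
    and "\<Gamma>' = mutation k \<Gamma>"
  shows
    "(\<forall>X \<in> {x_old hbar, xt_old hbar}.
        (\<forall>i. i \<noteq> k \<longrightarrow> (\<forall>f \<in> D_dom.
          K_fun k \<Gamma> (X \<Gamma>' i (inv (K_fun k \<Gamma>) f)) =
            (\<lambda>a. X \<Gamma> i f a + of_int (pos_part (exch \<Gamma> $ i $ k)) * X \<Gamma> k f a))) \<and>
        (\<forall>f \<in> D_dom.
          K_fun k \<Gamma> (X \<Gamma>' k (inv (K_fun k \<Gamma>) f)) = (\<lambda>a. - X \<Gamma> k f a)))
   \<and> (\<forall>X \<in> {x_new hbar, xt_new hbar}.
        (\<forall>i. i \<noteq> k \<and> exch \<Gamma> $ i $ k \<noteq> 0 \<longrightarrow> \<not> (\<forall>f \<in> D_dom.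
          K_fun k \<Gamma> (X \<Gamma>' i (inv (K_fun k \<Gamma>) f)) =
            (\<lambda>a. X \<Gamma> i f a + of_int (pos_part (exch \<Gamma> $ i $ k)) * X \<Gamma> k f a))) \<and>
        ((\<exists>j. exch \<Gamma> $ k $ j \<noteq> 0) \<longrightarrow> \<not> (\<forall>f \<in> D_dom.
          K_fun k \<Gamma> (X \<Gamma>' k (inv (K_fun k \<Gamma>) f)) = (\<lambda>a. - X \<Gamma> k f a))))
   \<and> (\<forall>X \<in> {x_old hbar, xt_old hbar}.
        (\<forall>i. unique_sa_extension (op_on_D (X \<Gamma> i)) \<and> unique_sa_extension (op_on_D (X \<Gamma>' i))) \<and>
        (\<forall>i. i \<noteq> k \<longrightarrow>
          same_sa_extension
            (op_conj (K_l2 k \<Gamma>) (op_on_D (X \<Gamma>' i)))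
            (op_add (op_on_D (X \<Gamma> i))
              (op_scale (of_int (pos_part (exch \<Gamma> $ i $ k))) (op_on_D (X \<Gamma> k)))) \<and>
          same_sa_extension
            (op_conj (K_l2 k \<Gamma>) (sa_extension (op_on_D (X \<Gamma>' i))))
            (op_add (sa_extension (op_on_D (X \<Gamma> i)))
              (op_scale (of_int (pos_part (exch \<Gamma> $ i $ k))) (sa_extension (op_on_D (X \<Gamma> k)))))) \<and>
        same_sa_extension
          (op_conj (K_l2 k \<Gamma>) (op_on_D (X \<Gamma>' k)))
          (op_scale (- 1) (op_on_D (X \<Gamma> k))) \<and>
        same_sa_extension
          (op_conj (K_l2 k \<Gamma>) (sa_extension (op_on_D (X \<Gamma>' k))))
          (op_scale (- 1) (sa_extension (op_on_D (X \<Gamma> k)))))"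
proof -
  have old: "\<exists>\<sigma>. \<forall>\<Gamma> i f a. f differentiable (at a) \<longrightarrow>
      X \<Gamma> i f a = lin_op (momentum_dir hbar \<Gamma> i) (\<sigma> *\<^sub>R exch_row \<Gamma> i) f a"
    if "X \<in> {x_old hbar, xt_old hbar}" for X :: "'n seed \<Rightarrow> 'n \<Rightarrow> (real ^ 'n \<Rightarrow> complex) \<Rightarrow> real ^ 'n \<Rightarrow> complex"
  proof -
    from that have "X = x_old hbar \<or> X = xt_old hbar"
      by simp
    then show ?thesis
    proof
      assume X: "X = x_old hbar"
      show ?thesis
        unfolding X by (intro exI[of _ "- 1"] allI impI x_old_eq_lin_op(1))
    next
      assume X: "X = xt_old hbar"
      show ?thesis
        unfolding X by (intro exI[of _ 1] allI impI x_old_eq_lin_op(2))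
    qed
  qed
  have new: "\<exists>\<sigma>. (\<sigma> = 1 \<or> \<sigma> = - 1) \<and> (\<forall>\<Gamma> i f a. f differentiable (at a) \<longrightarrow>
      X \<Gamma> i f a = lin_op (2 *\<^sub>R momentum_dir hbar \<Gamma> i) (- pos_row \<sigma> \<Gamma> i) f a)"
    if "X \<in> {x_new hbar, xt_new hbar}" for X :: "'n seed \<Rightarrow> 'n \<Rightarrow> (real ^ 'n \<Rightarrow> complex) \<Rightarrow> real ^ 'n \<Rightarrow> complex"
  proof -
    from that have "X = x_new hbar \<or> X = xt_new hbar"
      by simp
    then show ?thesis
    proof
      assume X: "X = x_new hbar"
      show ?thesis
        unfolding X by (intro exI[of _ 1] conjI allI impI x_new_eq_lin_op(1)) simp
    next
      assume X: "X = xt_new hbar"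
      show ?thesis
        unfolding X by (intro exI[of _ "- 1"] conjI allI impI x_new_eq_lin_op(2)) simp
    qed
  qed
  show ?thesis
  proof (intro conjI ballI)
    fix X :: "'n seed \<Rightarrow> 'n \<Rightarrow> (real ^ 'n \<Rightarrow> complex) \<Rightarrow> real ^ 'n \<Rightarrow> complex"
    assume "X \<in> {x_old hbar, xt_old hbar}"
    from old[OF this] obtain \<sigma> where X: "\<forall>\<Gamma> i f a. f differentiable (at a) \<longrightarrow>
        X \<Gamma> i f a = lin_op (momentum_dir hbar \<Gamma> i) (\<sigma> *\<^sub>R exch_row \<Gamma> i) f a" ..
    note * = old_operators_mutate[OF assms(3,4), of X hbar \<sigma>, OF X]
    show "\<forall>i. i \<noteq> k \<longrightarrow> (\<forall>f\<in>D_dom. K_fun k \<Gamma> (X \<Gamma>' i (inv (K_fun k \<Gamma>) f)) =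
        (\<lambda>a. X \<Gamma> i f a + of_int (pos_part (exch \<Gamma> $ i $ k)) * X \<Gamma> k f a))"
      by (intro allI impI ballI *(1))
    show "K_fun k \<Gamma> (X \<Gamma>' k (inv (K_fun k \<Gamma>) f)) = (\<lambda>a. - X \<Gamma> k f a)" if "f \<in> D_dom" for f
      using that by (rule *(2))
    show "\<forall>i. unique_sa_extension (op_on_D (X \<Gamma> i)) \<and> unique_sa_extension (op_on_D (X \<Gamma>' i))"
      by (intro allI conjI *(3,4))
    show "\<forall>i. i \<noteq> k \<longrightarrow>
          same_sa_extension
            (op_conj (K_l2 k \<Gamma>) (op_on_D (X \<Gamma>' i)))
            (op_add (op_on_D (X \<Gamma> i))
              (op_scale (of_int (pos_part (exch \<Gamma> $ i $ k))) (op_on_D (X \<Gamma> k)))) \<and>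
          same_sa_extension
            (op_conj (K_l2 k \<Gamma>) (sa_extension (op_on_D (X \<Gamma>' i))))
            (op_add (sa_extension (op_on_D (X \<Gamma> i)))
              (op_scale (of_int (pos_part (exch \<Gamma> $ i $ k))) (sa_extension (op_on_D (X \<Gamma> k)))))"
      by (intro allI impI conjI *(5,6))
    show "same_sa_extension (op_conj (K_l2 k \<Gamma>) (op_on_D (X \<Gamma>' k))) (op_scale (- 1) (op_on_D (X \<Gamma> k)))"
      by (rule *(7))
    show "same_sa_extension (op_conj (K_l2 k \<Gamma>) (sa_extension (op_on_D (X \<Gamma>' k))))
        (op_scale (- 1) (sa_extension (op_on_D (X \<Gamma> k))))"
      by (rule *(8))
  next
    fix X :: "'n seed \<Rightarrow> 'n \<Rightarrow> (real ^ 'n \<Rightarrow> complex) \<Rightarrow> real ^ 'n \<Rightarrow> complex"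
    assume "X \<in> {x_new hbar, xt_new hbar}"
    from new[OF this] obtain \<sigma> where "(\<sigma> = 1 \<or> \<sigma> = - 1) \<and> (\<forall>\<Gamma> i f a. f differentiable (at a) \<longrightarrow>
        X \<Gamma> i f a = lin_op (2 *\<^sub>R momentum_dir hbar \<Gamma> i) (- pos_row \<sigma> \<Gamma> i) f a)" ..
    then have \<sigma>: "\<sigma> = 1 \<or> \<sigma> = - 1" and X: "\<forall>\<Gamma> i f a. f differentiable (at a) \<longrightarrow>
        X \<Gamma> i f a = lin_op (2 *\<^sub>R momentum_dir hbar \<Gamma> i) (- pos_row \<sigma> \<Gamma> i) f a"
      by (rule conjunct1, rule conjunct2)
    note * = new_operators_do_not_mutate[OF assms(3,4) \<sigma>, of X hbar, OF X]
    show "\<forall>i. i \<noteq> k \<and> exch \<Gamma> $ i $ k \<noteq> 0 \<longrightarrow> \<not> (\<forall>f \<in> D_dom.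
          K_fun k \<Gamma> (X \<Gamma>' i (inv (K_fun k \<Gamma>) f)) =
            (\<lambda>a. X \<Gamma> i f a + of_int (pos_part (exch \<Gamma> $ i $ k)) * X \<Gamma> k f a))"
      using *(1) by meson
    show "(\<exists>j. exch \<Gamma> $ k $ j \<noteq> 0) \<longrightarrow> \<not> (\<forall>f \<in> D_dom.
          K_fun k \<Gamma> (X \<Gamma>' k (inv (K_fun k \<Gamma>) f)) = (\<lambda>a. - X \<Gamma> k f a))"
      using *(2) by meson
  qed
qed

end
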